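(* The following two functorial constructions are mutually inverse and induce an isomorphism of categories between operadic cloning systems and cloning PROs, which restricts to an isomorphism of categories between restricted operadic cloning systems and restricted cloning PROs. * To an operadic cloning system $(G_\bullet,\iota,\zeta,\kappa,\pi)$ assign the cloning PRO with $G(n,n)=G_n$, $\odot$ the group multiplication, $\mathrm{id}_n=e_n$, cloning maps $\kappa(m_1,\dots,m_n)=\kappa_1(m_1)\circ\kappa_2(m_2)\circ\cdots\circ\kappa_n(m_n)$, horizontal product $f\otimes g=\iota_n(m)(f)\cdot\zeta_m(n)(g)$ for $f\in G_n$, $g\in G_m$, and structure morphism $\pi^\pm:G\to\Sigma^\pm$, where $\pi^\pm(g)$ is the signed permutation with $|\pi^\pm(g)(i)|=\pi_n(g)(i)$ and with $\pi^\pm(g)(j)<0$ if and only if $\pi_{n+1}(\kappa^n_j(g))\ne c^n_j(\pi_n(g))$ $(1\le i,j\le n)$. * To a cloning PRO $(G,\odot,\otimes,\mathrm{id},\pi,\kappa)$ assign the operadic cloning system with groups $G_n=(G(n,n),\odot)$, $\iota_n(f)=f\otimes\mathrm{id}_1$, $\zeta_n(f)=\mathrm{id}_1\otimes f$, $\kappa^n_j=\kappa(1,\dots,1,2,1,\dots,1)$ ($n$ entries, with $2$ in position $j$), and homomorphisms $G_n\to\Sigma_n$, $g\mapsto(i\mapsto|\pi(g)(i)|)$. On morphisms, both constructions keep the underlying maps $G_n\to G'_n$.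
   Context: **Symmetric groups.** $\Sigma_n$ is the group of permutations of $\{1,\dots,n\}$, with product $(\sigma\tau)(i)=\sigma(\tau(i))$. Maps $\Sigma_n\to\Sigma_{n+1}$: $\lambda_n(\sigma)$ agrees with $\sigma$ on $\{1,\dots,n\}$ and fixes $n+1$; $\rho_n(\sigma)(1)=1$ and $\rho_n(\sigma)(i)=\sigma(i-1)+1$ for $i\ge2$; for $1\le j\le n$, $c^n_j(\sigma)(i)$ equals $\sigma(i)$ if $i\le j$ and $\sigma(i)\le\sigma(j)$; $\sigma(i)+1$ if $i<j$ and $\sigma(i)>\sigma(j)$; $\sigma(i-1)$ if $i>j+1$ and $\sigma(i-1)<\sigma(j)$; $\sigma(i-1)+1$ if $i\ge j+1$ and $\sigma(i-1)\ge\sigma(j)$. **Cloning systems.** A *cloning system* $(G_\bullet,\iota,\kappa,\pi)$ consists of groups $G_n$ ($n\ge1$), homomorphisms $\iota_n:G_n\to G_{n+1}$ and $\pi_n:G_n\to\Sigma_n$, and maps of sets $\kappa^n_j:G_n\to G_{n+1}$ ($1\le j\le n$) with, for all admissible indices and elements: (i) $\pi_{n+1}\iota_n=\lambda_n\pi_n$; (ii) $\pi_{n+1}(\kappa^n_j(g))(i)=c^n_j(\pi_n(g))(i)$ for $i\ne j,j+1$; (iii) $\iota_{n+1}\kappa^n_j=\kappa^{n+1}_j\iota_n$; (iv) $\kappa^{n+1}_{j+1}\kappa^n_l=\kappa^{n+1}_l\kappa^n_j$ for $l<j\le n$; (v) $\kappa^n_j(gh)=\kappa^n_{\pi_n(h)(j)}(g)\kappa^n_j(h)$.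 A *bilateral cloning system* $(G_\bullet,\iota,\zeta,\kappa,\pi)$ has in addition homomorphisms $\zeta_n:G_n\to G_{n+1}$ with (iv+) $\kappa^{n+1}_{j+1}\kappa^n_j=\kappa^{n+1}_j\kappa^n_j$; (vii) $\iota_{n+1}\iota_n=\kappa^{n+1}_{n+1}\iota_n$; (i') $\pi_{n+1}\zeta_n=\rho_n\pi_n$; (iii') $\zeta_{n+1}\kappa^n_j=\kappa^{n+1}_{j+1}\zeta_n$; (vi) $\zeta_{n+1}\iota_n=\iota_{n+1}\zeta_n$; (vii') $\zeta_{n+1}\zeta_n=\kappa^{n+1}_1\zeta_n$. It is *restricted* if (ii+) $\pi_{n+1}\kappa^n_j=c^n_j\pi_n$. Put $\iota_n(r)=\iota_{n+r-1}\cdots\iota_n$, $\zeta_n(l)=\zeta_{n+l-1}\cdots\zeta_n$, $\kappa_j(m)=\kappa^n_j(m)=\kappa^{n+m-2}_j\cdots\kappa^n_j:G_n\to G_{n+m-1}$ and $\nu^n_j(m)=\zeta_{n+m-j}(j-1)\circ\iota_n(m-j):G_n\to G_{n+m-1}$ ($1\le j\le m$), with $\iota_n(0)=\zeta_n(0)=\kappa^n_j(1)=\mathrm{id}$. A bilateral cloning system is *operadic* if for all $g\in G_n$, $h\in G_m$: (viii) $\kappa^n_i(m)(g)\nu^m_i(n)(h)=\nu^m_{\pi_n(g)(i)}(n)(h)\kappa^n_i(m)(g)$ for $1\le i\le n$; (ix) $\iota_n(m)(g)\zeta_m(n)(h)=\zeta_m(n)(h)\iota_n(m)(g)$. A morphism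 of (restricted) operadic cloning systems is a family of group homomorphisms $G_n\to G'_n$ commuting with $\iota,\zeta$, all $\kappa^n_j$, and with the maps $\pi$ to $\Sigma_n$. **PROs.** A *PRO* is a family of sets $O(n,m)$, $n,m\ge1$, with an associative vertical product $\odot:O(n,t)\times O(s,n)\to O(s,t)$ with two-sided units $\mathrm{id}_n\in O(n,n)$, and an associative horizontal product $\otimes:O(n_1,m_1)\times O(n_2,m_2)\to O(n_1+n_2,m_1+m_2)$, such that $(f\otimes g)\odot(p\otimes q)=(f\odot p)\otimes(g\odot q)$ whenever this makes sense and $\mathrm{id}_n\otimes\mathrm{id}_m=\mathrm{id}_{n+m}$. Morphisms of PROs are families of maps preserving all this structure. *The PRO $\Sigma^\pm$.* $\Sigma^\pm_n$ is the group of permutations $g$ of $\{\pm1,\dots,\pm n\}$ with $g(-i)=-g(i)$; $\Sigma^\pm(n,n)=\Sigma^\pm_n$ and $\Sigma^\pm(n,m)=\emptyset$ for $n\neq m$; $\odot$ is composition; $\otimes$ is the block product: $(g\otimes h)(i)=g(i)$ for $1\le i\le n$, and $(g\otimes h)(n+i)=h(i)+n$ if $h(i)>0$, $h(i)-n$ if $h(i)<0$, for $1\le i\le m$. Its cloning maps $c(m_1,\dots,m_n):\Sigma^\pm_n\to\Sigma^\pm_{m_1+\dots+m_n}$ replace strand $i$ by $m_i$ strands, in order if $g(i)>0$ and in reversed order with negative signs if $g(i)<0$: with $N_i=\sum_{k:|g(k)|<|g(i)|}m_k$, for $1\le t\le m_i$, $c(\underline m)(g)(m_1+\dots+m_{i-1}+t)$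 equals $N_i+t$ if $g(i)>0$ and $-(N_i+m_i+1-t)$ if $g(i)<0$. $\Sigma\subset\Sigma^\pm$ is the sub-PRO of positive (ordinary) permutations. *Cloning PRO* $(G,\odot,\otimes,\mathrm{id},\pi,\kappa)$: a PRO $G$ with $G(n,m)=\emptyset$ for $n\ne m$ and each $(G(n,n),\odot)$ a group; a morphism of PROs $\pi:G\to\Sigma^\pm$; and maps $\kappa(\underline m):G(n,n)\to G(m_1+\dots+m_n,m_1+\dots+m_n)$ for every $n\ge1$ and $\underline m=(m_1,\dots,m_n)$ with $m_i\ge1$, such that $\kappa(1,\dots,1)=\mathrm{id}$; $\kappa(\underline r^1\sqcup\dots\sqcup\underline r^n)\circ\kappa(\underline m)=\kappa(\sum_jr^1_j,\dots,\sum_jr^n_j)$ whenever $\underline r^i$ is a tuple of length $m_i$ ($\sqcup$ is concatenation); and (1) $\pi\circ\kappa(\underline m)=c(\underline m)\circ\pi$; (2) $\kappa(\underline m)(\mathrm{id}_n)=\mathrm{id}_{m_1+\dots+m_n}$; (3) $\kappa(\underline m)(f)\otimes\kappa(\underline n)(g)=\kappa(\underline m\sqcup\underline n)(f\otimes g)$; (4) $\kappa(\underline m)(h\odot g)=\kappa(\underline m_{\pi(g)})(h)\odot\kappa(\underline m)(g)$, where $\underline m_{\pi(g)}=(m_{|\pi(g)^{-1}(1)|},\dots,m_{|\pi(g)^{-1}(n)|})$; ($\star$) $\kappa(\underline m)(f)\odot(g_1\otimes\dots\otimes g_n)=(g_{|\pi(f)^{-1}(1)|}\otimes\dots\otimes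 g_{|\pi(f)^{-1}(n)|})\odot\kappa(\underline m)(f)$ for $f\in G(n,n)$, $g_i\in G(m_i,m_i)$. It is *restricted* if $\pi$ takes values in $\Sigma$. Morphisms of cloning PROs are morphisms of PROs compatible with $\pi$ and with all $\kappa(\underline m)$. *)

theory Defs
  imports "HOL-Algebra.Sym_Groups"
begin

section \<open>Categories and isomorphisms of categories\<close>

record ('o, 'm) category =
  Obj :: "'o set"
  Hom :: "'o \<Rightarrow> 'o \<Rightarrow> 'm set"
  Ident :: "'o \<Rightarrow> 'm"
  Comp :: "'o \<Rightarrow> 'o \<Rightarrow> 'o \<Rightarrow> 'm \<Rightarrow> 'm \<Rightarrow> 'm"

text \<open>\<open>Comp C X Y Z g f\<close> is the composite of \<open>f : X \<rightarrow> Y\<close> and \<open>g : Y \<rightarrow> Z\<close>. Hom sets of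
  different pairs of objects need not be disjoint: an arrow is used together with its source and
  its target.\<close>

locale category =
  fixes C :: "('o, 'm) category"
  assumes ident_hom: "X \<in> Obj C \<Longrightarrow> Ident C X \<in> Hom C X X"
    and comp_hom: "\<lbrakk>X \<in> Obj C; Y \<in> Obj C; Z \<in> Obj C; f \<in> Hom C X Y; g \<in> Hom C Y Z\<rbrakk>
      \<Longrightarrow> Comp C X Y Z g f \<in> Hom C X Z"
    and ident_right: "\<lbrakk>X \<in> Obj C; Y \<in> Obj C; f \<in> Hom C X Y\<rbrakk>
      \<Longrightarrow> Comp C X X Y f (Ident C X) = f"
    and ident_left: "\<lbrakk>X \<in> Obj C; Y \<in> Obj C; f \<in> Hom C X Y\<rbrakk>
      \<Longrightarrow> Comp C X Y Y (Ident C Y) f = f"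
    and comp_assoc: "\<lbrakk>W \<in> Obj C; X \<in> Obj C; Y \<in> Obj C; Z \<in> Obj C;
        f \<in> Hom C W X; g \<in> Hom C X Y; h \<in> Hom C Y Z\<rbrakk>
      \<Longrightarrow> Comp C W Y Z h (Comp C W X Y g f) = Comp C W X Z (Comp C X Y Z h g) f"

locale category_functor = source: category C + target: category D
  for C :: "('o, 'm) category" and D :: "('p, 'n) category" +
  fixes Fo :: "'o \<Rightarrow> 'p" and Fa :: "'o \<Rightarrow> 'o \<Rightarrow> 'm \<Rightarrow> 'n"
  assumes obj_map: "X \<in> Obj C \<Longrightarrow> Fo X \<in> Obj D"
    and hom_map: "\<lbrakk>X \<in> Obj C; Y \<in> Obj C; f \<in> Hom C X Y\<rbrakk> \<Longrightarrow> Fa X Y f \<in> Hom D (Fo X) (Fo Y)"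
    and map_ident: "X \<in> Obj C \<Longrightarrow> Fa X X (Ident C X) = Ident D (Fo X)"
    and map_comp: "\<lbrakk>X \<in> Obj C; Y \<in> Obj C; Z \<in> Obj C; f \<in> Hom C X Y; g \<in> Hom C Y Z\<rbrakk>
      \<Longrightarrow> Fa X Z (Comp C X Y Z g f) = Comp D (Fo X) (Fo Y) (Fo Z) (Fa Y Z g) (Fa X Y f)"

locale mutually_inverse_functors = F: category_functor C D Fo Fa + G: category_functor D C Go Ga
  for C :: "('o, 'm) category" and D :: "('p, 'n) category" and Fo Fa Go Ga +
  assumes GF_obj: "X \<in> Obj C \<Longrightarrow> Go (Fo X) = X"
    and GF_hom: "\<lbrakk>X \<in> Obj C; Y \<in> Obj C; f \<in> Hom C X Y\<rbrakk> \<Longrightarrow> Ga (Fo X) (Fo Y) (Fa X Y f) = f"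
    and FG_obj: "P \<in> Obj D \<Longrightarrow> Fo (Go P) = P"
    and FG_hom: "\<lbrakk>P \<in> Obj D; Q \<in> Obj D; g \<in> Hom D P Q\<rbrakk> \<Longrightarrow> Fa (Go P) (Go Q) (Ga P Q g) = g"

definition full_subcategory :: "('o, 'm) category \<Rightarrow> ('o \<Rightarrow> bool) \<Rightarrow> ('o, 'm) category" where
  "full_subcategory C Q = C\<lparr>Obj := {X \<in> Obj C. Q X}\<rparr>"


section \<open>The maps between symmetric groups\<close>

text \<open>Elements of \<open>sym_group n\<close> are permutations of \<open>nat\<close> that are the identity outside
  \<open>{1..n}\<close>; the maps below are completed accordingly.\<close>

definition sym_left :: "nat \<Rightarrow> (nat \<Rightarrow> nat) \<Rightarrow> nat \<Rightarrow> nat" where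
  "sym_left n \<sigma> i = (if i \<in> {1..n} then \<sigma> i else i)"

definition sym_right :: "nat \<Rightarrow> (nat \<Rightarrow> nat) \<Rightarrow> nat \<Rightarrow> nat" where
  "sym_right n \<sigma> i = (if i = 1 then 1 else if i \<in> {2..n + 1} then \<sigma> (i - 1) + 1 else i)"

definition sym_clone :: "nat \<Rightarrow> nat \<Rightarrow> (nat \<Rightarrow> nat) \<Rightarrow> nat \<Rightarrow> nat" where
  "sym_clone n j \<sigma> i =
    (if i \<notin> {1..n + 1} then i
     else if i \<le> j \<and> \<sigma> i \<le> \<sigma> j then \<sigma> i
     else if i < j \<and> \<sigma> i > \<sigma> j then \<sigma> i + 1
     else if i > j + 1 \<and> \<sigma> (i - 1) < \<sigma> j then \<sigma> (i - 1)
     else \<sigma> (i - 1) + 1)"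


section \<open>Cloning systems\<close>

text \<open>The groups are \<open>grp S n\<close> for \<open>n \<ge> 1\<close>, and \<open>proj S n\<close> is the homomorphism \<open>\<pi>\<^sub>n\<close>.\<close>

record 'a cloning_data =
  grp :: "nat \<Rightarrow> 'a monoid"
  iota :: "nat \<Rightarrow> 'a \<Rightarrow> 'a"
  kappa :: "nat \<Rightarrow> nat \<Rightarrow> 'a \<Rightarrow> 'a"
  proj :: "nat \<Rightarrow> 'a \<Rightarrow> nat \<Rightarrow> nat"

record 'a bilateral_cloning_data = "'a cloning_data" +
  zeta :: "nat \<Rightarrow> 'a \<Rightarrow> 'a"

locale cloning_system =
  fixes S :: "('a, 'b) cloning_data_scheme"
  assumes grp_group: "n \<ge> 1 \<Longrightarrow> group (grp S n)"
    and iota_hom: "n \<ge> 1 \<Longrightarrow> iota S n \<in> hom (grp S n) (grp S (n + 1))"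
    and proj_hom: "n \<ge> 1 \<Longrightarrow> proj S n \<in> hom (grp S n) (sym_group n)"
    and kappa_closed: "\<lbrakk>1 \<le> j; j \<le> n\<rbrakk>
      \<Longrightarrow> kappa S n j \<in> carrier (grp S n) \<rightarrow> carrier (grp S (n + 1))"
    and proj_iota: "\<lbrakk>n \<ge> 1; g \<in> carrier (grp S n)\<rbrakk>
      \<Longrightarrow> proj S (n + 1) (iota S n g) = sym_left n (proj S n g)"
    and proj_kappa: "\<lbrakk>1 \<le> j; j \<le> n; g \<in> carrier (grp S n); i \<in> {1..n + 1}; i \<noteq> j; i \<noteq> j + 1\<rbrakk>
      \<Longrightarrow> proj S (n + 1) (kappa S n j g) i = sym_clone n j (proj S n g) i"
    and iota_kappa: "\<lbrakk>1 \<le> j; j \<le> n; g \<in> carrier (grp S n)\<rbrakk>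
      \<Longrightarrow> iota S (n + 1) (kappa S n j g) = kappa S (n + 1) j (iota S n g)"
    and kappa_kappa: "\<lbrakk>1 \<le> l; l < j; j \<le> n; g \<in> carrier (grp S n)\<rbrakk>
      \<Longrightarrow> kappa S (n + 1) (j + 1) (kappa S n l g) = kappa S (n + 1) l (kappa S n j g)"
    and kappa_mult: "\<lbrakk>1 \<le> j; j \<le> n; g \<in> carrier (grp S n); h \<in> carrier (grp S n)\<rbrakk>
      \<Longrightarrow> kappa S n j (g \<otimes>\<^bsub>grp S n\<^esub> h)
        = kappa S n (proj S n h j) g \<otimes>\<^bsub>grp S (n + 1)\<^esub> kappa S n j h"

locale bilateral_cloning_system = cloning_system S
  for S :: "('a, 'b) bilateral_cloning_data_scheme" +
  assumes zeta_hom: "n \<ge> 1 \<Longrightarrow> zeta S n \<in> hom (grp S n) (grp S (n + 1))"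
    and kappa_kappa_same: "\<lbrakk>1 \<le> j; j \<le> n; g \<in> carrier (grp S n)\<rbrakk>
      \<Longrightarrow> kappa S (n + 1) (j + 1) (kappa S n j g) = kappa S (n + 1) j (kappa S n j g)"
    and iota_iota: "\<lbrakk>n \<ge> 1; g \<in> carrier (grp S n)\<rbrakk>
      \<Longrightarrow> iota S (n + 1) (iota S n g) = kappa S (n + 1) (n + 1) (iota S n g)"
    and proj_zeta: "\<lbrakk>n \<ge> 1; g \<in> carrier (grp S n)\<rbrakk>
      \<Longrightarrow> proj S (n + 1) (zeta S n g) = sym_right n (proj S n g)"
    and zeta_kappa: "\<lbrakk>1 \<le> j; j \<le> n; g \<in> carrier (grp S n)\<rbrakk>
      \<Longrightarrow> zeta S (n + 1) (kappa S n j g) = kappa S (n + 1) (j + 1) (zeta S n g)"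
    and zeta_iota: "\<lbrakk>n \<ge> 1; g \<in> carrier (grp S n)\<rbrakk>
      \<Longrightarrow> zeta S (n + 1) (iota S n g) = iota S (n + 1) (zeta S n g)"
    and zeta_zeta: "\<lbrakk>n \<ge> 1; g \<in> carrier (grp S n)\<rbrakk>
      \<Longrightarrow> zeta S (n + 1) (zeta S n g) = kappa S (n + 1) 1 (zeta S n g)"

definition restricted_system :: "('a, 'b) bilateral_cloning_data_scheme \<Rightarrow> bool" where
  "restricted_system S \<longleftrightarrow>
    (\<forall>n j. \<forall>g \<in> carrier (grp S n). 1 \<le> j \<longrightarrow> j \<le> n \<longrightarrow>
      proj S (n + 1) (kappa S n j g) = sym_clone n j (proj S n g))"

primrec iota_iter :: "('a, 'b) bilateral_cloning_data_scheme \<Rightarrow> nat \<Rightarrow> nat \<Rightarrow> 'a \<Rightarrow> 'a" where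
  "iota_iter S n 0 g = g"
| "iota_iter S n (Suc r) g = iota S (n + r) (iota_iter S n r g)"

primrec zeta_iter :: "('a, 'b) bilateral_cloning_data_scheme \<Rightarrow> nat \<Rightarrow> nat \<Rightarrow> 'a \<Rightarrow> 'a" where
  "zeta_iter S n 0 g = g"
| "zeta_iter S n (Suc l) g = zeta S (n + l) (zeta_iter S n l g)"

text \<open>\<open>kappa_iter S n j m\<close> is \<open>\<kappa>\<^sup>n\<^sub>j(m)\<close>, which has \<open>m - 1\<close> factors; only \<open>m \<ge> 1\<close> is meaningful.\<close>

primrec kappa_iter :: "('a, 'b) bilateral_cloning_data_scheme \<Rightarrow> nat \<Rightarrow> nat \<Rightarrow> nat \<Rightarrow> 'a \<Rightarrow> 'a" where
  "kappa_iter S n j 0 g = g"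
| "kappa_iter S n j (Suc m) g =
    (if m = 0 then g else kappa S (n + m - 1) j (kappa_iter S n j m g))"

definition nu :: "('a, 'b) bilateral_cloning_data_scheme \<Rightarrow> nat \<Rightarrow> nat \<Rightarrow> nat \<Rightarrow> 'a \<Rightarrow> 'a" where
  "nu S n j m g = zeta_iter S (n + m - j) (j - 1) (iota_iter S n (m - j) g)"

locale operadic_cloning_system = bilateral_cloning_system S
  for S :: "('a, 'b) bilateral_cloning_data_scheme" +
  assumes kappa_nu: "\<lbrakk>m \<ge> 1; 1 \<le> i; i \<le> n; g \<in> carrier (grp S n); h \<in> carrier (grp S m)\<rbrakk>
      \<Longrightarrow> kappa_iter S n i m g \<otimes>\<^bsub>grp S (n + m - 1)\<^esub> nu S m i n h
        = nu S m (proj S n g i) n h \<otimes>\<^bsub>grp S (n + m - 1)\<^esub> kappa_iter S n i m g"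
    and iota_zeta_commute: "\<lbrakk>n \<ge> 1; m \<ge> 1; g \<in> carrier (grp S n); h \<in> carrier (grp S m)\<rbrakk>
      \<Longrightarrow> iota_iter S n m g \<otimes>\<^bsub>grp S (n + m)\<^esub> zeta_iter S m n h
        = zeta_iter S m n h \<otimes>\<^bsub>grp S (n + m)\<^esub> iota_iter S n m g"

definition system_morphism ::
  "('a, 'c) bilateral_cloning_data_scheme \<Rightarrow> ('b, 'd) bilateral_cloning_data_scheme
    \<Rightarrow> (nat \<Rightarrow> 'a \<Rightarrow> 'b) \<Rightarrow> bool" where
  "system_morphism S T \<phi> \<longleftrightarrow>
    (\<forall>n \<ge> 1. \<phi> n \<in> hom (grp S n) (grp T n) \<and>
      (\<forall>g \<in> carrier (grp S n).
        \<phi> (n + 1) (iota S n g) = iota T n (\<phi> n g) \<and>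
        \<phi> (n + 1) (zeta S n g) = zeta T n (\<phi> n g) \<and>
        (\<forall>j \<in> {1..n}. \<phi> (n + 1) (kappa S n j g) = kappa T n j (\<phi> n g)) \<and>
        proj T n (\<phi> n g) = proj S n g))"


section \<open>PROs\<close>

text \<open>\<open>Ops P n m\<close> is \<open>O(n,m)\<close> for \<open>n, m \<ge> 1\<close>; \<open>vert P s n t\<close> is the vertical product
  \<open>O(n,t) \<times> O(s,n) \<rightarrow> O(s,t)\<close>; \<open>hor P n\<^sub>1 m\<^sub>1 n\<^sub>2 m\<^sub>2\<close> is the horizontal product
  \<open>O(n\<^sub>1,m\<^sub>1) \<times> O(n\<^sub>2,m\<^sub>2) \<rightarrow> O(n\<^sub>1+n\<^sub>2,m\<^sub>1+m\<^sub>2)\<close>.\<close>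

record 'a pro_data =
  Ops :: "nat \<Rightarrow> nat \<Rightarrow> 'a set"
  vert :: "nat \<Rightarrow> nat \<Rightarrow> nat \<Rightarrow> 'a \<Rightarrow> 'a \<Rightarrow> 'a"
  hor :: "nat \<Rightarrow> nat \<Rightarrow> nat \<Rightarrow> nat \<Rightarrow> 'a \<Rightarrow> 'a \<Rightarrow> 'a"
  idn :: "nat \<Rightarrow> 'a"

locale pro =
  fixes P :: "('a, 'b) pro_data_scheme"
  assumes idn_closed: "n \<ge> 1 \<Longrightarrow> idn P n \<in> Ops P n n"
    and vert_closed: "\<lbrakk>s \<ge> 1; n \<ge> 1; t \<ge> 1; f \<in> Ops P n t; g \<in> Ops P s n\<rbrakk>
      \<Longrightarrow> vert P s n t f g \<in> Ops P s t"
    and vert_assoc: "\<lbrakk>r \<ge> 1; s \<ge> 1; n \<ge> 1; t \<ge> 1; f \<in> Ops P n t; g \<in> Ops P s n; h \<in> Ops P r s\<rbrakk>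
      \<Longrightarrow> vert P r s t (vert P s n t f g) h = vert P r n t f (vert P r s n g h)"
    and vert_idn_left: "\<lbrakk>n \<ge> 1; m \<ge> 1; f \<in> Ops P n m\<rbrakk> \<Longrightarrow> vert P n m m (idn P m) f = f"
    and vert_idn_right: "\<lbrakk>n \<ge> 1; m \<ge> 1; f \<in> Ops P n m\<rbrakk> \<Longrightarrow> vert P n n m f (idn P n) = f"
    and hor_closed: "\<lbrakk>n\<^sub>1 \<ge> 1; m\<^sub>1 \<ge> 1; n\<^sub>2 \<ge> 1; m\<^sub>2 \<ge> 1; f \<in> Ops P n\<^sub>1 m\<^sub>1; g \<in> Ops P n\<^sub>2 m\<^sub>2\<rbrakk>
      \<Longrightarrow> hor P n\<^sub>1 m\<^sub>1 n\<^sub>2 m\<^sub>2 f g \<in> Ops P (n\<^sub>1 + n\<^sub>2) (m\<^sub>1 + m\<^sub>2)"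
    and hor_assoc: "\<lbrakk>n\<^sub>1 \<ge> 1; m\<^sub>1 \<ge> 1; n\<^sub>2 \<ge> 1; m\<^sub>2 \<ge> 1; n\<^sub>3 \<ge> 1; m\<^sub>3 \<ge> 1;
        f \<in> Ops P n\<^sub>1 m\<^sub>1; g \<in> Ops P n\<^sub>2 m\<^sub>2; h \<in> Ops P n\<^sub>3 m\<^sub>3\<rbrakk>
      \<Longrightarrow> hor P (n\<^sub>1 + n\<^sub>2) (m\<^sub>1 + m\<^sub>2) n\<^sub>3 m\<^sub>3 (hor P n\<^sub>1 m\<^sub>1 n\<^sub>2 m\<^sub>2 f g) h
        = hor P n\<^sub>1 m\<^sub>1 (n\<^sub>2 + n\<^sub>3) (m\<^sub>2 + m\<^sub>3) f (hor P n\<^sub>2 m\<^sub>2 n\<^sub>3 m\<^sub>3 g h)"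
    and interchange: "\<lbrakk>s\<^sub>1 \<ge> 1; n\<^sub>1 \<ge> 1; t\<^sub>1 \<ge> 1; s\<^sub>2 \<ge> 1; n\<^sub>2 \<ge> 1; t\<^sub>2 \<ge> 1;
        f \<in> Ops P n\<^sub>1 t\<^sub>1; g \<in> Ops P n\<^sub>2 t\<^sub>2; p \<in> Ops P s\<^sub>1 n\<^sub>1; q \<in> Ops P s\<^sub>2 n\<^sub>2\<rbrakk>
      \<Longrightarrow> vert P (s\<^sub>1 + s\<^sub>2) (n\<^sub>1 + n\<^sub>2) (t\<^sub>1 + t\<^sub>2) (hor P n\<^sub>1 t\<^sub>1 n\<^sub>2 t\<^sub>2 f g) (hor P s\<^sub>1 n\<^sub>1 s\<^sub>2 n\<^sub>2 p q)
        = hor P s\<^sub>1 t\<^sub>1 s\<^sub>2 t\<^sub>2 (vert P s\<^sub>1 n\<^sub>1 t\<^sub>1 f p) (vert P s\<^sub>2 n\<^sub>2 t\<^sub>2 g q)"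
    and hor_idn: "\<lbrakk>n \<ge> 1; m \<ge> 1\<rbrakk> \<Longrightarrow> hor P n n m m (idn P n) (idn P m) = idn P (n + m)"

definition pro_morphism ::
  "('a, 'c) pro_data_scheme \<Rightarrow> ('b, 'd) pro_data_scheme
    \<Rightarrow> (nat \<Rightarrow> nat \<Rightarrow> 'a \<Rightarrow> 'b) \<Rightarrow> bool" where
  "pro_morphism P Q F \<longleftrightarrow>
    (\<forall>n \<ge> 1. \<forall>m \<ge> 1. F n m \<in> Ops P n m \<rightarrow> Ops Q n m) \<and>
    (\<forall>n \<ge> 1. F n n (idn P n) = idn Q n) \<and>
    (\<forall>s \<ge> 1. \<forall>n \<ge> 1. \<forall>t \<ge> 1. \<forall>f \<in> Ops P n t. \<forall>g \<in> Ops P s n.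
      F s t (vert P s n t f g) = vert Q s n t (F n t f) (F s n g)) \<and>
    (\<forall>n\<^sub>1 \<ge> 1. \<forall>m\<^sub>1 \<ge> 1. \<forall>n\<^sub>2 \<ge> 1. \<forall>m\<^sub>2 \<ge> 1. \<forall>f \<in> Ops P n\<^sub>1 m\<^sub>1. \<forall>g \<in> Ops P n\<^sub>2 m\<^sub>2.
      F (n\<^sub>1 + n\<^sub>2) (m\<^sub>1 + m\<^sub>2) (hor P n\<^sub>1 m\<^sub>1 n\<^sub>2 m\<^sub>2 f g)
        = hor Q n\<^sub>1 m\<^sub>1 n\<^sub>2 m\<^sub>2 (F n\<^sub>1 m\<^sub>1 f) (F n\<^sub>2 m\<^sub>2 g))"


section \<open>The PRO of signed permutations\<close>

definition signed_perms :: "nat \<Rightarrow> (int \<Rightarrow> int) set" where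
  "signed_perms n = {g. g permutes ({- int n..int n} - {0}) \<and> (\<forall>i. g (- i) = - g i)}"

definition positive_perms :: "nat \<Rightarrow> (int \<Rightarrow> int) set" where
  "positive_perms n = {g \<in> signed_perms n. \<forall>i \<in> {1..int n}. g i > 0}"

text \<open>The odd map that agrees with \<open>f\<close> on \<open>{1..n}\<close> and is the identity outside
  \<open>{\<plusminus>1,\<dots>,\<plusminus>n}\<close>.\<close>

definition odd_extension :: "nat \<Rightarrow> (nat \<Rightarrow> int) \<Rightarrow> int \<Rightarrow> int" where
  "odd_extension n f i = (if i \<noteq> 0 \<and> \<bar>i\<bar> \<le> int n then sgn i * f (nat \<bar>i\<bar>) else i)"

definition signed_block :: "nat \<Rightarrow> nat \<Rightarrow> (int \<Rightarrow> int) \<Rightarrow> (int \<Rightarrow> int) \<Rightarrow> int \<Rightarrow> int" where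
  "signed_block n m g h = odd_extension (n + m)
    (\<lambda>i. if i \<le> n then g (int i)
         else if h (int (i - n)) > 0 then h (int (i - n)) + int n
         else h (int (i - n)) - int n)"

definition signed_pro :: "(int \<Rightarrow> int) pro_data" where
  "signed_pro =
    \<lparr>Ops = (\<lambda>n m. if n = m then signed_perms n else {}),
     vert = (\<lambda>s n t. (\<circ>)),
     hor = (\<lambda>n\<^sub>1 m\<^sub>1 n\<^sub>2 m\<^sub>2. signed_block n\<^sub>1 n\<^sub>2),
     idn = (\<lambda>n. id)\<rparr>"

text \<open>A position \<open>p\<close> is written as \<open>m\<^sub>1 + \<dots> + m\<^sub>i\<^sub>-\<^sub>1 + t\<close> with \<open>1 \<le> t \<le> m\<^sub>i\<close>: the strand \<open>i\<close> is the
  least one with \<open>p \<le> m\<^sub>1 + \<dots> + m\<^sub>i\<close>. Lists are indexed from 0, so \<open>m\<^sub>i\<close> is \<open>ms ! (i - 1)\<close>.\<close>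

definition signed_clone :: "nat list \<Rightarrow> (int \<Rightarrow> int) \<Rightarrow> int \<Rightarrow> int" where
  "signed_clone ms g = odd_extension (sum_list ms)
    (\<lambda>p. let i = (LEAST i. p \<le> sum_list (take i ms));
             t = p - sum_list (take (i - 1) ms);
             N = (\<Sum>k | k \<in> {1..length ms} \<and> \<bar>g (int k)\<bar> < \<bar>g (int i)\<bar>. ms ! (k - 1))
         in if g (int i) > 0 then int (N + t)
            else - int (N + ms ! (i - 1) + 1 - t))"


section \<open>Cloning PROs\<close>

record 'a cloning_pro_data = "'a pro_data" +
  Proj :: "nat \<Rightarrow> nat \<Rightarrow> 'a \<Rightarrow> int \<Rightarrow> int"
  Kappa :: "nat list \<Rightarrow> 'a \<Rightarrow> 'a"

definition valid_tuple :: "nat list \<Rightarrow> bool" where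
  "valid_tuple ms \<longleftrightarrow> ms \<noteq> [] \<and> (\<forall>m \<in> set ms. m \<ge> 1)"

definition diag_grp :: "('a, 'b) pro_data_scheme \<Rightarrow> nat \<Rightarrow> 'a monoid" where
  "diag_grp P n = \<lparr>carrier = Ops P n n, mult = vert P n n n, one = idn P n\<rparr>"

text \<open>The tuple of the \<open>|\<pi>(g)\<^sup>-\<^sup>1(i)|\<close>-th entries of \<open>xs\<close>, for \<open>1 \<le> i \<le> length xs\<close>.\<close>

definition permute_tuple :: "(int \<Rightarrow> int) \<Rightarrow> 'c list \<Rightarrow> 'c list" where
  "permute_tuple p xs =
    map (\<lambda>i. xs ! (nat \<bar>Hilbert_Choice.inv p (int i)\<bar> - 1)) [1..<length xs + 1]"

text \<open>\<open>hor_list P ms gs\<close> is \<open>g\<^sub>1 \<otimes> \<dots> \<otimes> g\<^sub>n\<close> for \<open>g\<^sub>i \<in> O(m\<^sub>i,m\<^sub>i)\<close> and \<open>n \<ge> 1\<close>.\<close>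

fun hor_list :: "('a, 'b) pro_data_scheme \<Rightarrow> nat list \<Rightarrow> 'a list \<Rightarrow> 'a" where
  "hor_list P [m] [g] = g"
| "hor_list P (m # ms) (g # gs) = hor P m m (sum_list ms) (sum_list ms) g (hor_list P ms gs)"
| "hor_list P _ _ = undefined"

locale cloning_pro = pro P
  for P :: "('a, 'b) cloning_pro_data_scheme" +
  assumes off_diagonal: "\<lbrakk>n \<ge> 1; m \<ge> 1; n \<noteq> m\<rbrakk> \<Longrightarrow> Ops P n m = {}"
    and diag_group: "n \<ge> 1 \<Longrightarrow> group (diag_grp P n)"
    and Proj_morphism: "pro_morphism P signed_pro (Proj P)"
    and Kappa_closed: "valid_tuple ms
      \<Longrightarrow> Kappa P ms \<in> Ops P (length ms) (length ms) \<rightarrow> Ops P (sum_list ms) (sum_list ms)"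
    and Kappa_ones: "\<lbrakk>n \<ge> 1; f \<in> Ops P n n\<rbrakk> \<Longrightarrow> Kappa P (replicate n 1) f = f"
    and Kappa_Kappa: "\<lbrakk>rs \<noteq> []; \<forall>r \<in> set rs. valid_tuple r;
        f \<in> Ops P (length rs) (length rs)\<rbrakk>
      \<Longrightarrow> Kappa P (concat rs) (Kappa P (map length rs) f) = Kappa P (map sum_list rs) f"
    and Proj_Kappa: "\<lbrakk>valid_tuple ms; f \<in> Ops P (length ms) (length ms)\<rbrakk>
      \<Longrightarrow> Proj P (sum_list ms) (sum_list ms) (Kappa P ms f)
        = signed_clone ms (Proj P (length ms) (length ms) f)"
    and Kappa_idn: "valid_tuple ms \<Longrightarrow> Kappa P ms (idn P (length ms)) = idn P (sum_list ms)"
    and Kappa_hor: "\<lbrakk>valid_tuple ms; valid_tuple ns;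
        f \<in> Ops P (length ms) (length ms); g \<in> Ops P (length ns) (length ns)\<rbrakk>
      \<Longrightarrow> hor P (sum_list ms) (sum_list ms) (sum_list ns) (sum_list ns) (Kappa P ms f) (Kappa P ns g)
        = Kappa P (ms @ ns) (hor P (length ms) (length ms) (length ns) (length ns) f g)"
    and Kappa_vert: "\<lbrakk>valid_tuple ms; n = length ms; k = sum_list ms;
        h \<in> Ops P n n; g \<in> Ops P n n\<rbrakk>
      \<Longrightarrow> Kappa P ms (vert P n n n h g)
        = vert P k k k (Kappa P (permute_tuple (Proj P n n g) ms) h) (Kappa P ms g)"
    and Kappa_star: "\<lbrakk>valid_tuple ms; n = length ms; k = sum_list ms; f \<in> Ops P n n;
        length gs = n; \<forall>i < n. gs ! i \<in> Ops P (ms ! i) (ms ! i)\<rbrakk>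
      \<Longrightarrow> vert P k k k (Kappa P ms f) (hor_list P ms gs)
        = vert P k k k
            (hor_list P (permute_tuple (Proj P n n f) ms) (permute_tuple (Proj P n n f) gs))
            (Kappa P ms f)"

definition restricted_pro :: "('a, 'b) cloning_pro_data_scheme \<Rightarrow> bool" where
  "restricted_pro P \<longleftrightarrow> (\<forall>n \<ge> 1. \<forall>f \<in> Ops P n n. Proj P n n f \<in> positive_perms n)"

definition cloning_pro_morphism ::
  "('a, 'c) cloning_pro_data_scheme \<Rightarrow> ('b, 'd) cloning_pro_data_scheme
    \<Rightarrow> (nat \<Rightarrow> nat \<Rightarrow> 'a \<Rightarrow> 'b) \<Rightarrow> bool" where
  "cloning_pro_morphism P Q F \<longleftrightarrow>
    pro_morphism P Q F \<and>
    (\<forall>n \<ge> 1. \<forall>m \<ge> 1. \<forall>f \<in> Ops P n m. Proj Q n m (F n m f) = Proj P n m f) \<and>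
    (\<forall>ms. valid_tuple ms \<longrightarrow> (\<forall>f \<in> Ops P (length ms) (length ms).
      F (sum_list ms) (sum_list ms) (Kappa P ms f) = Kappa Q ms (F (length ms) (length ms) f)))"


section \<open>The two categories\<close>

text \<open>All structures of the theory are families of partially defined operations, while HOL functions
  are total. For objects (and arrows) to be determined by their mathematical content, so that
  equality of objects in an isomorphism of categories is meaningful, every operation is required to
  take the value \<open>undefined\<close> outside its domain, and the unused components of arity 0 are
  empty. This is no restriction: every structure agrees, on the domains of its operations,
  with exactly one such structure.\<close>

definition extensional2 :: "'a set \<Rightarrow> 'b set \<Rightarrow> ('a \<Rightarrow> 'b \<Rightarrow> 'c) \<Rightarrow> bool" where
  "extensional2 A B f \<longleftrightarrow> (\<forall>x y. \<not> (x \<in> A \<and> y \<in> B) \<longrightarrow> f x y = undefined)"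

definition restrict2 :: "'a set \<Rightarrow> 'b set \<Rightarrow> ('a \<Rightarrow> 'b \<Rightarrow> 'c) \<Rightarrow> 'a \<Rightarrow> 'b \<Rightarrow> 'c" where
  "restrict2 A B f x y = (if x \<in> A \<and> y \<in> B then f x y else undefined)"

definition extensional_system :: "'a bilateral_cloning_data \<Rightarrow> bool" where
  "extensional_system S \<longleftrightarrow>
    carrier (grp S 0) = {} \<and> one (grp S 0) = undefined \<and>
    (\<forall>n. extensional2 (carrier (grp S n)) (carrier (grp S n)) (mult (grp S n)) \<and>
         iota S n \<in> extensional (carrier (grp S n)) \<and>
         zeta S n \<in> extensional (carrier (grp S n)) \<and>
         proj S n \<in> extensional (carrier (grp S n))) \<and>
    (\<forall>n j. kappa S n j \<in> extensional (if 1 \<le> j \<and> j \<le> n then carrier (grp S n) else {}))"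

definition extensional_pro :: "'a cloning_pro_data \<Rightarrow> bool" where
  "extensional_pro P \<longleftrightarrow>
    idn P 0 = undefined \<and>
    (\<forall>n. Ops P n 0 = {} \<and> Ops P 0 n = {}) \<and>
    (\<forall>s n t. extensional2 (Ops P n t) (Ops P s n) (vert P s n t)) \<and>
    (\<forall>n\<^sub>1 m\<^sub>1 n\<^sub>2 m\<^sub>2. extensional2 (Ops P n\<^sub>1 m\<^sub>1) (Ops P n\<^sub>2 m\<^sub>2) (hor P n\<^sub>1 m\<^sub>1 n\<^sub>2 m\<^sub>2)) \<and>
    (\<forall>n m. Proj P n m \<in> extensional (Ops P n m)) \<and>
    (\<forall>ms. Kappa P ms \<in> extensional
      (if valid_tuple ms then Ops P (length ms) (length ms) else {}))"

definition operadic_systems :: "('a bilateral_cloning_data, nat \<Rightarrow> 'a \<Rightarrow> 'a) category" where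
  "operadic_systems =
    \<lparr>Obj = {S. operadic_cloning_system S \<and> extensional_system S},
     Hom = (\<lambda>S T. {\<phi>. system_morphism S T \<phi> \<and> (\<forall>n. \<phi> n \<in> extensional (carrier (grp S n)))}),
     Ident = (\<lambda>S n. \<lambda>g \<in> carrier (grp S n). g),
     Comp = (\<lambda>S T U \<psi> \<phi> n. compose (carrier (grp S n)) (\<psi> n) (\<phi> n))\<rparr>"

definition cloning_pros :: "('a cloning_pro_data, nat \<Rightarrow> nat \<Rightarrow> 'a \<Rightarrow> 'a) category" where
  "cloning_pros =
    \<lparr>Obj = {P. cloning_pro P \<and> extensional_pro P},
     Hom = (\<lambda>P Q. {F. cloning_pro_morphism P Q F \<and> (\<forall>n m. F n m \<in> extensional (Ops P n m))}),
     Ident = (\<lambda>P n m. \<lambda>f \<in> Ops P n m. f),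
     Comp = (\<lambda>P Q R G F n m. compose (Ops P n m) (G n m) (F n m))\<rparr>"

definition restricted_operadic_systems ::
  "('a bilateral_cloning_data, nat \<Rightarrow> 'a \<Rightarrow> 'a) category" where
  "restricted_operadic_systems = full_subcategory operadic_systems restricted_system"

definition restricted_cloning_pros ::
  "('a cloning_pro_data, nat \<Rightarrow> nat \<Rightarrow> 'a \<Rightarrow> 'a) category" where
  "restricted_cloning_pros = full_subcategory cloning_pros restricted_pro"


section \<open>The two constructions\<close>

text \<open>For \<open>ms = [m\<^sub>j, \<dots>, m\<^sub>n]\<close>, \<open>clone_tail S n j ms\<close> is \<open>\<kappa>\<^sub>j(m\<^sub>j) \<circ> \<dots> \<circ> \<kappa>\<^sub>n(m\<^sub>n)\<close> on \<open>G\<^sub>n\<close>; the factor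
  \<open>\<kappa>\<^sub>j(m\<^sub>j)\<close> is applied in arity \<open>n + (m\<^sub>j\<^sub>+\<^sub>1 - 1) + \<dots> + (m\<^sub>n - 1)\<close>.\<close>

primrec clone_tail ::
  "('a, 'b) bilateral_cloning_data_scheme \<Rightarrow> nat \<Rightarrow> nat \<Rightarrow> nat list \<Rightarrow> 'a \<Rightarrow> 'a" where
  "clone_tail S n j [] g = g"
| "clone_tail S n j (m # ms) g =
    kappa_iter S (n + sum_list ms - length ms) j m (clone_tail S n (j + 1) ms g)"

definition signed_proj ::
  "('a, 'b) bilateral_cloning_data_scheme \<Rightarrow> nat \<Rightarrow> 'a \<Rightarrow> int \<Rightarrow> int" where
  "signed_proj S n g = odd_extension n
    (\<lambda>j. if proj S (n + 1) (kappa S n j g) \<noteq> sym_clone n j (proj S n g)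
         then - int (proj S n g j) else int (proj S n g j))"

definition pro_of_system :: "'a bilateral_cloning_data \<Rightarrow> 'a cloning_pro_data" where
  "pro_of_system S = (let O' = \<lambda>n m. if n = m \<and> n \<ge> 1 then carrier (grp S n) else {} in
    \<lparr>Ops = O',
     vert = (\<lambda>s n t. restrict2 (O' n t) (O' s n) (\<lambda>f g. f \<otimes>\<^bsub>grp S n\<^esub> g)),
     hor = (\<lambda>n\<^sub>1 m\<^sub>1 n\<^sub>2 m\<^sub>2. restrict2 (O' n\<^sub>1 m\<^sub>1) (O' n\<^sub>2 m\<^sub>2)
       (\<lambda>f g. iota_iter S n\<^sub>1 n\<^sub>2 f \<otimes>\<^bsub>grp S (n\<^sub>1 + n\<^sub>2)\<^esub> zeta_iter S n\<^sub>2 n\<^sub>1 g)),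
     idn = (\<lambda>n. \<one>\<^bsub>grp S n\<^esub>),
     Proj = (\<lambda>n m. restrict (signed_proj S n) (O' n m)),
     Kappa = (\<lambda>ms. restrict (clone_tail S (length ms) 1 ms)
       (if valid_tuple ms then O' (length ms) (length ms) else {}))\<rparr>)"

definition system_of_pro :: "'a cloning_pro_data \<Rightarrow> 'a bilateral_cloning_data" where
  "system_of_pro P =
    \<lparr>grp = diag_grp P,
     iota = (\<lambda>n. \<lambda>f \<in> Ops P n n. hor P n n 1 1 f (idn P 1)),
     kappa = (\<lambda>n j. restrict (Kappa P (replicate (j - 1) 1 @ [2] @ replicate (n - j) 1))
       (if 1 \<le> j \<and> j \<le> n then Ops P n n else {})),
     proj = (\<lambda>n. \<lambda>f \<in> Ops P n n. \<lambda>i. if i \<in> {1..n} then nat \<bar>Proj P n n f (int i)\<bar> else i),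
     zeta = (\<lambda>n. \<lambda>f \<in> Ops P n n. hor P 1 1 n n (idn P 1) f)\<rparr>"

text \<open>On arrows both constructions keep the underlying maps \<open>G\<^sub>n \<rightarrow> G'\<^sub>n\<close>; off the diagonal an arrow
  of cloning PROs consists of maps on empty sets.\<close>

definition pro_arrow :: "(nat \<Rightarrow> 'a \<Rightarrow> 'a) \<Rightarrow> nat \<Rightarrow> nat \<Rightarrow> 'a \<Rightarrow> 'a" where
  "pro_arrow \<phi> n m = (if n = m then \<phi> n else (\<lambda>_. undefined))"

definition system_arrow :: "(nat \<Rightarrow> nat \<Rightarrow> 'a \<Rightarrow> 'a) \<Rightarrow> nat \<Rightarrow> 'a \<Rightarrow> 'a" where
  "system_arrow F n = F n n"

end

theory Submission
  imports Defs
begin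

text \<open>The cloning maps \<open>\<kappa>(m)\<close> are generated by the elementary ones: if the strand \<open>p\<close> lies in
  the \<open>i\<close>-th block of \<open>m\<close>, then \<open>\<kappa>\<^sub>p \<circ> \<kappa>(m) = \<kappa>(m + e\<^sub>i)\<close>. Every tuple is reached
  from \<open>(1,\<dots>,1)\<close> by such increments, so that each axiom of a cloning PRO reduces by induction to the
  effect of one \<open>\<kappa>\<^sub>p\<close>. The signs are controlled in the same way: by axiom (ii), \<open>\<pi>(\<kappa>\<^sub>j g)\<close> is either
  \<open>c\<^sub>j(\<pi> g)\<close> or differs from it by a swap of the strands \<open>j\<close> and \<open>j + 1\<close>, and comparing the two
  expressions of a double cloning given by (iv) and (iv+) shows that both copies of a strand inherit
  its sign. For \<open>(\<star>)\<close>, both sides are multiplicative in \<open>(g\<^sub>1,\<dots>,g\<^sub>n)\<close>, which leaves the case of one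
  nontrivial \<open>g\<^sub>i\<close>; this is axiom (viii) with the other strands cloned. Conversely, the axioms of an
  operadic cloning system are instances of those of a cloning PRO.\<close>

subsection \<open>Tuples\<close>

text \<open>The position p in the increment rule may be any strand of its block. Axiom (4) relies on
  this freedom: (v) moves p to its image, which lies in the expected block but, when the sign is
  negative, at the opposite place in it. Axiom (ii) says nothing about the strands j and j + 1, and
  this gap is where signs come from: a bijection that is prescribed elsewhere can only keep or
  exchange the two remaining targets. The product rule for signs is (v) seen on the first copy of a
  strand. Nothing is lost in passing from a signed \<pi> to its absolute value, because doubling a
  signed permutation at j projects to c_j of its absolute value exactly when its value at j is
  positive. Axiom (viii) survives cloning of the other strands because an element inserted in one
  block fixes all strands outside it: (v) then keeps the index on that side, and cloning the
  inserted element only adds trivial strands next to it. Objects are compared as records of total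
  functions, so the inverse laws must also match arity 0 and the default values.\<close>

text \<open>Strands and positions \<open>p\<close> are numbered from 1, the entries of a tuple from 0.\<close>

definition in_block :: "nat list \<Rightarrow> nat \<Rightarrow> nat \<Rightarrow> bool" where
  "in_block ms i p \<longleftrightarrow> i < length ms \<and> sum_list (take i ms) < p \<and> p \<le> sum_list (take (Suc i) ms)"

definition incr :: "nat list \<Rightarrow> nat \<Rightarrow> nat list" where
  "incr ms i = ms[i := Suc (ms ! i)]"

lemma length_incr [simp]: "length (incr ms i) = length ms"
  by (simp add: incr_def)

lemma nth_incr: "k < length ms \<Longrightarrow> incr ms i ! k = (if k = i then Suc (ms ! i) else ms ! k)"
  by (simp add: incr_def)

lemma sum_list_take_Suc:
  fixes ms :: "nat list"
  shows "i < length ms \<Longrightarrow> sum_list (take (Suc i) ms) = sum_list (take i ms) + ms ! i"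
  by (simp add: take_Suc_conv_app_nth)

lemma sum_list_take_incr:
  "i < length ms \<Longrightarrow> sum_list (take k (incr ms i)) = sum_list (take k ms) + (if i < k then 1 else 0)"
proof (induction ms arbitrary: i k)
  case (Cons m ms)
  then show ?case
    by (cases i; cases k) (auto simp: incr_def)
qed simp

lemma sum_list_incr [simp]: "i < length ms \<Longrightarrow> sum_list (incr ms i) = Suc (sum_list ms)"
  using sum_list_take_incr[of i ms "length ms"] by simp

lemma sum_list_drop_incr:
  assumes "i < length ms"
  shows "sum_list (drop k (incr ms i)) = sum_list (drop k ms) + (if i < k then 0 else 1)"
proof -
  have "sum_list (take k xs) + sum_list (drop k xs) = sum_list xs" for xs :: "nat list"
    by (metis append_take_drop_id sum_list.append)
  from this[of ms] this[of "incr ms i"] show ?thesis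
    using assms by (auto simp: sum_list_take_incr split: if_splits)
qed

lemma valid_tuple_nth: "valid_tuple ms \<longleftrightarrow> ms \<noteq> [] \<and> (\<forall>i < length ms. 1 \<le> ms ! i)"
  by (auto simp: valid_tuple_def all_set_conv_all_nth)

lemma valid_tuple_incr: "valid_tuple ms \<Longrightarrow> valid_tuple (incr ms i)"
  by (cases "i < length ms")
    (auto simp: valid_tuple_nth nth_incr incr_def list_update_beyond nth_list_update)

lemma valid_tuple_ge_length:
  assumes "valid_tuple ms"
  shows "length ms \<le> sum_list ms"
proof -
  have "\<forall>m \<in> set ms. 1 \<le> m \<Longrightarrow> length ms \<le> sum_list ms"
    by (induction ms) auto
  then show ?thesis
    using assms by (auto simp: valid_tuple_def)
qed

lemma sum_list_take_mono:
  fixes ms :: "nat list"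
  assumes "i \<le> j"
  shows "sum_list (take i ms) \<le> sum_list (take j ms)"
proof -
  have "take j ms = take i ms @ take (j - i) (drop i ms)"
    using assms by (metis le_add_diff_inverse take_add)
  then show ?thesis
    by simp
qed

lemma in_block_bounds: "in_block ms i p \<Longrightarrow> 1 \<le> p \<and> p \<le> sum_list ms"
  using sum_list_take_mono[of "Suc i" "length ms" ms] by (auto simp: in_block_def)

lemma in_block_exists:
  assumes "1 \<le> p" "p \<le> sum_list ms"
  obtains i where "in_block ms i p"
proof -
  let ?i = "LEAST i. p \<le> sum_list (take i ms)"
  have ex: "p \<le> sum_list (take (length ms) ms)"
    using assms by simp
  have 1: "p \<le> sum_list (take ?i ms)"
    by (rule LeastI[where P = "\<lambda>i. p \<le> sum_list (take i ms)", OF ex])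
  have 2: "?i \<le> length ms"
    by (rule Least_le[where P = "\<lambda>i. p \<le> sum_list (take i ms)", OF ex])
  have 3: "?i \<noteq> 0"
    using 1 assms by (intro notI) simp
  have "\<not> p \<le> sum_list (take (?i - 1) ms)"
    by (rule not_less_Least) (use 3 in simp)
  then have "in_block ms (?i - 1) p"
    using 1 2 3 by (auto simp: in_block_def)
  then show ?thesis
    using that by blast
qed

lemma in_block_unique:
  assumes "in_block ms i p" "in_block ms j p"
  shows "i = j"
  using assms sum_list_take_mono[of "Suc i" j ms] sum_list_take_mono[of "Suc j" i ms]
  by (cases i j rule: linorder_cases) (auto simp: in_block_def)

text \<open>Translates the \<open>LEAST\<close> in \<open>signed_clone\<close> into blocks. The
  successor appears because strands are numbered from 1 there and entries from 0 here.\<close>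

lemma in_block_LEAST:
  assumes "in_block ms i p"
  shows "(LEAST i. p \<le> sum_list (take i ms)) = Suc i"
proof (rule Least_equality)
  show "p \<le> sum_list (take (Suc i) ms)"
    using assms by (simp add: in_block_def)
next
  fix j assume "p \<le> sum_list (take j ms)"
  then show "Suc i \<le> j"
    using assms sum_list_take_mono[of j i ms] by (force simp: in_block_def not_less_eq_eq)
qed

text \<open>Lengthening the block of \<open>p\<close> doubles \<open>p\<close>: the new positions
  \<open>p\<close> and \<open>p + 1\<close> both come from the old \<open>p\<close>, and later
  positions move up by one. The conditional recovers the old position, as in
  \<open>sym_clone\<close>.\<close>

lemma in_block_incr:
  assumes "in_block ms i p"
  shows "in_block (incr ms i) k q \<longleftrightarrow> in_block ms k (if q \<le> p then q else q - 1)"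
proof -
  have "k < i \<Longrightarrow> sum_list (take (Suc k) ms) \<le> sum_list (take i ms)"
    "k > i \<Longrightarrow> sum_list (take (Suc i) ms) \<le> sum_list (take k ms)"
    by (simp_all add: sum_list_take_mono)
  then show ?thesis
    using assms
    by (cases k i rule: linorder_cases) (auto simp: in_block_def sum_list_take_incr simp del: take_Suc)
qed

lemma in_block_last: "valid_tuple ms \<Longrightarrow> i < length ms \<Longrightarrow> in_block ms i (sum_list (take (Suc i) ms))"
  using sum_list_take_Suc[of i ms] by (fastforce simp: in_block_def valid_tuple_nth)

lemma in_block_replicate: "in_block (replicate n (Suc 0)) i p \<longleftrightarrow> i < n \<and> p = Suc i"
  by (auto simp: in_block_def sum_list_replicate min_def)

text \<open>The start \<open>ms0\<close> is arbitrary, so that statements about sums can begin at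
  the zero tuple and (viii) at a tuple with one large entry. The bounds on \<open>xs\<close> are
  handed to the step because they forbid touching an entry that already has its final value.\<close>

lemma tuple_induct [consumes 2, case_names base incr]:
  fixes ms ms0 :: "nat list"
  assumes "length ms0 = length ms" "\<And>i. i < length ms \<Longrightarrow> ms0 ! i \<le> ms ! i"
    and base: "P ms0"
    and incr: "\<And>xs i. \<lbrakk>length xs = length ms; i < length ms; xs ! i < ms ! i;
        \<And>k. k < length ms \<Longrightarrow> ms0 ! k \<le> xs ! k; P xs\<rbrakk> \<Longrightarrow> P (incr xs i)"
  shows "P ms"
proof -
  have "P xs" if "length xs = length ms" "\<And>k. k < length ms \<Longrightarrow> ms0 ! k \<le> xs ! k \<and> xs ! k \<le> ms ! k" for xs
    using that
  proof (induction "sum_list xs" arbitrary: xs rule: less_induct)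
    case less
    show ?case
    proof (cases "xs = ms0")
      case True
      then show ?thesis
        using base by simp
    next
      case False
      then obtain i where i: "i < length ms" "xs ! i \<noteq> ms0 ! i"
        using less.prems assms(1) by (metis nth_equalityI)
      with less.prems have lt: "ms0 ! i < xs ! i"
        by (metis le_neq_implies_less)
      \<comment> \<open>Some entry exceeds the one of \<open>ms0\<close>; lowering it exhibits
        \<open>xs\<close> as an increment of a tuple with smaller sum.\<close>
      define ys where "ys = xs[i := xs ! i - 1]"
      have xs: "xs = incr ys i"
        using i lt less.prems by (simp add: ys_def incr_def)
      have ly: "length ys = length ms"
        using less.prems by (simp add: ys_def)
      have yk: "ms0 ! k \<le> ys ! k \<and> ys ! k \<le> ms ! k" if "k < length ms" for k
        using less.prems(2)[OF that] lt less.prems(1) that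
        by (cases "k = i") (auto simp: ys_def nth_list_update)
      have "sum_list ys < sum_list xs"
        using i ly by (simp add: xs)
      then have "P ys"
        using less.hyps ly yk by blast
      moreover have "ys ! i < ms ! i"
        using less.prems(2)[OF i(1)] lt less.prems(1) i by (auto simp: ys_def)
      ultimately show ?thesis
        unfolding xs using incr ly yk i by blast
    qed
  qed
  then show ?thesis
    using assms(2) by blast
qed

lemma valid_tuple_induct [consumes 1, case_names ones incr]:
  assumes "valid_tuple ms"
    and "P (replicate (length ms) 1)"
    and "\<And>xs i. \<lbrakk>valid_tuple xs; length xs = length ms; i < length ms; P xs\<rbrakk> \<Longrightarrow> P (incr xs i)"
  shows "P ms"
proof (rule tuple_induct[where ?ms0.0 = "replicate (length ms) 1" and P = P])
  show "P (incr xs i)"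
    if "length xs = length ms" "i < length ms" "xs ! i < ms ! i"
      "\<And>k. k < length ms \<Longrightarrow> replicate (length ms) 1 ! k \<le> xs ! k" "P xs" for xs i
  proof -
    have "valid_tuple xs"
      using that(1,2,4) by (force simp: valid_tuple_nth)
    then show ?thesis
      using assms(3) that by blast
  qed
qed (use assms in \<open>auto simp: valid_tuple_nth\<close>)

lemma incr_append1: "i < length ms \<Longrightarrow> incr (ms @ ns) i = incr ms i @ ns"
  by (simp add: incr_def nth_append list_update_append1)

lemma incr_append2: "incr (ms @ ns) (length ms + i) = ms @ incr ns i"
  by (simp add: incr_def nth_append list_update_append)

text \<open>Identifies the concatenation by which elementary cloning is written in
  \<open>system_of_pro\<close> with one increment of (1,...,1).\<close>

lemma incr_ones:
  assumes "1 \<le> j" "j \<le> n"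
  shows "replicate (j - 1) 1 @ [2] @ replicate (n - j) 1 = incr (replicate n 1) (j - 1)"
  by (rule nth_equalityI) (use assms in \<open>auto simp: incr_def nth_append nth_Cons' nth_list_update\<close>)


subsection \<open>Signed permutations\<close>

text \<open>Exactly what makes a function on the integers determined by its values at 1,...,n. It
  holds by construction for every \<open>odd_extension\<close>, before bijectivity is known, so
  equalities of signed permutations are checked on positive strands only.\<close>

definition odd_map :: "nat \<Rightarrow> (int \<Rightarrow> int) \<Rightarrow> bool" where
  "odd_map n h \<longleftrightarrow> (\<forall>i. h (- i) = - h i) \<and> (\<forall>i. \<bar>i\<bar> > int n \<longrightarrow> h i = i)"

text \<open>The permutation |h| of strands, completed by the identity in the convention of
  \<open>sym_group\<close>.\<close>

definition unsigned :: "nat \<Rightarrow> (int \<Rightarrow> int) \<Rightarrow> nat \<Rightarrow> nat" where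
  "unsigned n h i = (if i \<in> {1..n} then nat \<bar>h (int i)\<bar> else i)"

lemma odd_map_odd_extension [simp]: "odd_map n (odd_extension n f)"
  by (auto simp: odd_map_def odd_extension_def sgn_minus)

lemma odd_extension_nat: "1 \<le> p \<Longrightarrow> p \<le> n \<Longrightarrow> odd_extension n f (int p) = f p"
  by (simp add: odd_extension_def)

lemma odd_map_eqI:
  assumes "odd_map n h" "odd_map n h'" "\<And>p. 1 \<le> p \<Longrightarrow> p \<le> n \<Longrightarrow> h (int p) = h' (int p)"
  shows "h = h'"
proof
  fix i :: int
  have z: "h 0 = 0" "h' 0 = 0"
    using assms(1,2) unfolding odd_map_def by (metis add.inverse_neutral equal_neg_zero)+
  consider "\<bar>i\<bar> > int n" | "i = 0" | "1 \<le> i" "i \<le> int n" | "1 \<le> - i" "- i \<le> int n"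
    by linarith
  then show "h i = h' i"
  proof cases
    case 3
    then show ?thesis
      using assms(3)[of "nat i"] by simp
  next
    case 4
    then have "h (- i) = h' (- i)"
      using assms(3)[of "nat (- i)"] by simp
    then show ?thesis
      using assms(1,2) by (simp add: odd_map_def)
  qed (use assms z in \<open>auto simp: odd_map_def\<close>)
qed

lemma signed_perms_odd_map: "h \<in> signed_perms n \<Longrightarrow> odd_map n h"
  unfolding signed_perms_def odd_map_def
  by (auto intro!: permutes_not_in[where S = "{- int n..int n} - {0}"])

lemma signed_perms_in_range:
  assumes "h \<in> signed_perms n" "1 \<le> p" "p \<le> n"
  shows "h (int p) \<noteq> 0" "\<bar>h (int p)\<bar> \<le> int n"
proof -
  have "h (int p) \<in> {- int n..int n} - {0}"
    using assms by (subst permutes_in_image) (auto simp: signed_perms_def)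
  then show "h (int p) \<noteq> 0" "\<bar>h (int p)\<bar> \<le> int n"
    by auto
qed

lemma signed_perms_inj: "h \<in> signed_perms n \<Longrightarrow> inj h"
  by (auto simp: signed_perms_def permutes_inj)

text \<open>If |h(i)| = |h(j)|, then h(i) is h(j) or h(-j) by oddness, and i = -j is impossible for
  positive strands.\<close>

lemma unsigned_permutes:
  assumes h: "h \<in> signed_perms n"
  shows "unsigned n h permutes {1..n}"
proof (rule bij_imp_permutes)
  have "inj_on (unsigned n h) {1..n}"
  proof (rule inj_onI)
    fix i j assume ij: "i \<in> {1..n}" "j \<in> {1..n}" "unsigned n h i = unsigned n h j"
    then have "\<bar>h (int i)\<bar> = \<bar>h (int j)\<bar>"
      by (auto simp: unsigned_def)
    then consider "h (int i) = h (int j)" | "h (int i) = h (- int j)"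
      using signed_perms_odd_map[OF h] by (auto simp: odd_map_def abs_eq_iff)
    then show "i = j"
      using ij by cases (auto dest!: injD[OF signed_perms_inj[OF h]])
  qed
  moreover have "unsigned n h ` {1..n} \<subseteq> {1..n}"
    using signed_perms_in_range[OF h] by (fastforce simp: unsigned_def)
  ultimately show "bij_betw (unsigned n h) {1..n} {1..n}"
    by (simp add: bij_betw_def endo_inj_surj)
qed (auto simp: unsigned_def)

text \<open>Signs may be chosen freely over a permutation of the strands; this is how the signed map
  built from \<open>proj\<close> and \<open>flips\<close> is seen to be a signed
  permutation.\<close>

lemma signed_permsI:
  assumes odd: "odd_map n h" and u: "unsigned n h permutes {1..n}"
  shows "h \<in> signed_perms n"
proof -
  let ?A = "{- int n..int n} - {0}"
  have z: "h 0 = 0"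
    using odd unfolding odd_map_def by (metis add.inverse_neutral equal_neg_zero)
  have abs: "\<bar>h i\<bar> = int (unsigned n h (nat \<bar>i\<bar>))" if "i \<in> ?A" for i
  proof (cases "i > 0")
    case False
    then have "h i = - h (int (nat \<bar>i\<bar>))"
      using odd by (simp add: odd_map_def)
    then show ?thesis
      using that by (auto simp: unsigned_def)
  qed (use that in \<open>auto simp: unsigned_def\<close>)
  have in_A: "nat \<bar>i\<bar> \<in> {1..n}" if "i \<in> ?A" for i
    using that by auto
  have maps: "\<bar>h i\<bar> \<in> {1..int n}" if "i \<in> ?A" for i
    using abs[OF that] permutes_in_image[OF u, of "nat \<bar>i\<bar>"] in_A[OF that] by auto
  have "inj_on h ?A"
  proof (rule inj_onI)
    fix i j assume ij: "i \<in> ?A" "j \<in> ?A" "h i = h j"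
    then have "unsigned n h (nat \<bar>i\<bar>) = unsigned n h (nat \<bar>j\<bar>)"
      using abs[OF ij(1)] abs[OF ij(2)] by simp
    then have "nat \<bar>i\<bar> = nat \<bar>j\<bar>"
      by (rule injD[OF permutes_inj[OF u]])
    then have "i = j \<or> i = - j"
      by linarith
    moreover have "h (- j) = - h j" "h j \<noteq> 0"
      using odd maps[OF ij(2)] by (auto simp: odd_map_def)
    ultimately show "i = j"
      using ij(3) by auto
  qed
  moreover have "h ` ?A \<subseteq> ?A"
    using maps by fastforce
  ultimately have "bij_betw h ?A ?A"
    by (simp add: bij_betw_def endo_inj_surj)
  then have "h permutes ?A"
    by (rule bij_imp_permutes) (use odd z in \<open>auto simp: odd_map_def\<close>)
  then show ?thesis
    using odd by (simp add: signed_perms_def odd_map_def)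
qed

lemma unsigned_nat: "1 \<le> p \<Longrightarrow> p \<le> n \<Longrightarrow> int (unsigned n h p) = \<bar>h (int p)\<bar>"
  by (simp add: unsigned_def)

lemma unsigned_in:
  "h \<in> signed_perms n \<Longrightarrow> i < n \<Longrightarrow> 1 \<le> unsigned n h (Suc i) \<and> unsigned n h (Suc i) \<le> n"
  using permutes_in_image[OF unsigned_permutes, of h n "Suc i"] by auto

lemma unsigned_index_surj:
  assumes "h \<in> signed_perms n" "k < n"
  obtains i where "i < n" "unsigned n h (Suc i) - 1 = k"
proof -
  have "Suc k \<in> unsigned n h ` {1..n}"
    using permutes_image[OF unsigned_permutes[OF assms(1)]] assms(2) by auto
  then obtain p where "p \<in> {1..n}" "unsigned n h p = Suc k"
    by auto
  then show ?thesis
    using that[of "p - 1"] by auto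
qed

lemma unsigned_index_eq_iff:
  assumes "h \<in> signed_perms n" "i < n" "k < n"
  shows "unsigned n h (Suc i) - 1 = unsigned n h (Suc k) - 1 \<longleftrightarrow> i = k"
  using unsigned_in[OF assms(1,2)] unsigned_in[OF assms(1,3)]
    inj_eq[OF permutes_inj[OF unsigned_permutes[OF assms(1)]], of "Suc i" "Suc k"] by linarith

lemma length_permute_tuple [simp]: "length (permute_tuple h xs) = length xs"
  by (simp add: permute_tuple_def del: upt_Suc)

text \<open>Replaces the inverse in \<open>permute_tuple\<close> by the forward rule: entry i moves
  to place |h(i)|. All later arguments use this form and never the inverse.\<close>

lemma nth_permute_tuple:
  assumes h: "h \<in> signed_perms (length xs)" and i: "i < length xs"
  shows "permute_tuple h xs ! (unsigned (length xs) h (Suc i) - 1) = xs ! i"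
proof -
  let ?u = "unsigned (length xs) h (Suc i)"
  have u: "1 \<le> ?u" "?u \<le> length xs" "int ?u = \<bar>h (int (Suc i))\<bar>"
    using unsigned_in[OF h i] i by (auto simp: unsigned_nat simp del: of_nat_Suc)
  have "h (- int (Suc i)) = - h (int (Suc i))"
    using signed_perms_odd_map[OF h] unfolding odd_map_def by blast
  \<comment> \<open>The preimage of \<open>?u\<close> is the strand or its negative, depending on
    the sign; the absolute value in \<open>permute_tuple\<close> makes both cases agree.\<close>
  then have "h (int (Suc i)) = int ?u \<or> h (- int (Suc i)) = int ?u"
    using u(3) by linarith
  then have "\<bar>Hilbert_Choice.inv h (int ?u)\<bar> = int (Suc i)"
  proof
    assume "h (int (Suc i)) = int ?u"
    then show ?thesis
      using inv_f_f[OF signed_perms_inj[OF h], of "int (Suc i)"] by simp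
  next
    assume "h (- int (Suc i)) = int ?u"
    then show ?thesis
      using inv_f_f[OF signed_perms_inj[OF h], of "- int (Suc i)"] by simp
  qed
  moreover have "[1..<length xs + 1] ! (?u - 1) = ?u"
    using u by (subst nth_upt) auto
  ultimately show ?thesis
    using u i by (simp add: permute_tuple_def nth_map del: upt_Suc of_nat_Suc)
qed

text \<open>Every index has the form |h(i)|, so comparing the lists at these places is
  enough.\<close>

lemma permute_tuple_eqI:
  assumes h: "h \<in> signed_perms (length xs)" and "length ys = length xs"
    and "\<And>i. i < length xs \<Longrightarrow> ys ! (unsigned (length xs) h (Suc i) - 1) = xs ! i"
  shows "permute_tuple h xs = ys"
proof (rule nth_equalityI)
  fix k assume "k < length (permute_tuple h xs)"
  then obtain i where "i < length xs" "unsigned (length xs) h (Suc i) - 1 = k"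
    using unsigned_index_surj[OF h] by auto
  then show "permute_tuple h xs ! k = ys ! k"
    using nth_permute_tuple[OF h] assms(3) by metis
qed (use assms in simp)

lemma permute_tuple_replicate:
  "h \<in> signed_perms n \<Longrightarrow> permute_tuple h (replicate n x) = replicate n x"
  by (rule permute_tuple_eqI) (auto dest: unsigned_in)

lemma permute_tuple_list_update:
  assumes h: "h \<in> signed_perms (length xs)" and i: "i < length xs"
  shows "permute_tuple h (xs[i := x]) = (permute_tuple h xs)[unsigned (length xs) h (Suc i) - 1 := x]"
proof (rule permute_tuple_eqI)
  fix k assume "k < length (xs[i := x])"
  then have k: "k < length xs"
    by simp
  have "unsigned (length xs) h (Suc k) - 1 < length xs"
    using unsigned_in[OF h k] by auto
  then show "(permute_tuple h xs)[unsigned (length xs) h (Suc i) - 1 := x] !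
      (unsigned (length (xs[i := x])) h (Suc k) - 1) = xs[i := x] ! k"
    using unsigned_index_eq_iff[OF h i k] nth_permute_tuple[OF h k] k
    by (auto simp: nth_list_update)
qed (use h in auto)

text \<open>Permuting turns m + e_i into the permuted tuple plus e_k with k = |h(i)|; this carries
  the increment induction through every axiom that involves a permuted tuple.\<close>

lemma permute_tuple_incr:
  fixes ms :: "nat list"
  assumes h: "h \<in> signed_perms (length ms)" and i: "i < length ms"
  shows "permute_tuple h (incr ms i) = incr (permute_tuple h ms) (unsigned (length ms) h (Suc i) - 1)"
  unfolding incr_def using permute_tuple_list_update[OF h i] nth_permute_tuple[OF h i] by simp

text \<open>Both sums vanish on the zero tuple and grow by one with each increment, so no reindexing
  of sums is needed.\<close>

lemma sum_list_permute_tuple: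
  fixes ms :: "nat list"
  assumes h: "h \<in> signed_perms (length ms)"
  shows "sum_list (permute_tuple h ms) = sum_list ms"
proof (rule tuple_induct[where ms = ms and ?ms0.0 = "replicate (length ms) 0"
      and P = "\<lambda>xs :: nat list. sum_list (permute_tuple h xs) = sum_list xs"])
  show "sum_list (permute_tuple h (replicate (length ms) 0)) = sum_list (replicate (length ms) 0)"
    using h by (simp add: permute_tuple_replicate)
next
  fix xs :: "nat list" and i
  assume xs: "length xs = length ms" "i < length ms" "sum_list (permute_tuple h xs) = sum_list xs"
  have "unsigned (length ms) h (Suc i) - 1 < length ms"
    using unsigned_in[OF h xs(2)] by auto
  then show "sum_list (permute_tuple h (incr xs i)) = sum_list (incr xs i)"
    using h xs by (simp add: permute_tuple_incr)
qed auto

lemma valid_permute_tuple: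
  assumes "valid_tuple ms" and h: "h \<in> signed_perms (length ms)"
  shows "valid_tuple (permute_tuple h ms)"
  unfolding valid_tuple_nth
proof (intro conjI allI impI)
  fix k assume "k < length (permute_tuple h ms)"
  then obtain i where "i < length ms" "unsigned (length ms) h (Suc i) - 1 = k"
    using unsigned_index_surj[OF h] by auto
  then show "1 \<le> permute_tuple h ms ! k"
    using nth_permute_tuple[OF h, of i] assms(1) by (auto simp: valid_tuple_nth)
next
  show "permute_tuple h ms \<noteq> []"
    using assms(1) length_permute_tuple[of h ms]
      by (auto simp: valid_tuple_def simp del: length_permute_tuple)
qed


subsection \<open>Cloning signed permutations\<close>

text \<open>The number N_i in the formula for c(m), with entries counted from 0.\<close>

definition offset :: "nat list \<Rightarrow> (int \<Rightarrow> int) \<Rightarrow> nat \<Rightarrow> nat" where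
  "offset ms h i = (\<Sum>k | k < length ms \<and> \<bar>h (int (Suc k))\<bar> < \<bar>h (int (Suc i))\<bar>. ms ! k)"

lemma signed_clone_block:
  assumes p: "in_block ms i p"
  shows "signed_clone ms h (int p) =
    (if h (int (Suc i)) > 0 then int (offset ms h i + (p - sum_list (take i ms)))
     else - int (offset ms h i + ms ! i + 1 - (p - sum_list (take i ms))))"
proof -
  have "(\<Sum>k | k \<in> {1..length ms} \<and> \<bar>h (int k)\<bar> < \<bar>h (int (Suc i))\<bar>. ms ! (k - 1)) = offset ms h i"
    unfolding offset_def
    by (rule sum.reindex_bij_witness[where i = Suc and j = "\<lambda>k. k - 1"]) auto
  then show ?thesis
    using in_block_bounds[OF p]
    unfolding signed_clone_def by (subst odd_extension_nat)
      (simp_all only: in_block_LEAST[OF p] Let_def diff_Suc_1)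
qed

text \<open>The same formula with integer instead of truncated subtraction, suited to linear
  arithmetic.\<close>

lemma signed_clone_block_int:
  assumes p: "in_block ms i p"
  shows "signed_clone ms h (int p) =
    (if h (int (Suc i)) > 0 then int (offset ms h i) + (int p - int (sum_list (take i ms)))
     else - (int (offset ms h i) + int (ms ! i) + 1 - (int p - int (sum_list (take i ms)))))"
  using p sum_list_take_Suc[of i ms] unfolding signed_clone_block[OF p] in_block_def
  by (auto simp: of_nat_diff simp del: of_nat_Suc)

lemma offset_incr:
  assumes i: "i < length ms"
  shows "offset (incr ms i) h k
    = offset ms h k + (if \<bar>h (int (Suc i))\<bar> < \<bar>h (int (Suc k))\<bar> then 1 else 0)"
proof -
  let ?A = "{l. l < length ms \<and> \<bar>h (int (Suc l))\<bar> < \<bar>h (int (Suc k))\<bar>}"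
  have "offset (incr ms i) h k = (\<Sum>l\<in>?A. ms ! l + (if l = i then 1 else 0))"
    by (auto simp: offset_def nth_incr intro!: sum.cong)
  also have "\<dots> = offset ms h k + (if i \<in> ?A then 1 else 0)"
    by (simp add: offset_def sum.distrib)
  finally show ?thesis
    using i by simp
qed

text \<open>N_i is where the target block of strand i begins in the permuted tuple. Under an
  increment of entry l both sides grow exactly when |h(l)| < |h(k)|.\<close>

lemma offset_permute_tuple:
  assumes h: "h \<in> signed_perms (length ms)" and k: "k < length ms"
  shows "sum_list (take (unsigned (length ms) h (Suc k) - 1) (permute_tuple h ms)) = offset ms h k"
proof -
  let ?u = "\<lambda>i. unsigned (length ms) h (Suc i) - 1"
  let ?P = "\<lambda>xs. sum_list (take (?u k) (permute_tuple h xs)) = offset xs h k"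
  show "?P ms"
  proof (rule tuple_induct[where ms = ms and ?ms0.0 = "replicate (length ms) 0" and P = ?P])
    show "?P (replicate (length ms) 0)"
      using h by (simp add: permute_tuple_replicate offset_def)
  next
    fix xs i
    assume xs: "length xs = length ms" "i < length ms" "?P xs"
    note u = unsigned_in[OF h xs(2)] unsigned_in[OF h k]
    have "\<bar>h (int (Suc i))\<bar> < \<bar>h (int (Suc k))\<bar> \<longleftrightarrow> ?u i < ?u k"
      using u xs(2) k unsigned_nat[of "Suc i" "length ms" h] unsigned_nat[of "Suc k" "length ms" h]
      by linarith
    moreover have "?u i < length ms"
      using u by auto
    ultimately show "?P (incr xs i)"
      using xs h by (simp add: permute_tuple_incr sum_list_take_incr offset_incr del: of_nat_Suc)
  qed auto
qed

text \<open>The target interval of block i starts after N_i and has length m_i, whichever the sign;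
  the sign only decides in which order it is filled.\<close>

lemma signed_clone_in_block:
  assumes h: "h \<in> signed_perms (length ms)" and p: "in_block ms i p"
  shows "in_block (permute_tuple h ms) (unsigned (length ms) h (Suc i) - 1)
    (nat \<bar>signed_clone ms h (int p)\<bar>)"
proof -
  have i: "i < length ms"
    using p by (simp add: in_block_def)
  have u: "unsigned (length ms) h (Suc i) - 1 < length ms"
    using unsigned_in[OF h i] by auto
  have "sum_list (take (Suc (unsigned (length ms) h (Suc i) - 1)) (permute_tuple h ms))
      = offset ms h i + ms ! i"
    using sum_list_take_Suc[of "unsigned (length ms) h (Suc i) - 1" "permute_tuple h ms"] u
      offset_permute_tuple[OF h i] nth_permute_tuple[OF h i] by simp
  moreover have "sum_list (take i ms) < p" "p \<le> sum_list (take i ms) + ms ! i"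
    using p sum_list_take_Suc[OF i] by (auto simp: in_block_def)
  ultimately show ?thesis
    unfolding in_block_def offset_permute_tuple[OF h i] signed_clone_block[OF p]
    using u by auto
qed

lemma signed_clone_ones:
  assumes h: "h \<in> signed_perms n"
  shows "signed_clone (replicate n 1) h = h"
proof (rule odd_map_eqI)
  show "odd_map n (signed_clone (replicate n 1) h)"
    by (simp add: signed_clone_def sum_list_replicate)
  show "odd_map n h"
    by (rule signed_perms_odd_map[OF h])
  fix p assume p: "1 \<le> p" "p \<le> n"
  define i where "i = p - 1"
  have i: "p = Suc i" "i < n"
    using p by (auto simp: i_def)
  have b: "in_block (replicate n 1) i p"
    using i by (simp add: in_block_replicate)
  have "offset (replicate n 1) h i = unsigned n h (Suc i) - 1"
    using offset_permute_tuple[of h "replicate n 1" i] h i unsigned_in[OF h i(2)]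
    by (simp add: permute_tuple_replicate sum_list_replicate min_def split: if_splits)
  moreover have "int (unsigned n h (Suc i)) = \<bar>h (int p)\<bar>"
    using unsigned_nat[of "Suc i" n h] i by simp
  moreover have "1 \<le> unsigned n h (Suc i)" "h (int p) \<noteq> 0"
    using unsigned_in[OF h i(2)] signed_perms_in_range[OF h p] by auto
  ultimately show "signed_clone (replicate n 1) h (int p) = h (int p)"
    unfolding signed_clone_block[OF b] using i by (auto simp: sum_list_replicate min_def)
qed

text \<open>\<open>c(1,\<dots>,1,2,1,\<dots>,1)\<close> with \<open>2\<close> in position \<open>p\<close>.\<close>

definition clone_strand :: "nat \<Rightarrow> nat \<Rightarrow> (int \<Rightarrow> int) \<Rightarrow> int \<Rightarrow> int" where
  "clone_strand n p h = odd_extension (Suc n) (\<lambda>q.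
     if q = p then (if h (int p) > 0 then h (int p) else h (int p) - 1)
     else if q = Suc p then (if h (int p) > 0 then h (int p) + 1 else h (int p))
     else let x = h (int (if q \<le> p then q else q - 1))
       in if \<bar>x\<bar> < \<bar>h (int p)\<bar> then x else x + sgn x)"

text \<open>The whole target block of i precedes that of k: the sum defining the larger offset
  contains the term of i.\<close>

lemma offset_less:
  assumes h: "h \<in> signed_perms (length ms)" and "i < length ms" "k < length ms"
    and "\<bar>h (int (Suc i))\<bar> < \<bar>h (int (Suc k))\<bar>"
  shows "offset ms h i + ms ! i \<le> offset ms h k"
proof -
  let ?A = "\<lambda>i. {l. l < length ms \<and> \<bar>h (int (Suc l))\<bar> < \<bar>h (int (Suc i))\<bar>}"
  have "offset ms h i + ms ! i = sum ((!) ms) (insert i (?A i))"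
    by (simp add: offset_def)
  also have "\<dots> \<le> sum ((!) ms) (?A k)"
    by (rule sum_mono2) (use assms in auto)
  finally show ?thesis
    by (simp add: offset_def)
qed

text \<open>The increment rule inside the signed permutations. A strand in the block of
  \<open>p\<close> has its place in that block changed; a strand of another block only has its
  offset changed, or not, according to which target block comes first.\<close>

lemma clone_strand_signed_clone:
  assumes h: "h \<in> signed_perms (length ms)" and p: "in_block ms i p"
  shows "clone_strand (sum_list ms) p (signed_clone ms h) = signed_clone (incr ms i) h"
proof (rule odd_map_eqI)
  have i: "i < length ms"
    using p by (simp add: in_block_def)
  show "odd_map (Suc (sum_list ms)) (clone_strand (sum_list ms) p (signed_clone ms h))"
    by (simp add: clone_strand_def)
  show "odd_map (Suc (sum_list ms)) (signed_clone (incr ms i) h)"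
    using i by (simp add: signed_clone_def)
  fix q assume q: "1 \<le> q" "q \<le> Suc (sum_list ms)"
  obtain k where k: "in_block (incr ms i) k q"
    using in_block_exists[of q "incr ms i"] q i by auto
  \<comment> \<open>The strand of the old tuple of which \<open>q\<close> is a copy.\<close>
  define q' where "q' = (if q \<le> p then q else q - 1)"
  have k': "in_block ms k q'"
    using k in_block_incr[OF p] by (simp add: q'_def)
  have kl: "k < length ms"
    using k' by (simp add: in_block_def)
  note T = sum_list_take_Suc[OF i] sum_list_take_Suc[OF kl]
  have pb: "sum_list (take i ms) < p" "p \<le> sum_list (take i ms) + ms ! i"
    using p T by (auto simp: in_block_def)
  have qb: "sum_list (take k ms) < q'" "q' \<le> sum_list (take k ms) + ms ! k"
    using k' T by (auto simp: in_block_def)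
  have tk: "sum_list (take k (incr ms i)) = sum_list (take k ms) + (if i < k then 1 else 0)"
    using i by (rule sum_list_take_incr)
  have lt: "i < k \<Longrightarrow> p < q" "k < i \<Longrightarrow> q < p"
    using sum_list_take_mono[of "Suc i" k ms] sum_list_take_mono[of "Suc k" i ms] pb qb T
    by (auto simp: q'_def split: if_splits)
  have ne: "\<bar>h (int (Suc i))\<bar> \<noteq> \<bar>h (int (Suc k))\<bar>" if "i \<noteq> k"
    using unsigned_index_eq_iff[OF h i kl] unsigned_nat[of "Suc i" "length ms" h]
      unsigned_nat[of "Suc k" "length ms" h] i kl that by auto
  note off = offset_incr[OF i, of h k] offset_less[OF h i kl] offset_less[OF h kl i]
  have nz: "h (int (Suc i)) \<noteq> 0" "h (int (Suc k)) \<noteq> 0"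
    using signed_perms_in_range[OF h] i kl by (auto simp del: of_nat_Suc)
  show "clone_strand (sum_list ms) p (signed_clone ms h) (int q) = signed_clone (incr ms i) h (int q)"
  proof (cases "k = i")
    case True
    define N a m where "N = int (offset ms h i)" and "a = int (sum_list (take i ms))"
      and "m = int (ms ! i)"
    have b: "a < int p" "int p \<le> a + m" "a < int q'" "int q' \<le> a + m" "0 \<le> N"
      using pb qb True by (auto simp: N_def a_def m_def)
    have vp: "signed_clone ms h (int p) = (if h (int (Suc i)) > 0 then N + (int p - a)
      else - (N + m + 1 - (int p - a)))"
      unfolding signed_clone_block_int[OF p] N_def a_def m_def ..
    have vq: "signed_clone ms h (int q')
      = (if h (int (Suc i)) > 0 then N + (int q' - a) else - (N + m + 1 - (int q' - a)))"
      unfolding signed_clone_block_int[OF k'] N_def a_def m_def True ..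
    \<comment> \<open>The enlarged block has m + 1 strands, whence m + 2 in the reversed
      case.\<close>
    have v: "signed_clone (incr ms i) h (int q) =
        (if h (int (Suc i)) > 0 then N + (int q - a) else - (N + m + 2 - (int q - a)))"
      using True i unfolding signed_clone_block_int[OF k] off(1) tk N_def a_def m_def
        nth_incr[OF kl] by auto
    have "q < p \<and> q' = q \<or> q = p \<or> q = Suc p \<or> q > Suc p \<and> int q' = int q - 1"
      by (auto simp: q'_def of_nat_diff)
    then consider "q < p" "q' = q" | "q = p" | "q = Suc p" | "q > Suc p" "int q' = int q - 1"
      by blast
    then show ?thesis
    proof cases
      case 1
      then show ?thesis
        unfolding clone_strand_def odd_extension_nat[OF q] Let_def q'_def[symmetric] vp vq v
        using b by (auto simp: sgn_if simp del: of_nat_Suc)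
    next
      case 4
      then show ?thesis
        unfolding clone_strand_def odd_extension_nat[OF q] Let_def q'_def[symmetric] vp vq v
        using b by (auto simp: sgn_if simp del: of_nat_Suc)
    qed (use b in \<open>unfold clone_strand_def odd_extension_nat[OF q] Let_def vp v, auto\<close>)
  next
    case False
    have nq: "q \<noteq> p" "q \<noteq> Suc p"
      using lt False k' p in_block_unique[of ms k p i] by (auto simp: q'_def split: if_splits)
    define t where "t = int q' - int (sum_list (take k ms))"
    define s where "s = int p - int (sum_list (take i ms))"
    have q't: "int q - int (sum_list (take k (incr ms i))) = t"
      using lt False q(1) by (cases i k rule: linorder_cases) (auto simp: tk q'_def t_def of_nat_diff)
    define N where "N = (\<lambda>j. int (offset ms h j))"
    define m where "m = (\<lambda>j. int (ms ! j))"
    have ts: "1 \<le> t" "t \<le> m k" "1 \<le> s" "s \<le> m i" "0 \<le> N i" "0 \<le> N k"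
      using pb qb by (auto simp: t_def s_def m_def N_def)
    define x y where "x = h (int (Suc i))" and "y = h (int (Suc k))"
    \<comment> \<open>The two target blocks are disjoint intervals, so comparing the images of
      \<open>p\<close> and \<open>q'\<close> amounts to comparing the blocks.\<close>
    have c: "\<bar>x\<bar> < \<bar>y\<bar> \<and> N i + m i \<le> N k \<or> \<bar>y\<bar> < \<bar>x\<bar> \<and> N k + m k \<le> N i"
      using ne[OF not_sym[OF False]] off(2,3) unfolding x_def y_def N_def m_def by linarith
    have vp: "signed_clone ms h (int p) = (if x > 0 then N i + s else - (N i + m i + 1 - s))"
      unfolding signed_clone_block_int[OF p] x_def N_def m_def s_def ..
    have vq: "signed_clone ms h (int q') = (if y > 0 then N k + t else - (N k + m k + 1 - t))"
      unfolding signed_clone_block_int[OF k'] y_def N_def m_def t_def ..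
    have v: "signed_clone (incr ms i) h (int q) =
        (let N' = N k + (if \<bar>x\<bar> < \<bar>y\<bar> then 1 else 0) in if y > 0 then N' + t else - (N' + m k + 1 - t))"
      using False unfolding signed_clone_block_int[OF k] off(1) nth_incr[OF kl] q't
      by (simp add: Let_def N_def m_def x_def y_def del: of_nat_Suc)
    have A: "clone_strand (sum_list ms) p (signed_clone ms h) (int q)
       = (if \<bar>signed_clone ms h (int q')\<bar> < \<bar>signed_clone ms h (int p)\<bar> then signed_clone ms h (int q')
          else signed_clone ms h (int q') + sgn (signed_clone ms h (int q')))"
      unfolding clone_strand_def odd_extension_nat[OF q] Let_def q'_def using nq by simp
    show ?thesis
      using c
    proof
      assume c: "\<bar>x\<bar> < \<bar>y\<bar> \<and> N i + m i \<le> N k"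
      then have "\<not> \<bar>signed_clone ms h (int q')\<bar> < \<bar>signed_clone ms h (int p)\<bar>"
        unfolding vp vq using ts by (auto split: if_splits)
      then show ?thesis
        unfolding A v Let_def using c ts by (auto simp: vq)
    next
      assume c: "\<bar>y\<bar> < \<bar>x\<bar> \<and> N k + m k \<le> N i"
      then have "\<bar>signed_clone ms h (int q')\<bar> < \<bar>signed_clone ms h (int p)\<bar>"
        unfolding vp vq using ts by (auto split: if_splits)
      then show ?thesis
        unfolding A v Let_def using c ts by (auto simp: vq)
    qed
  qed
qed

lemma clone_strand_eq_signed_clone:
  assumes "h \<in> signed_perms n" "1 \<le> p" "p \<le> n"
  shows "clone_strand n p h = signed_clone (incr (replicate n 1) (p - 1)) h"
  using clone_strand_signed_clone[of h "replicate n 1" "p - 1" p] assms signed_clone_ones[of h n]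
  by (simp add: in_block_replicate sum_list_replicate)

subsection \<open>Signs in a cloning system\<close>

text \<open>The condition that makes the value at j negative in \<open>signed_proj\<close>: the two
  copies of strand j arrive in exchanged order.\<close>

definition flips :: "('a, 'b) cloning_data_scheme \<Rightarrow> nat \<Rightarrow> nat \<Rightarrow> 'a \<Rightarrow> bool" where
  "flips S n j g \<longleftrightarrow> proj S (n + 1) (kappa S n j g) \<noteq> sym_clone n j (proj S n g)"

context cloning_system
begin

abbreviation G :: "nat \<Rightarrow> 'a set" where
  "G n \<equiv> carrier (grp S n)"

lemma proj_permutes: "n \<ge> 1 \<Longrightarrow> g \<in> G n \<Longrightarrow> proj S n g permutes {1..n}"
  using proj_hom[of n] by (auto simp: hom_def sym_group_carrier)

lemma proj_in: "1 \<le> j \<Longrightarrow> j \<le> n \<Longrightarrow> g \<in> G n \<Longrightarrow> 1 \<le> proj S n g j \<and> proj S n g j \<le> n"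
  using permutes_in_image[OF proj_permutes[of n g], of j] by auto

lemma proj_eq_iff: "n \<ge> 1 \<Longrightarrow> g \<in> G n \<Longrightarrow> proj S n g i = proj S n g j \<longleftrightarrow> i = j"
  using inj_eq[OF permutes_inj[OF proj_permutes]] by blast

lemma proj_mult:
  "n \<ge> 1 \<Longrightarrow> g \<in> G n \<Longrightarrow> h \<in> G n
    \<Longrightarrow> proj S n (g \<otimes>\<^bsub>grp S n\<^esub> h) i = proj S n g (proj S n h i)"
  using proj_hom[of n] by (auto simp: hom_def sym_group_mult)

lemma kappa_in: "1 \<le> j \<Longrightarrow> j \<le> n \<Longrightarrow> g \<in> G n \<Longrightarrow> kappa S n j g \<in> G (Suc n)"
  using kappa_closed[of j n] by auto

lemma iota_in: "1 \<le> n \<Longrightarrow> g \<in> G n \<Longrightarrow> iota S n g \<in> G (Suc n)"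
  using iota_hom[of n] by (auto simp: hom_def)

lemma grp_simps:
  assumes "1 \<le> n"
  shows "\<one>\<^bsub>grp S n\<^esub> \<in> G n"
    and "x \<in> G n \<Longrightarrow> \<one>\<^bsub>grp S n\<^esub> \<otimes>\<^bsub>grp S n\<^esub> x = x"
    and "x \<in> G n \<Longrightarrow> x \<otimes>\<^bsub>grp S n\<^esub> \<one>\<^bsub>grp S n\<^esub> = x"
    and "x \<in> G n \<Longrightarrow> y \<in> G n \<Longrightarrow> x \<otimes>\<^bsub>grp S n\<^esub> y \<in> G n"
    and "x \<in> G n \<Longrightarrow> y \<in> G n \<Longrightarrow> z \<in> G n
      \<Longrightarrow> x \<otimes>\<^bsub>grp S n\<^esub> y \<otimes>\<^bsub>grp S n\<^esub> z = x \<otimes>\<^bsub>grp S n\<^esub> (y \<otimes>\<^bsub>grp S n\<^esub> z)"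
proof -
  interpret group "grp S n"
    using assms by (rule grp_group)
  show "\<one>\<^bsub>grp S n\<^esub> \<in> G n"
    and "x \<in> G n \<Longrightarrow> \<one>\<^bsub>grp S n\<^esub> \<otimes>\<^bsub>grp S n\<^esub> x = x"
    and "x \<in> G n \<Longrightarrow> x \<otimes>\<^bsub>grp S n\<^esub> \<one>\<^bsub>grp S n\<^esub> = x"
    and "x \<in> G n \<Longrightarrow> y \<in> G n \<Longrightarrow> x \<otimes>\<^bsub>grp S n\<^esub> y \<in> G n"
    and "x \<in> G n \<Longrightarrow> y \<in> G n \<Longrightarrow> z \<in> G n
      \<Longrightarrow> x \<otimes>\<^bsub>grp S n\<^esub> y \<otimes>\<^bsub>grp S n\<^esub> z = x \<otimes>\<^bsub>grp S n\<^esub> (y \<otimes>\<^bsub>grp S n\<^esub> z)"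
    by (simp_all add: m_assoc)
qed

text \<open>Serves to show that units are preserved by maps for which only a product formula is at
  hand.\<close>

lemma idempotent_is_one:
  assumes "1 \<le> n" "x \<in> G n" "x \<otimes>\<^bsub>grp S n\<^esub> x = x"
  shows "x = \<one>\<^bsub>grp S n\<^esub>"
proof -
  interpret group "grp S n"
    using assms(1) by (rule grp_group)
  show ?thesis
    using assms by (simp add: l_cancel_one')
qed

lemma proj_one: "1 \<le> n \<Longrightarrow> proj S n \<one>\<^bsub>grp S n\<^esub> = id"
  using hom_one[OF proj_hom grp_group sym_group_is_group, of n] by (simp add: sym_group_one)

lemma iota_one: "1 \<le> n \<Longrightarrow> iota S n \<one>\<^bsub>grp S n\<^esub> = \<one>\<^bsub>grp S (Suc n)\<^esub>"
  using hom_one[OF iota_hom grp_group grp_group, of n] by simp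

lemma iota_mult: "1 \<le> n \<Longrightarrow> x \<in> G n \<Longrightarrow> y \<in> G n
    \<Longrightarrow> iota S n (x \<otimes>\<^bsub>grp S n\<^esub> y) = iota S n x \<otimes>\<^bsub>grp S (Suc n)\<^esub> iota S n y"
  using iota_hom[of n] by (auto simp: hom_def)

text \<open>\<kappa>_j is not a homomorphism, but (v) with both elements equal to 1 keeps the index
  j, since \<pi>(1) is the identity, and makes the image idempotent.\<close>

lemma kappa_one:
  assumes "1 \<le> j" "j \<le> n"
  shows "kappa S n j \<one>\<^bsub>grp S n\<^esub> = \<one>\<^bsub>grp S (Suc n)\<^esub>"
proof -
  have n: "1 \<le> n"
    using assms by simp
  have "kappa S n j (\<one>\<^bsub>grp S n\<^esub> \<otimes>\<^bsub>grp S n\<^esub> \<one>\<^bsub>grp S n\<^esub>)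
      = kappa S n j \<one>\<^bsub>grp S n\<^esub> \<otimes>\<^bsub>grp S (n + 1)\<^esub> kappa S n j \<one>\<^bsub>grp S n\<^esub>"
    using kappa_mult[OF assms grp_simps(1)[OF n] grp_simps(1)[OF n]] proj_one[OF n] by simp
  then show ?thesis
    using idempotent_is_one[of "Suc n" "kappa S n j \<one>\<^bsub>grp S n\<^esub>"] kappa_in[OF assms grp_simps(1)[OF n]]
      grp_simps[OF n] by simp
qed

text \<open>Off the doubled strands injectivity excludes equality with the value at j, so the four
  cases of \<open>sym_clone\<close> collapse into one strict comparison.\<close>

lemma proj_kappa_other:
  assumes j: "1 \<le> j" "j \<le> n" and g: "g \<in> G n"
    and i: "1 \<le> i" "i \<le> n + 1" "i \<noteq> j" "i \<noteq> j + 1"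
  shows "proj S (Suc n) (kappa S n j g) i =
    (let s = proj S n g (if i \<le> j then i else i - 1) in if s < proj S n g j then s else s + 1)"
proof -
  have "proj S n g i \<noteq> proj S n g j" "proj S n g (i - 1) \<noteq> proj S n g j"
    using proj_eq_iff[of n g] j g i by auto
  then show ?thesis
    using proj_kappa[of j n g i] assms by (auto simp: sym_clone_def Let_def)
qed

text \<open>With s the image of strand j under \<pi>(g), axiom (ii) sends the other strands into the
  complement of {s, s + 1}. By cardinality they fill it, so the two copies share s and s + 1 between
  them.\<close>

lemma proj_kappa_strand:
  assumes j: "1 \<le> j" "j \<le> n" and g: "g \<in> G n"
  shows "proj S (Suc n) (kappa S n j g) j = proj S n g j + (if flips S n j g then 1 else 0)"
    and "proj S (Suc n) (kappa S n j g) (Suc j) = proj S n g j + (if flips S n j g then 0 else 1)"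
proof -
  define s where "s = proj S n g j"
  define t where "t = proj S (Suc n) (kappa S n j g)"
  have s: "1 \<le> s" "s \<le> n"
    using proj_in[OF j g] by (auto simp: s_def)
  have t: "t permutes {1..Suc n}"
    using proj_permutes[of "Suc n" "kappa S n j g"] kappa_in[OF j g] by (simp add: t_def)
  let ?A = "{1..Suc n} - {j, Suc j}" and ?B = "{1..Suc n} - {s, Suc s}"
  have "t ` ?A \<subseteq> ?B"
  proof
    fix y assume "y \<in> t ` ?A"
    then obtain i where i: "i \<in> ?A" "y = t i"
      by blast
    have "proj S n g (if i \<le> j then i else i - 1) \<noteq> s"
      using proj_eq_iff[of n g] j g i by (auto simp: s_def)
    then have "y \<noteq> s \<and> y \<noteq> Suc s"
      using proj_kappa_other[OF j g, of i] i by (auto simp: t_def s_def Let_def split: if_splits)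
    then show "y \<in> ?B"
      using i permutes_in_image[OF t, of i] by auto
  qed
  moreover have "card (t ` ?A) = card ?B"
  proof -
    have "card (t ` ?A) = card ?A"
      by (rule card_image) (use permutes_inj[OF t] in \<open>auto simp: inj_on_def\<close>)
    also have "\<dots> = card ?B"
      using j s by (simp add: card_Diff_subset)
    finally show ?thesis .
  qed
  ultimately have img: "t ` ?A = ?B"
    by (intro card_subset_eq) auto
  have in_s: "t i = s \<or> t i = Suc s" if "i = j \<or> i = Suc j" for i
  proof (rule ccontr)
    assume "\<not> (t i = s \<or> t i = Suc s)"
    moreover have "t i \<in> {1..Suc n}"
      using permutes_in_image[OF t, of i] that j by auto
    ultimately have "t i \<in> t ` ?A"
      unfolding img by auto
    then show False
      using that inj_eq[OF permutes_inj[OF t]] by auto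
  qed
  have neq: "t j \<noteq> t (Suc j)"
    using inj_eq[OF permutes_inj[OF t]] by auto
  \<comment> \<open>\<open>sym_clone\<close> keeps the order, sending j to s and j + 1 to s + 1. As
    all other values agree, the only way to differ from it is the exchange.\<close>
  have "flips S n j g \<longleftrightarrow> t j = Suc s"
  proof
    assume "t j = Suc s"
    moreover have "sym_clone n j (proj S n g) j = s"
      using j by (simp add: sym_clone_def s_def)
    ultimately show "flips S n j g"
      unfolding flips_def t_def by auto
  next
    assume f: "flips S n j g"
    show "t j = Suc s"
    proof (rule ccontr)
      assume "t j \<noteq> Suc s"
      then have tj: "t j = s" "t (Suc j) = Suc s"
        using in_s[of j] in_s[of "Suc j"] neq by auto
      have "t i = sym_clone n j (proj S n g) i" for i
      proof -
        consider "i = j" | "i = Suc j" | "i \<notin> {1..Suc n}" | "i \<in> {1..Suc n}" "i \<noteq> j" "i \<noteq> Suc j"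
          by blast
        then show ?thesis
        proof cases
          case 3
          then show ?thesis
            using permutes_not_in[OF t] by (auto simp: sym_clone_def)
        next
          case 4
          then show ?thesis
            using proj_kappa[OF j g, of i] by (simp add: t_def)
        qed (use j tj in \<open>auto simp: sym_clone_def s_def\<close>)
      qed
      then show False
        using f unfolding flips_def t_def by auto
    qed
  qed
  then show "proj S (Suc n) (kappa S n j g) j = proj S n g j + (if flips S n j g then 1 else 0)"
    and "proj S (Suc n) (kappa S n j g) (Suc j) = proj S n g j + (if flips S n j g then 0 else 1)"
    using in_s[of j] in_s[of "Suc j"] neq unfolding t_def[symmetric] s_def[symmetric] by auto
qed

text \<open>Either copy detects the exchange. Both forms are used, since the known relations do not
  always determine the value at the first copy.\<close>

lemma flips_iff:
  assumes "1 \<le> j" "j \<le> n" "g \<in> G n"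
  shows "flips S n j g \<longleftrightarrow> proj S (Suc n) (kappa S n j g) j = proj S n g j + 1"
    and "flips S n j g \<longleftrightarrow> proj S (Suc n) (kappa S n j g) (Suc j) = proj S n g j"
  using proj_kappa_strand[OF assms] by simp_all

text \<open>Signs multiply: by (v) the first copy of j goes to the first or second copy of
  \<pi>(h)(j), depending on whether h flips, and these two copies are exchanged when g flips
  there.\<close>

lemma flips_mult:
  assumes j: "1 \<le> j" "j \<le> n" and g: "g \<in> G n" and h: "h \<in> G n"
  shows "flips S n j (g \<otimes>\<^bsub>grp S n\<^esub> h) \<longleftrightarrow> flips S n (proj S n h j) g \<noteq> flips S n j h"
proof -
  have n: "1 \<le> n"
    using j by simp
  have t: "1 \<le> proj S n h j" "proj S n h j \<le> n"
    using proj_in[OF j h] by auto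
  have "proj S (Suc n) (kappa S n j (g \<otimes>\<^bsub>grp S n\<^esub> h)) j
      = proj S (Suc n) (kappa S n (proj S n h j) g) (proj S (Suc n) (kappa S n j h) j)"
    using kappa_mult[OF j g h] proj_mult[of "Suc n"] kappa_in[OF j h] kappa_in[OF t g] by simp
  then show ?thesis
    using flips_iff(1)[OF j grp_simps(4)[OF n g h]] proj_kappa_strand(1)[OF j h]
      proj_kappa_strand[OF t g] proj_mult[OF n g h] by (simp split: if_splits)
qed

lemma flips_iota:
  assumes j: "1 \<le> j" "j \<le> n" and g: "g \<in> G n"
  shows "flips S (Suc n) j (iota S n g) \<longleftrightarrow> flips S n j g"
proof -
  have n: "1 \<le> n"
    using j by simp
  have "proj S (Suc (Suc n)) (kappa S (Suc n) j (iota S n g)) j = proj S (Suc n) (kappa S n j g) j"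
    using iota_kappa[OF j g] proj_iota[of "Suc n" "kappa S n j g"] kappa_in[OF j g] j
    by (simp add: sym_left_def)
  moreover have "proj S (Suc n) (iota S n g) j = proj S n g j"
    using proj_iota[OF n g] j by (simp add: sym_left_def)
  ultimately show ?thesis
    using flips_iff(1)[of j "Suc n" "iota S n g"] flips_iff(1)[OF j g] j iota_in[OF n g] by simp
qed

end

lemma signed_proj_flips:
  "1 \<le> j \<Longrightarrow> j \<le> n \<Longrightarrow> signed_proj S n g (int j)
    = (if flips S n j g then - int (proj S n g j) else int (proj S n g j))"
  by (simp add: signed_proj_def odd_extension_nat flips_def)

lemma odd_map_signed_proj: "odd_map n (signed_proj S n g)"
  by (simp add: signed_proj_def)

context bilateral_cloning_system
begin

lemma unsigned_signed_proj:
  assumes "1 \<le> n" "g \<in> G n"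
  shows "unsigned n (signed_proj S n g) = proj S n g"
  using permutes_not_in[OF proj_permutes[OF assms]]
  by (fastforce simp: unsigned_def signed_proj_flips fun_eq_iff)

lemma signed_proj_in_signed_perms:
  assumes "1 \<le> n" "g \<in> G n"
  shows "signed_proj S n g \<in> signed_perms n"
  by (rule signed_permsI)
    (use assms in \<open>simp_all add: odd_map_signed_proj unsigned_signed_proj proj_permutes del:
      One_nat_def\<close>)

lemma signed_proj_mult:
  assumes n: "1 \<le> n" and g: "g \<in> G n" and h: "h \<in> G n"
  shows "signed_proj S n (g \<otimes>\<^bsub>grp S n\<^esub> h) = signed_proj S n g \<circ> signed_proj S n h"
proof (rule odd_map_eqI[OF odd_map_signed_proj])
  show "odd_map n (signed_proj S n g \<circ> signed_proj S n h)"
    using odd_map_signed_proj[of n S g] odd_map_signed_proj[of n S h] by (simp add: odd_map_def)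
  fix j assume j: "1 \<le> j" "j \<le> n"
  have t: "1 \<le> proj S n h j" "proj S n h j \<le> n"
    using proj_in[OF j h] by auto
  show "signed_proj S n (g \<otimes>\<^bsub>grp S n\<^esub> h) (int j) = (signed_proj S n g \<circ> signed_proj S n h) (int j)"
    using odd_map_signed_proj[of n S g] flips_mult[OF j g h] proj_mult[OF n g h, of j]
    by (simp add: signed_proj_flips[OF j] signed_proj_flips[OF t] odd_map_def)
qed

lemma signed_proj_one: "1 \<le> n \<Longrightarrow> signed_proj S n \<one>\<^bsub>grp S n\<^esub> = id"
proof (rule odd_map_eqI[OF odd_map_signed_proj])
  show "odd_map n id"
    by (simp add: odd_map_def)
  fix j assume n: "1 \<le> n" and j: "1 \<le> j" "j \<le> n"
  show "signed_proj S n \<one>\<^bsub>grp S n\<^esub> (int j) = id (int j)"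
    using flips_iff(1)[OF j grp_simps(1)[OF n]] kappa_one[OF j] proj_one[OF n] proj_one[of "Suc n"]
    by (simp add: signed_proj_flips[OF j])
qed

lemma zeta_in: "1 \<le> n \<Longrightarrow> g \<in> G n \<Longrightarrow> zeta S n g \<in> G (Suc n)"
  using zeta_hom[of n] by (auto simp: hom_def)

lemma zeta_one: "1 \<le> n \<Longrightarrow> zeta S n \<one>\<^bsub>grp S n\<^esub> = \<one>\<^bsub>grp S (Suc n)\<^esub>"
  using hom_one[OF zeta_hom grp_group grp_group, of n] by simp

lemma zeta_mult: "1 \<le> n \<Longrightarrow> x \<in> G n \<Longrightarrow> y \<in> G n
    \<Longrightarrow> zeta S n (x \<otimes>\<^bsub>grp S n\<^esub> y) = zeta S n x \<otimes>\<^bsub>grp S (Suc n)\<^esub> zeta S n y"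
  using zeta_hom[of n] by (auto simp: hom_def)

text \<open>By (vii), doubling the added strand is adding one more, and an added strand is
  fixed.\<close>

lemma flips_iota_last:
  assumes n: "1 \<le> n" and g: "g \<in> G n"
  shows "\<not> flips S (Suc n) (Suc n) (iota S n g)"
proof -
  have "proj S (Suc (Suc n)) (kappa S (Suc n) (Suc n) (iota S n g)) (Suc n) = Suc n"
    using iota_iota[OF n g] proj_iota[of "Suc n" "iota S n g"] proj_iota[OF n g] iota_in[OF n g]
    by (simp add: sym_left_def)
  then show ?thesis
    using flips_iff(1)[of "Suc n" "Suc n" "iota S n g"] iota_in[OF n g] proj_iota[OF n g]
    by (simp add: sym_left_def)
qed

lemma signed_proj_iota:
  assumes n: "1 \<le> n" and g: "g \<in> G n" and j: "1 \<le> j" "j \<le> Suc n"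
  shows "signed_proj S (Suc n) (iota S n g) (int j)
    = (if j \<le> n then signed_proj S n g (int j) else int j)"
proof (cases "j \<le> n")
  case True
  then show ?thesis
    using flips_iota[OF j(1) True g] proj_iota[OF n g] j by (simp add: signed_proj_flips sym_left_def)
next
  case False
  then have "j = Suc n"
    using j by simp
  then show ?thesis
    using flips_iota_last[OF n g] proj_iota[OF n g]
    unfolding signed_proj_flips[OF j] by (simp add: sym_left_def)
qed

lemma flips_zeta:
  assumes j: "1 \<le> j" "j \<le> n" and g: "g \<in> G n"
  shows "flips S (Suc n) (Suc j) (zeta S n g) \<longleftrightarrow> flips S n j g"
proof -
  have n: "1 \<le> n"
    using j by simp
  have "proj S (Suc (Suc n)) (kappa S (Suc n) (Suc j) (zeta S n g)) (Suc j)
      = proj S (Suc n) (kappa S n j g) j + 1"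
    using zeta_kappa[OF j g] proj_zeta[of "Suc n" "kappa S n j g"] kappa_in[OF j g] j
    by (simp add: sym_right_def)
  moreover have "proj S (Suc n) (zeta S n g) (Suc j) = proj S n g j + 1"
    using proj_zeta[OF n g] j by (simp add: sym_right_def)
  ultimately show ?thesis
    using flips_iff(1)[of "Suc j" "Suc n" "zeta S n g"] flips_iff(1)[OF j g] j zeta_in[OF n g] by simp
qed

lemma flips_zeta_first:
  assumes n: "1 \<le> n" and g: "g \<in> G n"
  shows "\<not> flips S (Suc n) 1 (zeta S n g)"
proof -
  have "proj S (Suc (Suc n)) (kappa S (Suc n) 1 (zeta S n g)) 1 = 1"
    using zeta_zeta[OF n g] proj_zeta[of "Suc n" "zeta S n g"] proj_zeta[OF n g] zeta_in[OF n g]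
    by (simp add: sym_right_def)
  then show ?thesis
    using flips_iff(1)[of 1 "Suc n" "zeta S n g"] zeta_in[OF n g] proj_zeta[OF n g]
    by (simp add: sym_right_def)
qed

text \<open>Translation by l away from zero, as the block product does to the values of its right
  factor.\<close>

definition shift :: "nat \<Rightarrow> int \<Rightarrow> int" where
  "shift l x = (if x > 0 then x + int l else x - int l)"

lemma signed_proj_zeta:
  assumes n: "1 \<le> n" and g: "g \<in> G n" and j: "1 \<le> j" "j \<le> Suc n"
  shows "signed_proj S (Suc n) (zeta S n g) (int j) =
    (if j = 1 then 1 else shift 1 (signed_proj S n g (int (j - 1))))"
proof (cases "j = 1")
  case True
  then show ?thesis
    using flips_zeta_first[OF n g] proj_zeta[OF n g]
    unfolding signed_proj_flips[OF j] by (simp add: sym_right_def)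
next
  case False
  define i where "i = j - 1"
  then have i: "j = Suc i" "1 \<le> i" "i \<le> n"
    using False j by auto
  show ?thesis
    using False flips_zeta[OF i(2,3) g] proj_zeta[OF n g] i proj_in[OF i(2,3) g]
      signed_proj_flips[OF i(2,3), of S g] signed_proj_flips[OF j, of S "zeta S n g"]
    by (simp add: sym_right_def shift_def)
qed

text \<open>The remaining sign of \<open>\<kappa>\<^sub>q \<kappa>\<^sub>j g\<close> is read off the other of its two expressions as a double
  cloning, whose value at \<open>q\<close> (or \<open>q + 1\<close>) is given by axiom (ii).\<close>

lemma flips_kappa:
  assumes j: "1 \<le> j" "j \<le> n" and g: "g \<in> G n" and q: "1 \<le> q" "q \<le> Suc n"
  shows "flips S (Suc n) q (kappa S n j g) \<longleftrightarrow> flips S n (if q \<le> j then q else q - 1) g"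
proof -
  let ?\<sigma> = "proj S n g" and ?x = "kappa S n j g"
  have x: "?x \<in> G (Suc n)"
    by (rule kappa_in[OF j g])
  note fx = flips_iff[OF q x]
  consider "q < j" | "q > Suc j" | "q = j" | "q = Suc j"
    by linarith
  then show ?thesis
  proof cases
    case 1
    have qn: "q \<le> n"
      using 1 j by simp
    let ?y = "kappa S n q g"
    have y: "?y \<in> G (Suc n)"
      by (rule kappa_in[OF q(1) qn g])
    \<comment> \<open>In this expression the last doubled strand is j + 1, so position
      \<open>q\<close> is off it and its value is known.\<close>
    have F: "kappa S (Suc n) q ?x = kappa S (Suc n) (Suc j) ?y"
      using kappa_kappa[of q j n g] q j 1 g by simp
    have ne: "?\<sigma> q \<noteq> ?\<sigma> j"
      using proj_eq_iff[of n g q j] 1 g j by simp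
    have F_q: "proj S (Suc (Suc n)) (kappa S (Suc n) (Suc j) ?y) q =
        (if proj S (Suc n) ?y q < proj S (Suc n) ?y (Suc j) then proj S (Suc n) ?y q
         else proj S (Suc n) ?y q + 1)"
      using proj_kappa_other[of "Suc j" "Suc n" ?y q, OF _ _ y] 1 j q by (simp add: Let_def)
    have y_j: "proj S (Suc n) ?y (Suc j) = (if ?\<sigma> j < ?\<sigma> q then ?\<sigma> j else ?\<sigma> j + 1)"
      using proj_kappa_other[OF q(1) qn g, of "Suc j"] 1 j by (simp add: Let_def)
    have x_q: "proj S (Suc n) ?x q = (if ?\<sigma> q < ?\<sigma> j then ?\<sigma> q else ?\<sigma> q + 1)"
      using proj_kappa_other[OF j g, of q] 1 q by (simp add: Let_def)
    show ?thesis
      unfolding fx(1) F F_q y_j x_q proj_kappa_strand(1)[OF q(1) qn g] using ne 1 by auto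
  next
    case 2
    have qn: "1 \<le> q - 1" "q - 1 \<le> n"
      using 2 q by simp_all
    let ?y = "kappa S n (q - 1) g"
    have y: "?y \<in> G (Suc n)"
      by (rule kappa_in[OF qn g])
    have F: "kappa S (Suc n) q ?x = kappa S (Suc n) j ?y"
      using kappa_kappa[of j "q - 1" n g] q j 2 g by simp
    have ne: "?\<sigma> (q - 1) \<noteq> ?\<sigma> j"
      using proj_eq_iff[of n g "q - 1" j] 2 g j by simp
    have F_q: "proj S (Suc (Suc n)) (kappa S (Suc n) j ?y) q =
        (if proj S (Suc n) ?y (q - 1) < proj S (Suc n) ?y j then proj S (Suc n) ?y (q - 1)
         else proj S (Suc n) ?y (q - 1) + 1)"
      using proj_kappa_other[of j "Suc n" ?y q, OF _ _ y] 2 j q by (simp add: Let_def)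
    have y_j: "proj S (Suc n) ?y j = (if ?\<sigma> j < ?\<sigma> (q - 1) then ?\<sigma> j else ?\<sigma> j + 1)"
    proof -
      have "j \<le> q - 1" "j \<noteq> q - 1" "j \<noteq> q - 1 + 1"
        using 2 by auto
      then show ?thesis
        using proj_kappa_other[OF qn g, of j] j by (simp add: Let_def)
    qed
    have x_q: "proj S (Suc n) ?x q = (if ?\<sigma> (q - 1) < ?\<sigma> j then ?\<sigma> (q - 1) else ?\<sigma> (q - 1) + 1)"
      using proj_kappa_other[OF j g, of q] 2 q by (simp add: Let_def)
    show ?thesis
      unfolding fx(1) F F_q y_j x_q proj_kappa_strand(1)[OF qn g] using ne 2 by auto
  next
    case 3
    \<comment> \<open>By (iv+) the second copy may be doubled instead of the first, which puts
      position j under (ii).\<close>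
    have F: "kappa S (Suc n) q ?x = kappa S (Suc n) (Suc j) ?x"
      using kappa_kappa_same[OF j g] 3 by simp
    have F_j: "proj S (Suc (Suc n)) (kappa S (Suc n) (Suc j) ?x) j =
        (if proj S (Suc n) ?x j < proj S (Suc n) ?x (Suc j) then proj S (Suc n) ?x j
         else proj S (Suc n) ?x j + 1)"
      using proj_kappa_other[of "Suc j" "Suc n" ?x j, OF _ _ x] j by (simp add: Let_def)
    show ?thesis
      unfolding fx(1) F unfolding 3 F_j proj_kappa_strand[OF j g] by auto
  next
    case 4
    \<comment> \<open>Doubling the first copy instead leaves position j + 2 under (ii). This is the
      second copy of \<open>q\<close>, hence the second criterion of \<open>flips_iff\<close>
      below.\<close>
    have F: "kappa S (Suc n) q ?x = kappa S (Suc n) j ?x"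
      using kappa_kappa_same[OF j g] 4 by simp
    have F_j: "proj S (Suc (Suc n)) (kappa S (Suc n) j ?x) (Suc (Suc j)) =
        (if proj S (Suc n) ?x (Suc j) < proj S (Suc n) ?x j then proj S (Suc n) ?x (Suc j)
         else proj S (Suc n) ?x (Suc j) + 1)"
      using proj_kappa_other[of j "Suc n" ?x "Suc (Suc j)", OF _ _ x] j by (simp add: Let_def)
    show ?thesis
      unfolding fx(2) F unfolding 4 F_j proj_kappa_strand[OF j g] by auto
  qed
qed

text \<open>A flip exchanges the targets s and s + 1 of the copies and both copies inherit the minus
  sign, so the pair of values is -(s + 1), -s: the strand doubled in reversed order with negative
  signs.\<close>

lemma signed_proj_kappa:
  assumes j: "1 \<le> j" "j \<le> n" and g: "g \<in> G n"
  shows "signed_proj S (Suc n) (kappa S n j g) = clone_strand n j (signed_proj S n g)"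
proof (rule odd_map_eqI[OF odd_map_signed_proj])
  show "odd_map (Suc n) (clone_strand n j (signed_proj S n g))"
    by (simp add: clone_strand_def)
  fix q assume q: "1 \<le> q" "q \<le> Suc n"
  let ?\<sigma> = "proj S n g"
  have sj: "1 \<le> ?\<sigma> j"
    using proj_in[OF j g] by auto
  consider "q = j" | "q = Suc j" | "q \<noteq> j" "q \<noteq> Suc j"
    by blast
  then show "signed_proj S (Suc n) (kappa S n j g) (int q)
    = clone_strand n j (signed_proj S n g) (int q)"
  proof cases
    case 1
    show ?thesis
      unfolding clone_strand_def odd_extension_nat[OF q] signed_proj_flips[OF q] flips_kappa[OF j g q]
        signed_proj_flips[OF j] Let_def
      using 1 proj_kappa_strand[OF j g] sj by simp
  next
    case 2
    show ?thesis
      unfolding clone_strand_def odd_extension_nat[OF q] signed_proj_flips[OF q] flips_kappa[OF j g q]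
        signed_proj_flips[OF j] Let_def
      using 2 proj_kappa_strand[OF j g] sj by simp
  next
    case 3
    define q' where "q' = (if q \<le> j then q else q - 1)"
    have q': "1 \<le> q'" "q' \<le> n" "q' \<noteq> j"
      using q j 3 by (auto simp: q'_def)
    have s: "1 \<le> ?\<sigma> q'" "?\<sigma> q' \<noteq> ?\<sigma> j"
      using proj_in[OF q'(1,2) g] proj_eq_iff[of n g q' j] j g q' by auto
    show ?thesis
      unfolding clone_strand_def odd_extension_nat[OF q] signed_proj_flips[OF q] flips_kappa[OF j g q]
        signed_proj_flips[OF j] Let_def q'_def[symmetric] signed_proj_flips[OF q'(1,2)]
      using 3 proj_kappa_other[OF j g, of q, folded q'_def] q s by (auto simp: Let_def)
  qed
qed


subsection \<open>Cloning by tuples\<close>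

lemma kappa_iter_Suc: "1 \<le> m \<Longrightarrow> kappa_iter S n j (Suc m) g
  = kappa S (n + m - 1) j (kappa_iter S n j m g)"
  by simp

lemma kappa_iter_in:
  assumes "1 \<le> j" "j \<le> n" "g \<in> G n" "1 \<le> m"
  shows "kappa_iter S n j m g \<in> G (n + m - 1)"
  using assms(4)
proof (induction m rule: dec_induct)
  case base
  then show ?case
    using assms by simp
next
  case (step m)
  then show ?case
    using kappa_in[of j "n + m - 1" "kappa_iter S n j m g"] assms by (simp add: kappa_iter_Suc)
qed

text \<open>\<open>kappa_iter\<close> always doubles the first copy; (iv) and (iv+) show that
  doubling any other copy has the same effect.\<close>

lemma kappa_kappa_iter:
  assumes "1 \<le> j" "j \<le> n" "g \<in> G n" "1 \<le> m" "j \<le> p" "p < j + m"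
  shows "kappa S (n + m - 1) p (kappa_iter S n j m g) = kappa_iter S n j (Suc m) g"
  using assms(4-6)
proof (induction m arbitrary: p rule: dec_induct)
  case base
  then have "p = j"
    by simp
  then show ?case
    by simp
next
  case (step m)
  let ?Y = "kappa_iter S n j m g"
  have Y: "?Y \<in> G (n + m - 1)" and j: "j \<le> n + m - 1"
    using kappa_iter_in[of j n g m] assms step.hyps by auto
  have N: "n + Suc m - 1 = n + m - 1 + 1"
    using step.hyps by simp
  have Z: "kappa_iter S n j (Suc m) g = kappa S (n + m - 1) j ?Y"
    using step.hyps by simp
  have goal: "kappa_iter S n j (Suc (Suc m)) g = kappa S (n + m - 1 + 1) j (kappa S (n + m - 1) j ?Y)"
    using step.hyps kappa_iter_Suc[of "Suc m" n j g] N Z by simp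
  consider "p = j" | "p = j + 1" | "p > j + 1"
    using step.prems by linarith
  then show ?case
  proof cases
    case 1
    then show ?thesis
      unfolding goal Z N by simp
  next
    case 2
    then show ?thesis
      unfolding goal Z N using kappa_kappa_same[OF assms(1) j Y] by simp
  next
    case 3
    \<comment> \<open>Beyond j + 1, the doubling at \<open>p\<close> passes the outermost \<kappa>_j
      by (iv) and becomes one at p - 1, to which the induction hypothesis applies.\<close>
    have "kappa S (n + m - 1 + 1) (p - 1 + 1) (kappa S (n + m - 1) j ?Y)
        = kappa S (n + m - 1 + 1) j (kappa S (n + m - 1) (p - 1) ?Y)"
      by (rule kappa_kappa[OF assms(1) _ _ Y]) (use 3 step.prems step.hyps assms in auto)
    also have "kappa S (n + m - 1) (p - 1) ?Y = kappa S (n + m - 1) j ?Y"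
      using step.IH[of "p - 1"] 3 step.prems unfolding Z by simp
    finally show ?thesis
      unfolding goal Z N using 3 by simp
  qed
qed

text \<open>(iv) applied m - 1 times: a strand to the right of j moves up by one each time j is
  doubled.\<close>

lemma kappa_iter_kappa:
  assumes "1 \<le> j" "j < p" "p \<le> n" "g \<in> G n" "1 \<le> m"
  shows "kappa S (n + m - 1) (p + m - 1) (kappa_iter S n j m g)
    = kappa_iter S (Suc n) j m (kappa S n p g)"
  using assms(5)
proof (induction m rule: dec_induct)
  case base
  then show ?case
    by simp
next
  case (step m)
  let ?Y = "kappa_iter S n j m g"
  have Y: "?Y \<in> G (n + m - 1)" and j: "j \<le> n + m - 1"
    using kappa_iter_in[of j n g m] assms step.hyps by auto
  have N: "n + Suc m - 1 = n + m - 1 + 1" "p + Suc m - 1 = p + m - 1 + 1"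
    "n + m - 1 + 1 = Suc n + m - 1"
    using step.hyps by simp_all
  have "kappa S (n + Suc m - 1) (p + Suc m - 1) (kappa S (n + m - 1) j ?Y)
      = kappa S (n + m - 1 + 1) j (kappa S (n + m - 1) (p + m - 1) ?Y)"
    unfolding N(1,2) by (rule kappa_kappa[OF assms(1) _ _ Y]) (use step.hyps assms in auto)
  then show ?case
    unfolding step.IH kappa_iter_Suc[OF step.hyps(1)] N(3) .
qed

text \<open>The inequality is carried along because the arities involve truncated
  subtraction.\<close>

lemma clone_tail_in:
  assumes "1 \<le> j" "j + length ms = Suc n" "\<forall>m \<in> set ms. 1 \<le> m" "g \<in> G n"
  shows "clone_tail S n j ms g \<in> G (n + sum_list ms - length ms) \<and> length ms \<le> sum_list ms"
  using assms
proof (induction ms arbitrary: j)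
  case (Cons m ms)
  let ?N = "n + sum_list ms - length ms"
  have IH: "clone_tail S n (j + 1) ms g \<in> G ?N" "length ms \<le> sum_list ms"
    using Cons.IH[of "j + 1"] Cons.prems by auto
  have "kappa_iter S ?N j m (clone_tail S n (j + 1) ms g) \<in> G (?N + m - 1)"
    using Cons.prems IH by (intro kappa_iter_in) auto
  moreover have "?N + m - 1 = n + sum_list (m # ms) - length (m # ms)"
    using Cons.prems IH by simp
  ultimately show ?case
    using Cons.prems IH by simp
qed simp

text \<open>Inside the first block this is \<open>kappa_kappa_iter\<close>; to its right, the
  doubling passes \<kappa>_j(m) and the induction hypothesis takes over. The positions start at
  \<open>j - 1\<close> because the strands before j are still single.\<close>

lemma kappa_clone_tail:
  assumes "1 \<le> j" "j + length ms = Suc n" "\<forall>m \<in> set ms. 1 \<le> m" "g \<in> G n"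
    and "in_block ms i p"
  shows "kappa S (n + sum_list ms - length ms) (j - 1 + p) (clone_tail S n j ms g)
    = clone_tail S n j (incr ms i) g"
  using assms
proof (induction ms arbitrary: j i p)
  case Nil
  then show ?case
    by (simp add: in_block_def)
next
  case (Cons m ms)
  let ?N = "n + sum_list ms - length ms" and ?X = "clone_tail S n (j + 1) ms g"
  have X: "?X \<in> G ?N" "length ms \<le> sum_list ms"
    using clone_tail_in[of "j + 1" ms n g] Cons.prems by auto
  have N: "n + sum_list (m # ms) - length (m # ms) = ?N + m - 1"
    using Cons.prems X by simp
  show ?case
  proof (cases i)
    case 0
    then have p: "1 \<le> p" "p \<le> m"
      using Cons.prems(5) by (auto simp: in_block_def)
    have "kappa S (?N + m - 1) (j - 1 + p) (kappa_iter S ?N j m ?X) = kappa_iter S ?N j (Suc m) ?X"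
      by (rule kappa_kappa_iter) (use Cons.prems X p in auto)
    then show ?thesis
      unfolding N by (simp add: 0 incr_def)
  next
    case (Suc i')
    then have b: "in_block ms i' (p - m)" and p: "m < p"
      using Cons.prems(5) by (auto simp: in_block_def)
    have pm: "1 \<le> p - m" "p - m \<le> sum_list ms"
      using in_block_bounds[OF b] by auto
    \<comment> \<open>Before \<kappa>_j(m) is applied, the strand has number j + (p - m): strand j
      still has length one.\<close>
    have e: "j - 1 + p = j + (p - m) + m - 1"
      using p Cons.prems by simp
    have "kappa S (?N + m - 1) (j - 1 + p) (kappa_iter S ?N j m ?X)
        = kappa_iter S (Suc ?N) j m (kappa S ?N (j + (p - m)) ?X)"
      unfolding e by (rule kappa_iter_kappa) (use Cons.prems X pm in auto)
    also have "kappa S ?N (j + (p - m)) ?X = clone_tail S n (j + 1) (incr ms i') g"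
      using Cons.IH[of "j + 1" i' "p - m"] Cons.prems b by simp
    finally have "kappa S (?N + m - 1) (j - 1 + p) (kappa_iter S ?N j m ?X)
        = kappa_iter S (Suc ?N) j m (clone_tail S n (j + 1) (incr ms i') g)" .
    moreover have "incr (m # ms) i = m # incr ms i'" "i' < length ms"
      using Suc b by (auto simp: incr_def in_block_def)
    moreover have "n + sum_list (incr ms i') - length (incr ms i') = Suc ?N"
      using \<open>i' < length ms\<close> X(2) by simp
    ultimately show ?thesis
      unfolding N by simp
  qed
qed

text \<open>\<kappa>(m) as a total map, free of the domain restrictions of \<open>Kappa\<close> in
  the constructed PRO.\<close>

definition clone :: "nat list \<Rightarrow> 'a \<Rightarrow> 'a" where
  "clone ms = clone_tail S (length ms) 1 ms"

lemma clone_in: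
  assumes "valid_tuple ms" "g \<in> G (length ms)"
  shows "clone ms g \<in> G (sum_list ms)"
  using clone_tail_in[of 1 ms "length ms" g] assms by (auto simp: clone_def valid_tuple_def)

lemma kappa_clone:
  assumes "valid_tuple ms" "g \<in> G (length ms)" "in_block ms i p"
  shows "kappa S (sum_list ms) p (clone ms g) = clone (incr ms i) g"
  using kappa_clone_tail[of 1 ms "length ms" g i p] assms by (auto simp: clone_def valid_tuple_def)

lemma clone_ones: "clone (replicate n 1) g = g"
proof -
  have "clone_tail S n j (replicate k 1) g = g" for j k
    by (induction k arbitrary: j) auto
  then show ?thesis
    by (simp add: clone_def)
qed

lemma clone_two:
  assumes "1 \<le> j" "j \<le> n" "g \<in> G n"
  shows "clone (incr (replicate n 1) (j - 1)) g = kappa S n j g"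
proof -
  have "valid_tuple (replicate n 1)"
    using assms by (auto simp: valid_tuple_def)
  then show ?thesis
    using kappa_clone[of "replicate n 1" g "j - 1" j] clone_ones[of n g] assms
    by (simp add: in_block_replicate sum_list_replicate)
qed

lemma valid_tuple_length: "valid_tuple ms \<Longrightarrow> 1 \<le> length ms"
  by (cases ms) (auto simp: valid_tuple_def)

lemma signed_proj_clone:
  assumes "valid_tuple ms" "g \<in> G (length ms)"
  shows "signed_proj S (sum_list ms) (clone ms g) = signed_clone ms (signed_proj S (length ms) g)"
proof (rule valid_tuple_induct[OF assms(1), where
      P = "\<lambda>ms. signed_proj S (sum_list ms) (clone ms g)
        = signed_clone ms (signed_proj S (length ms) g)"])
  have h: "signed_proj S (length ms) g \<in> signed_perms (length ms)"
    using signed_proj_in_signed_perms assms valid_tuple_length by blast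
  show "signed_proj S (sum_list (replicate (length ms) 1)) (clone (replicate (length ms) 1) g)
      = signed_clone (replicate (length ms) 1) (signed_proj S (length (replicate (length ms) 1)) g)"
    unfolding clone_ones using signed_clone_ones[OF h] by (simp add: sum_list_replicate)
  fix xs i
  assume xs: "valid_tuple xs" "length xs = length ms" "i < length ms"
    and IH: "signed_proj S (sum_list xs) (clone xs g) = signed_clone xs (signed_proj S (length xs) g)"
  let ?p = "sum_list (take (Suc i) xs)"
  have b: "in_block xs i ?p"
    using in_block_last xs by simp
  have "signed_proj S (Suc (sum_list xs)) (kappa S (sum_list xs) ?p (clone xs g))
      = clone_strand (sum_list xs) ?p (signed_clone xs (signed_proj S (length xs) g))"
    using signed_proj_kappa[of ?p "sum_list xs" "clone xs g"] in_block_bounds[OF b] clone_in[OF xs(1)]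
      assms(2) xs IH by simp
  also have "\<dots> = signed_clone (incr xs i) (signed_proj S (length xs) g)"
    by (rule clone_strand_signed_clone[OF _ b]) (use h xs in simp)
  finally show "signed_proj S (sum_list (incr xs i)) (clone (incr xs i) g)
      = signed_clone (incr xs i) (signed_proj S (length (incr xs i)) g)"
    using kappa_clone[OF xs(1) _ b] assms(2) xs by simp
qed

lemma clone_one:
  assumes "valid_tuple ms"
  shows "clone ms \<one>\<^bsub>grp S (length ms)\<^esub> = \<one>\<^bsub>grp S (sum_list ms)\<^esub>"
  using assms
proof (rule valid_tuple_induct[where P = "\<lambda>xs. clone xs \<one>\<^bsub>grp S (length ms)\<^esub> = \<one>\<^bsub>grp S (sum_list xs)\<^esub>"])
  show "clone (replicate (length ms) 1) \<one>\<^bsub>grp S (length ms)\<^esub>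
    = \<one>\<^bsub>grp S (sum_list (replicate (length ms) 1))\<^esub>"
    unfolding clone_ones by (simp add: sum_list_replicate)
  fix xs i
  assume xs: "valid_tuple xs" "length xs = length ms" "i < length ms"
    and IH: "clone xs \<one>\<^bsub>grp S (length ms)\<^esub> = \<one>\<^bsub>grp S (sum_list xs)\<^esub>"
  let ?p = "sum_list (take (Suc i) xs)"
  have b: "in_block xs i ?p"
    using in_block_last xs by simp
  show "clone (incr xs i) \<one>\<^bsub>grp S (length ms)\<^esub> = \<one>\<^bsub>grp S (sum_list (incr xs i))\<^esub>"
    using kappa_clone[OF xs(1) _ b, of "\<one>\<^bsub>grp S (length ms)\<^esub>"] xs IH in_block_bounds[OF b]
      grp_simps(1)[OF valid_tuple_length[OF assms]] kappa_one[of ?p "sum_list xs"] by simp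
qed

text \<open>Tells which entry of the permuted tuple grows when (v) moves the index \<open>p\<close>
  past \<open>clone ms g\<close>.\<close>

lemma proj_clone_in_block:
  assumes ms: "valid_tuple ms" and g: "g \<in> G (length ms)" and b: "in_block ms i p"
  shows "in_block (permute_tuple (signed_proj S (length ms) g) ms)
    (unsigned (length ms) (signed_proj S (length ms) g) (Suc i) - 1)
      (proj S (sum_list ms) (clone ms g) p)"
proof -
  have p: "1 \<le> p" "p \<le> sum_list ms"
    using in_block_bounds[OF b] by auto
  have h: "signed_proj S (length ms) g \<in> signed_perms (length ms)"
    using signed_proj_in_signed_perms ms g valid_tuple_length by blast
  have "proj S (sum_list ms) (clone ms g) p
    = unsigned (sum_list ms) (signed_proj S (sum_list ms) (clone ms g)) p"
    using unsigned_signed_proj[of "sum_list ms" "clone ms g"] clone_in[OF ms g] p by simp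
  also have "\<dots> = nat \<bar>signed_clone ms (signed_proj S (length ms) g) (int p)\<bar>"
    unfolding signed_proj_clone[OF ms g] using p by (simp add: unsigned_def)
  finally show ?thesis
    using signed_clone_in_block[OF h b] by simp
qed

text \<open>Axiom (4). Applying \<kappa>_p to the product, (v) clones the left factor at the image
  of p. Only the block of this image is known, and by \<open>kappa_clone\<close> only the block
  matters; it is the one whose entry grows when the permuted tuple is formed from the incremented
  one.\<close>

lemma clone_mult:
  assumes ms: "valid_tuple ms" and h: "h \<in> G (length ms)" and g: "g \<in> G (length ms)"
  shows "clone ms (h \<otimes>\<^bsub>grp S (length ms)\<^esub> g)
    = clone (permute_tuple (signed_proj S (length ms) g) ms) h \<otimes>\<^bsub>grp S (sum_list ms)\<^esub> clone ms g"
proof (rule valid_tuple_induct[OF ms, where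
      P = "\<lambda>xs. clone xs (h \<otimes>\<^bsub>grp S (length ms)\<^esub> g)
        = clone (permute_tuple (signed_proj S (length ms) g) xs) h \<otimes>\<^bsub>grp S (sum_list xs)\<^esub> clone xs g"])
  let ?s = "signed_proj S (length ms) g"
  have n: "1 \<le> length ms"
    by (rule valid_tuple_length[OF ms])
  have s: "?s \<in> signed_perms (length ms)"
    by (rule signed_proj_in_signed_perms[OF n g])
  show "clone (replicate (length ms) 1) (h \<otimes>\<^bsub>grp S (length ms)\<^esub> g)
    = clone (permute_tuple ?s (replicate (length ms) 1)) h
      \<otimes>\<^bsub>grp S (sum_list (replicate (length ms) 1))\<^esub> clone (replicate (length ms) 1) g"
    unfolding permute_tuple_replicate[OF s] clone_ones by (simp add: sum_list_replicate)
  fix xs i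
  assume xs: "valid_tuple xs" "length xs = length ms" "i < length ms"
    and IH: "clone xs (h \<otimes>\<^bsub>grp S (length ms)\<^esub> g) = clone (permute_tuple ?s xs) h
      \<otimes>\<^bsub>grp S (sum_list xs)\<^esub> clone xs g"
  let ?p = "sum_list (take (Suc i) xs)" and ?u = "unsigned (length ms) ?s (Suc i) - 1"
  let ?N = "sum_list xs" and ?ys = "permute_tuple ?s xs"
  have b: "in_block xs i ?p"
    using in_block_last xs by simp
  have p: "1 \<le> ?p" "?p \<le> ?N"
    using in_block_bounds[OF b] by auto
  have ys: "valid_tuple ?ys" "sum_list ?ys = ?N" "length ?ys = length ms"
    using valid_permute_tuple[of xs ?s] sum_list_permute_tuple[of ?s xs] s xs by auto
  have b': "in_block ?ys ?u (proj S ?N (clone xs g) ?p)"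
    using proj_clone_in_block[of xs g i ?p] xs g b by simp
  have "clone (incr xs i) (h \<otimes>\<^bsub>grp S (length ms)\<^esub> g)
    = kappa S ?N ?p (clone ?ys h \<otimes>\<^bsub>grp S ?N\<^esub> clone xs g)"
    using kappa_clone[OF xs(1) _ b, of "h \<otimes>\<^bsub>grp S (length ms)\<^esub> g"] grp_simps(4)[OF n h g] xs(2)
    unfolding IH[symmetric] by simp
  also have "\<dots> = kappa S ?N (proj S ?N (clone xs g) ?p) (clone ?ys h)
    \<otimes>\<^bsub>grp S (?N + 1)\<^esub> kappa S ?N ?p (clone xs g)"
    by (rule kappa_mult[OF p]) (use clone_in[OF ys(1)] clone_in[OF xs(1)] ys xs h g in auto)
  also have "kappa S ?N (proj S ?N (clone xs g) ?p) (clone ?ys h) = clone (incr ?ys ?u) h"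
    using kappa_clone[OF ys(1) _ b'] h ys by simp
  also have "kappa S ?N ?p (clone xs g) = clone (incr xs i) g"
    using kappa_clone[OF xs(1) _ b] g xs by simp
  finally show "clone (incr xs i) (h \<otimes>\<^bsub>grp S (length ms)\<^esub> g)
    = clone (permute_tuple ?s (incr xs i)) h \<otimes>\<^bsub>grp S (sum_list (incr xs i))\<^esub> clone (incr xs i) g"
    using permute_tuple_incr[of ?s xs i] s xs by simp
qed

end

section \<open>Composition of cloning maps\<close>

text \<open>Encodes a tuple of tuples as a flat tuple \<open>ts\<close> cut into segments of lengths
  \<open>ls\<close>. A flat tuple can be built up by increments, which would be awkward for a list
  of lists.\<close>

primrec segment_sums :: "nat list \<Rightarrow> nat list \<Rightarrow> nat list" where
  "segment_sums [] ts = []"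
| "segment_sums (l # ls) ts = sum_list (take l ts) # segment_sums ls (drop l ts)"

lemma length_segment_sums [simp]: "length (segment_sums ls ts) = length ls"
  by (induction ls arbitrary: ts) auto

lemma segment_sums_concat: "segment_sums (map length rs) (concat rs) = map sum_list rs"
  by (induction rs) auto

lemma segment_sums_ones: "segment_sums ls (replicate (sum_list ls) 1) = ls"
  by (induction ls) (auto simp: take_replicate drop_replicate sum_list_replicate min_def)

lemma sum_list_take_segment_sums:
  "sum_list (take i (segment_sums ls ts)) = sum_list (take (sum_list (take i ls)) ts)"
proof (induction ls arbitrary: i ts)
  case (Cons l ls)
  show ?case
  proof (cases i)
    case (Suc i')
    have "take (l + sum_list (take i' ls)) ts = take l ts @ take (sum_list (take i' ls)) (drop l ts)"
      by (rule take_add)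
    then show ?thesis
      by (simp add: Suc Cons.IH)
  qed simp
qed simp

lemma segment_sums_incr:
  assumes "in_block ls i (Suc k)" "length ts = sum_list ls"
  shows "segment_sums ls (incr ts k) = incr (segment_sums ls ts) i"
  using assms
proof (induction ls arbitrary: i k ts)
  case (Cons l ls)
  have kl: "k < length ts"
    using in_block_bounds[OF Cons.prems(1)] Cons.prems(2) by simp
  show ?case
  proof (cases i)
    case 0
    then have "k < l"
      using Cons.prems(1) by (simp add: in_block_def)
    then show ?thesis
      using sum_list_take_incr[OF kl, of l] 0 by (simp add: incr_def)
  next
    case (Suc i')
    then have "l \<le> k" "in_block ls i' (Suc (k - l))"
      using Cons.prems(1) by (auto simp: in_block_def)
    moreover have "drop l (incr ts k) = incr (drop l ts) (k - l)"
      using \<open>l \<le> k\<close> kl by (simp add: incr_def drop_update_swap)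
    ultimately show ?thesis
      using Cons.IH[of i' "k - l" "drop l ts"] sum_list_take_incr[OF kl, of l] Cons.prems(2) Suc
      by (simp add: incr_def)
  qed
qed (simp add: in_block_def)

lemma in_block_segment_sums:
  assumes "in_block ts k p" "in_block ls i (Suc k)"
  shows "in_block (segment_sums ls ts) i p"
proof -
  have "sum_list (take (sum_list (take i ls)) ts) \<le> sum_list (take k ts)"
    "sum_list (take (Suc k) ts) \<le> sum_list (take (sum_list (take (Suc i) ls)) ts)"
    using assms(2) by (intro sum_list_take_mono; simp add: in_block_def)+
  then show ?thesis
    using assms unfolding in_block_def sum_list_take_segment_sums by auto
qed

context bilateral_cloning_system
begin

text \<open>An increment of \<open>ts\<close> at k increments the sum of the segment containing k,
  and both sides clone at the same strand. Validity of the segment sums is part of the induction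
  because the increment rule requires it.\<close>

lemma clone_clone_segment_sums:
  assumes ls: "valid_tuple ls" and f: "f \<in> G (length ls)"
    and "valid_tuple ts" "length ts = sum_list ls"
  shows "valid_tuple (segment_sums ls ts) \<and> clone ts (clone ls f) = clone (segment_sums ls ts) f"
    (is "?P ts")
  using assms(3)
proof (rule valid_tuple_induct)
  show "?P (replicate (length ts) 1)"
    unfolding clone_ones assms(4) segment_sums_ones using ls by simp
  fix xs k
  assume xs: "valid_tuple xs" "length xs = length ts" "k < length ts" and IH: "?P xs"
  let ?p = "sum_list (take (Suc k) xs)"
  have b: "in_block xs k ?p"
    using in_block_last xs by simp
  obtain i where i: "in_block ls i (Suc k)"
    using in_block_exists[of "Suc k" ls] xs assms(4) by auto
  have "sum_list (segment_sums ls xs) = sum_list xs"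
    using sum_list_take_segment_sums[of "length ls" ls xs] xs assms(4) by simp
  then have "clone (incr xs k) (clone ls f) = clone (incr (segment_sums ls xs) i) f"
    using kappa_clone[OF xs(1) _ b, of "clone ls f"] clone_in[OF ls f] xs assms(4) IH f
      kappa_clone[of "segment_sums ls xs" f i ?p] in_block_segment_sums[OF b i] by simp
  then show "?P (incr xs k)"
    using segment_sums_incr[OF i, of xs] xs assms(4) IH by (simp add: valid_tuple_incr)
qed

lemma clone_clone:
  assumes "rs \<noteq> []" "\<forall>r \<in> set rs. valid_tuple r" "f \<in> G (length rs)"
  shows "clone (concat rs) (clone (map length rs) f) = clone (map sum_list rs) f"
proof -
  have "valid_tuple (map length rs)"
    using assms valid_tuple_length by (auto simp: valid_tuple_def)
  moreover have "valid_tuple (concat rs)"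
    using assms by (auto simp: valid_tuple_def)
  ultimately show ?thesis
    using clone_clone_segment_sums[of "map length rs" f "concat rs"] assms
    by (simp add: segment_sums_concat length_concat)
qed

end

subsection \<open>Horizontal product of a cloning system\<close>

context bilateral_cloning_system
begin

lemma iota_iter_in: "1 \<le> n \<Longrightarrow> g \<in> G n \<Longrightarrow> iota_iter S n r g \<in> G (n + r)"
  by (induction r) (auto intro: iota_in)

lemma zeta_iter_in: "1 \<le> n \<Longrightarrow> g \<in> G n \<Longrightarrow> zeta_iter S n l g \<in> G (n + l)"
  by (induction l) (auto intro: zeta_in)

lemma iota_iter_one: "1 \<le> n \<Longrightarrow> iota_iter S n r \<one>\<^bsub>grp S n\<^esub> = \<one>\<^bsub>grp S (n + r)\<^esub>"
  by (induction r) (auto simp: iota_one)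

lemma zeta_iter_one: "1 \<le> n \<Longrightarrow> zeta_iter S n l \<one>\<^bsub>grp S n\<^esub> = \<one>\<^bsub>grp S (n + l)\<^esub>"
  by (induction l) (auto simp: zeta_one)

lemma iota_iter_mult:
  assumes "1 \<le> n" "x \<in> G n" "y \<in> G n"
  shows "iota_iter S n r (x \<otimes>\<^bsub>grp S n\<^esub> y) = iota_iter S n r x \<otimes>\<^bsub>grp S (n + r)\<^esub> iota_iter S n r y"
  by (induction r) (use assms in \<open>auto simp: iota_mult iota_iter_in\<close>)

lemma zeta_iter_mult:
  assumes "1 \<le> n" "x \<in> G n" "y \<in> G n"
  shows "zeta_iter S n l (x \<otimes>\<^bsub>grp S n\<^esub> y) = zeta_iter S n l x \<otimes>\<^bsub>grp S (n + l)\<^esub> zeta_iter S n l y"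
  by (induction l) (use assms in \<open>auto simp: zeta_mult zeta_iter_in\<close>)

lemma iota_iter_add: "iota_iter S (n + a) b (iota_iter S n a g) = iota_iter S n (a + b) g"
  by (induction b) (auto simp: add.assoc)

lemma zeta_iter_add: "zeta_iter S (n + a) b (zeta_iter S n a g) = zeta_iter S n (a + b) g"
  by (induction b) (auto simp: add.assoc)

lemma zeta_iota_iter1:
  assumes "1 \<le> n" "g \<in> G n"
  shows "zeta S (n + r) (iota_iter S n r g) = iota_iter S (Suc n) r (zeta S n g)"
proof (induction r)
  case (Suc r)
  then show ?case
    using zeta_iota[of "n + r" "iota_iter S n r g"] iota_iter_in[OF assms] assms by simp
qed simp

lemma zeta_iota_iter:
  assumes "1 \<le> n" "g \<in> G n"
  shows "zeta_iter S (n + r) l (iota_iter S n r g) = iota_iter S (n + l) r (zeta_iter S n l g)"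
proof (induction l)
  case (Suc l)
  then show ?case
    using zeta_iota_iter1[of "n + l" "zeta_iter S n l g" r] zeta_iter_in[OF assms, of l] assms
    by (simp add: ac_simps)
qed simp

lemma signed_proj_iota_iter:
  assumes n: "1 \<le> n" and g: "g \<in> G n" and j: "1 \<le> j" "j \<le> n + r"
  shows "signed_proj S (n + r) (iota_iter S n r g) (int j)
    = (if j \<le> n then signed_proj S n g (int j) else int j)"
  using j
proof (induction r)
  case (Suc r)
  then show ?case
    using signed_proj_iota[of "n + r" "iota_iter S n r g" j] iota_iter_in[OF n g] n by auto
qed simp

lemma signed_proj_zeta_iter:
  assumes n: "1 \<le> n" and g: "g \<in> G n" and j: "1 \<le> j" "j \<le> n + l"
  shows "signed_proj S (n + l) (zeta_iter S n l g) (int j) =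
    (if j \<le> l then int j else shift l (signed_proj S n g (int (j - l))))"
  using j
proof (induction l arbitrary: j)
  case 0
  then show ?case
    by (simp add: shift_def)
next
  case (Suc l)
  have shift: "shift 1 (shift l x) = shift (Suc l) x" for x
    by (auto simp: shift_def)
  have Z: "signed_proj S (Suc (n + l)) (zeta S (n + l) (zeta_iter S n l g)) (int j) =
      (if j = 1 then 1 else shift 1 (signed_proj S (n + l) (zeta_iter S n l g) (int (j - 1))))"
    by (rule signed_proj_zeta) (use n Suc.prems zeta_iter_in[OF n g] in auto)
  show ?case
  proof (cases "j = 1")
    case True
    then show ?thesis
      using Z by simp
  next
    case False
    then have "1 \<le> j - 1" "j - 1 \<le> n + l"
      using Suc.prems by auto
    from Suc.IH[OF this] have Y: "signed_proj S (n + l) (zeta_iter S n l g) (int (j - 1)) =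
        (if j \<le> Suc l then int (j - 1) else shift l (signed_proj S n g (int (j - Suc l))))"
      by (simp add: le_diff_conv)
    have Z': "signed_proj S (Suc (n + l)) (zeta S (n + l) (zeta_iter S n l g)) (int j) =
        shift 1 (signed_proj S (n + l) (zeta_iter S n l g) (int (j - 1)))"
      using Z False by simp
    have "shift 1 (int (j - 1)) = int j"
      using False Suc.prems(1) by (simp add: shift_def)
    then show ?thesis
      using Z' unfolding Y by (simp add: shift del: One_nat_def)
  qed
qed

lemma proj_eq_nat_signed_proj:
  assumes "1 \<le> j" "j \<le> n"
  shows "proj S n g j = nat \<bar>signed_proj S n g (int j)\<bar>"
  using assms by (simp add: signed_proj_flips)

lemma kappa_iota_iter1:
  assumes j: "1 \<le> j" "j \<le> n" and g: "g \<in> G n"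
  shows "kappa S (n + r) j (iota_iter S n r g) = iota_iter S (Suc n) r (kappa S n j g)"
proof (induction r)
  case (Suc r)
  then show ?case
    using iota_kappa[of j "n + r" "iota_iter S n r g"] iota_iter_in[of n g r] j g by simp
qed simp

text \<open>Doubling any of the strands added on the right just adds another one: (vii) for the last
  strand, and (iii) to reach the earlier ones.\<close>

lemma kappa_iota_iter2:
  assumes n: "1 \<le> n" and g: "g \<in> G n" and j: "n < j" "j \<le> n + r"
  shows "kappa S (n + r) j (iota_iter S n r g) = iota_iter S n (Suc r) g"
  using j
proof (induction r)
  case (Suc r)
  have X: "iota_iter S n r g \<in> G (n + r)"
    by (rule iota_iter_in[OF n g])
  show ?case
  proof (cases "j = Suc (n + r)")
    case True
    then show ?thesis
      using iota_iota[OF _ X] n by simp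
  next
    case False
    then show ?thesis
      using Suc iota_kappa[of j "n + r" "iota_iter S n r g"] X by simp
  qed
qed simp

lemma kappa_zeta_iter1:
  assumes j: "1 \<le> j" "j \<le> n" and g: "g \<in> G n"
  shows "kappa S (n + l) (l + j) (zeta_iter S n l g) = zeta_iter S (Suc n) l (kappa S n j g)"
proof (induction l)
  case (Suc l)
  then show ?case
    using zeta_kappa[of "l + j" "n + l" "zeta_iter S n l g"] zeta_iter_in[of n g l] j g by simp
qed simp

text \<open>Mirror image: (vii') for the first strand, then (iii').\<close>

lemma kappa_zeta_iter2:
  assumes n: "1 \<le> n" and g: "g \<in> G n" and j: "1 \<le> j" "j \<le> l"
  shows "kappa S (n + l) j (zeta_iter S n l g) = zeta_iter S n (Suc l) g"
  using j
proof (induction l arbitrary: j)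
  case (Suc l)
  have X: "zeta_iter S n l g \<in> G (n + l)"
    by (rule zeta_iter_in[OF n g])
  show ?case
  proof (cases "j = 1")
    case True
    then show ?thesis
      using zeta_zeta[OF _ X] n by simp
  next
    case False
    then show ?thesis
      using Suc.IH[of "j - 1"] Suc.prems zeta_kappa[of "j - 1" "n + l" "zeta_iter S n l g"] X by simp
  qed
qed simp

definition hprod :: "nat \<Rightarrow> nat \<Rightarrow> 'a \<Rightarrow> 'a \<Rightarrow> 'a" where
  "hprod n m f g = iota_iter S n m f \<otimes>\<^bsub>grp S (n + m)\<^esub> zeta_iter S m n g"

lemma zeta_iter_in': "1 \<le> m \<Longrightarrow> g \<in> G m \<Longrightarrow> zeta_iter S m n g \<in> G (n + m)"
  using zeta_iter_in[of m g n] by (simp add: add.commute)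

lemma hprod_in:
  assumes "1 \<le> n" "1 \<le> m" "f \<in> G n" "g \<in> G m"
  shows "hprod n m f g \<in> G (n + m)"
  unfolding hprod_def using assms by (intro grp_simps(4) iota_iter_in zeta_iter_in') auto

lemma proj_zeta_iter_fixed:
  assumes "1 \<le> m" "g \<in> G m" "1 \<le> j" "j \<le> n"
  shows "proj S (n + m) (zeta_iter S m n g) j = j"
  using proj_eq_nat_signed_proj[of j "n + m" "zeta_iter S m n g"] assms
    signed_proj_zeta_iter[of m g j n] by (simp add: add.commute)

text \<open>The right factor fixes strand j, so (v) keeps the index on the left factor, and the
  right factor merely receives one more trivial strand.\<close>

lemma kappa_hprod1:
  assumes j: "1 \<le> j" "j \<le> n" and m: "1 \<le> m" and f: "f \<in> G n" and g: "g \<in> G m"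
  shows "kappa S (n + m) j (hprod n m f g) = hprod (Suc n) m (kappa S n j f) g"
proof -
  have n: "1 \<le> n"
    using j by simp
  have "kappa S (n + m) j (hprod n m f g)
    = kappa S (n + m) (proj S (n + m) (zeta_iter S m n g) j) (iota_iter S n m f)
      \<otimes>\<^bsub>grp S (n + m + 1)\<^esub> kappa S (n + m) j (zeta_iter S m n g)"
    unfolding hprod_def by (rule kappa_mult) (use j iota_iter_in[OF n f] zeta_iter_in'[OF m g] in auto)
  then show ?thesis
    using kappa_iota_iter1[OF j f, of m] kappa_zeta_iter2[OF m g j] proj_zeta_iter_fixed[OF m g j]
    by (simp add: hprod_def add.commute)
qed

text \<open>Here (v) moves the index on the left factor to some \<open>?t\<close> beyond n. Its
  exact value is immaterial, since cloning any added strand of the left factor gives the same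
  element.\<close>

lemma kappa_hprod2:
  assumes n: "1 \<le> n" and j: "1 \<le> j" "j \<le> m" and f: "f \<in> G n" and g: "g \<in> G m"
  shows "kappa S (n + m) (n + j) (hprod n m f g) = hprod n (Suc m) f (kappa S m j g)"
proof -
  have m: "1 \<le> m"
    using j by simp
  let ?t = "proj S (n + m) (zeta_iter S m n g) (n + j)"
  have "int ?t = \<bar>shift n (signed_proj S m g (int j))\<bar>"
    using proj_eq_nat_signed_proj[of "n + j" "n + m" "zeta_iter S m n g"] j
      signed_proj_zeta_iter[OF m g, of "n + j" n] by (simp add: add.commute)
  moreover have "signed_proj S m g (int j) \<noteq> 0" "\<bar>signed_proj S m g (int j)\<bar> \<le> int m"
    using signed_perms_in_range[OF signed_proj_in_signed_perms[OF m g] j] by auto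
  ultimately have t: "n < ?t" "?t \<le> n + m"
    by (auto simp: shift_def split: if_splits)
  have "kappa S (n + m) (n + j) (hprod n m f g) = kappa S (n + m) ?t (iota_iter S n m f)
      \<otimes>\<^bsub>grp S (n + m + 1)\<^esub> kappa S (n + m) (n + j) (zeta_iter S m n g)"
    unfolding hprod_def by (rule kappa_mult) (use j iota_iter_in[OF n f] zeta_iter_in'[OF m g] in auto)
  moreover have "kappa S (n + m) (n + j) (zeta_iter S m n g) = zeta_iter S (Suc m) n (kappa S m j g)"
    using kappa_zeta_iter1[OF j g, of n] by (simp add: add.commute)
  ultimately show ?thesis
    using kappa_iota_iter2[OF n f t] by (simp add: hprod_def)
qed

end

lemma in_block_append1: "in_block ms i p \<Longrightarrow> in_block (ms @ ns) i p"
  by (auto simp: in_block_def)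

lemma in_block_append2: "in_block ns i p \<Longrightarrow> in_block (ms @ ns) (length ms + i) (sum_list ms + p)"
  by (auto simp: in_block_def simp flip: add_Suc_right)

context bilateral_cloning_system
begin

text \<open>Axiom (3), by two increment inductions: over \<open>ns\<close> with all strands of f
  single, then over \<open>ms\<close>.\<close>

lemma clone_hprod:
  assumes ms: "valid_tuple ms" and ns: "valid_tuple ns"
    and f: "f \<in> G (length ms)" and g: "g \<in> G (length ns)"
  shows "hprod (sum_list ms) (sum_list ns) (clone ms f) (clone ns g)
    = clone (ms @ ns) (hprod (length ms) (length ns) f g)"
proof -
  let ?n = "length ms" and ?m = "length ns" and ?h = "hprod (length ms) (length ns) f g"
  have n: "1 \<le> ?n" and m: "1 \<le> ?m"
    using valid_tuple_length[OF ms] valid_tuple_length[OF ns] by auto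
  have h: "?h \<in> G (?n + ?m)"
    by (rule hprod_in[OF n m f g])
  let ?P = "\<lambda>xs ys. hprod (sum_list xs) (sum_list ys) (clone xs f) (clone ys g) = clone (xs @ ys) ?h"
  let ?one = "replicate ?n 1"
  have one: "valid_tuple ?one"
    using ms by (auto simp: valid_tuple_def)
  have "?P ?one ns"
  proof (rule valid_tuple_induct[OF ns, where P = "?P ?one"])
    show "?P ?one (replicate ?m 1)"
      unfolding clone_ones replicate_add[symmetric] by (simp add: sum_list_replicate)
    fix ys i
    assume ys: "valid_tuple ys" "length ys = ?m" "i < ?m" and IH: "?P ?one ys"
    let ?p = "sum_list (take (Suc i) ys)"
    have b: "in_block ys i ?p"
      using in_block_last ys by simp
    have bb: "in_block (?one @ ys) (?n + i) (?n + ?p)"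
      using in_block_append2[OF b, of ?one] by (simp add: sum_list_replicate)
    have v: "valid_tuple (?one @ ys)"
      using one ys by (simp add: valid_tuple_def)
    have "hprod ?n (Suc (sum_list ys)) f (kappa S (sum_list ys) ?p (clone ys g))
        = kappa S (?n + sum_list ys) (?n + ?p) (hprod ?n (sum_list ys) f (clone ys g))"
      by (rule kappa_hprod2[symmetric])
        (use n f g ys in_block_bounds[OF b] clone_in[OF ys(1), of g] in auto)
    then show "?P ?one (incr ys i)"
      using kappa_clone[OF ys(1) _ b, of g] kappa_clone[OF v _ bb, of ?h] h g ys IH
        incr_append2[of ?one ys i] clone_ones[of ?n f] by (simp add: sum_list_replicate)
  qed
  note base = this
  show "?P ms ns"
  proof (rule valid_tuple_induct[OF ms, where P = "\<lambda>xs. ?P xs ns"])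
    show "?P ?one ns"
      by (rule base)
    fix xs i
    assume xs: "valid_tuple xs" "length xs = ?n" "i < ?n" and IH: "?P xs ns"
    let ?p = "sum_list (take (Suc i) xs)"
    have b: "in_block xs i ?p"
      using in_block_last xs by simp
    have bb: "in_block (xs @ ns) i ?p"
      by (rule in_block_append1[OF b])
    have v: "valid_tuple (xs @ ns)"
      using ns xs by (auto simp: valid_tuple_def)
    have sn: "1 \<le> sum_list ns"
      using valid_tuple_ge_length[OF ns] m by simp
    have "hprod (Suc (sum_list xs)) (sum_list ns) (kappa S (sum_list xs) ?p (clone xs f)) (clone ns g)
        = kappa S (sum_list xs + sum_list ns) ?p
          (hprod (sum_list xs) (sum_list ns) (clone xs f) (clone ns g))"
      by (rule kappa_hprod1[symmetric])
        (use sn f g xs in_block_bounds[OF b] clone_in[OF xs(1), of f] clone_in[OF ns g] in auto)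
    then show "?P (incr xs i) ns"
      using kappa_clone[OF xs(1) _ b, of f] kappa_clone[OF v _ bb, of ?h] h f xs IH
        incr_append1[of i xs ns] by simp
  qed
qed

text \<open>The signed projection is multiplicative, and its factors act on separate blocks:
  \<zeta>(g) fixes the left strands, and \<iota>(f) fixes the right strands, including the negatives
  that \<zeta>(g) may produce.\<close>

lemma signed_proj_hprod:
  assumes n: "1 \<le> n" and m: "1 \<le> m" and f: "f \<in> G n" and g: "g \<in> G m"
  shows "signed_proj S (n + m) (hprod n m f g)
    = signed_block n m (signed_proj S n f) (signed_proj S m g)"
proof (rule odd_map_eqI[OF odd_map_signed_proj])
  show "odd_map (n + m) (signed_block n m (signed_proj S n f) (signed_proj S m g))"
    by (simp add: signed_block_def)
  fix j assume j: "1 \<le> j" "j \<le> n + m"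
  let ?i = "signed_proj S (n + m) (iota_iter S n m f)"
  have "signed_proj S (n + m) (hprod n m f g) (int j)
    = ?i (signed_proj S (n + m) (zeta_iter S m n g) (int j))"
    unfolding hprod_def
    using signed_proj_mult[of "n + m" "iota_iter S n m f" "zeta_iter S m n g"]
      iota_iter_in[OF n f, of m] zeta_iter_in'[OF m g, of n] n by simp
  also have "signed_proj S (n + m) (zeta_iter S m n g) (int j) =
      (if j \<le> n then int j else shift n (signed_proj S m g (int (j - n))))"
    using signed_proj_zeta_iter[OF m g, of j n] j by (simp add: add.commute)
  finally have e: "signed_proj S (n + m) (hprod n m f g) (int j) =
      ?i (if j \<le> n then int j else shift n (signed_proj S m g (int (j - n))))" .
  show "signed_proj S (n + m) (hprod n m f g) (int j)
    = signed_block n m (signed_proj S n f) (signed_proj S m g) (int j)"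
  proof (cases "j \<le> n")
    case True
    then show ?thesis
      using e signed_proj_iota_iter[OF n f j] by (simp add: signed_block_def odd_extension_nat[OF j])
  next
    case False
    define x where "x = signed_proj S m g (int (j - n))"
    have x: "x \<noteq> 0" "\<bar>x\<bar> \<le> int m"
      using signed_perms_in_range[OF signed_proj_in_signed_perms[OF m g], of "j - n"] False j
      by (auto simp: x_def)
    have "?i (shift n x) = shift n x"
    proof (cases "x > 0")
      case True
      then have "shift n x = int (nat x + n)" "nat x + n \<le> n + m" "\<not> nat x + n \<le> n" "1 \<le> nat x + n"
        using x by (auto simp: shift_def)
      then show ?thesis
        using signed_proj_iota_iter[OF n f, of "nat x + n" m] by simp
    next
      case False
      define y where "y = nat (- x) + n"
      have "shift n x = - int y" and y: "y \<le> n + m" "\<not> y \<le> n" "1 \<le> y"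
        using x False by (auto simp: shift_def y_def)
      moreover have "?i (- int y) = - ?i (int y)"
        using odd_map_signed_proj[of "n + m" S "iota_iter S n m f"] by (simp add: odd_map_def)
      ultimately show ?thesis
        using signed_proj_iota_iter[OF n f y(3,1)] by simp
    qed
    then show ?thesis
      using e False x_def by (simp add: signed_block_def odd_extension_nat[OF j] shift_def)
  qed
qed


subsection \<open>Elements supported on consecutive strands\<close>

text \<open>h with \<open>a\<close> trivial strands on its left and \<open>b\<close> on its right.
  The \<nu> of axiom (viii) is the case a = j - 1, b = n - j.\<close>

definition place :: "nat \<Rightarrow> nat \<Rightarrow> nat \<Rightarrow> 'a \<Rightarrow> 'a" where
  "place a m b h = zeta_iter S (m + b) a (iota_iter S m b h)"

lemma place_in: "1 \<le> m \<Longrightarrow> h \<in> G m \<Longrightarrow> place a m b h \<in> G (m + b + a)"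
  unfolding place_def by (intro zeta_iter_in iota_iter_in) auto

lemma kappa_place_left:
  assumes "1 \<le> m" "h \<in> G m" "1 \<le> p" "p \<le> a"
  shows "kappa S (m + b + a) p (place a m b h) = place (Suc a) m b h"
  unfolding place_def using kappa_zeta_iter2[of "m + b" "iota_iter S m b h" p a] iota_iter_in
    assms by simp

lemma kappa_place_right:
  assumes "1 \<le> m" "h \<in> G m" "a + m < p" "p \<le> m + b + a"
  shows "kappa S (m + b + a) p (place a m b h) = place a m (Suc b) h"
proof -
  have "kappa S (m + b + a) (a + (p - a)) (place a m b h)
      = zeta_iter S (Suc (m + b)) a (kappa S (m + b) (p - a) (iota_iter S m b h))"
    unfolding place_def by (rule kappa_zeta_iter1) (use assms iota_iter_in in auto)
  then show ?thesis
    using kappa_iota_iter2[of m h "p - a" b] assms by (simp add: place_def)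
qed

lemma proj_place:
  assumes m: "1 \<le> m" and h: "h \<in> G m" and p: "1 \<le> p" "p \<le> a \<or> a + m < p" "p \<le> m + b + a"
  shows "proj S (m + b + a) (place a m b h) p = p"
proof (cases "p \<le> a")
  case True
  then show ?thesis
    unfolding place_def using proj_zeta_iter_fixed[of "m + b" "iota_iter S m b h" p a]
      iota_iter_in[OF m h, of b] m p
    by (simp add: add.commute[of _ a])
next
  case False
  have I: "iota_iter S m b h \<in> G (m + b)"
    by (rule iota_iter_in[OF m h])
  have "signed_proj S (m + b) (iota_iter S m b h) (int (p - a)) = int (p - a)"
    using signed_proj_iota_iter[OF m h, of "p - a" b] False p by auto
  then show ?thesis
    using proj_eq_nat_signed_proj[of p "m + b + a" "place a m b h"]
      signed_proj_zeta_iter[of "m + b" "iota_iter S m b h" p a] I m p False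
    by (simp add: place_def shift_def)
qed

text \<open>The product 1 \<otimes> ... \<otimes> h \<otimes> ... \<otimes> 1 with h in the i-th
  block.\<close>

definition block_elem :: "nat list \<Rightarrow> nat \<Rightarrow> 'a \<Rightarrow> 'a" where
  "block_elem ms i h = place (sum_list (take i ms)) (ms ! i) (sum_list (drop (Suc i) ms)) h"

lemma sum_list_split:
  fixes ms :: "nat list"
  assumes "i < length ms"
  shows "sum_list ms = ms ! i + sum_list (drop (Suc i) ms) + sum_list (take i ms)"
proof -
  have "sum_list (take i ms @ ms ! i # drop (Suc i) ms) = sum_list ms"
    using id_take_nth_drop[OF assms] by simp
  then show ?thesis
    by simp
qed

lemma block_elem_in:
  assumes "i < length ms" "1 \<le> ms ! i" "h \<in> G (ms ! i)"
  shows "block_elem ms i h \<in> G (sum_list ms)"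
  unfolding block_elem_def sum_list_split[OF assms(1)] by (rule place_in[OF assms(2,3)])

text \<open>The strands of the other blocks are padding: they are fixed, and doubling one of them
  only lengthens the padding on its side. Both facts feed (v).\<close>

lemma block_elem_outside:
  assumes i: "i < length ms" "1 \<le> ms ! i" "h \<in> G (ms ! i)"
    and b: "in_block ms k p" and k: "k \<noteq> i"
  shows "kappa S (sum_list ms) p (block_elem ms i h) = block_elem (incr ms k) i h"
    and "proj S (sum_list ms) (block_elem ms i h) p = p"
proof -
  have kl: "k < length ms"
    using b by (simp add: in_block_def)
  have p: "1 \<le> p" "p \<le> sum_list ms"
    using in_block_bounds[OF b] by auto
  have less: "k < i \<Longrightarrow> p \<le> sum_list (take i ms)"
    using b sum_list_take_mono[of "Suc k" i ms] by (simp add: in_block_def)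
  have greater: "i < k \<Longrightarrow> sum_list (take i ms) + ms ! i < p"
    using b sum_list_take_mono[of "Suc i" k ms] sum_list_take_Suc[OF i(1)] by (simp add: in_block_def)
  have "p \<le> sum_list (take i ms) \<or> sum_list (take i ms) + ms ! i < p"
    using less greater k by (cases i k rule: linorder_cases) auto
  then show "proj S (sum_list ms) (block_elem ms i h) p = p"
    unfolding block_elem_def using proj_place[OF i(2,3) p(1)] p(2) sum_list_split[OF i(1)] by metis
  show "kappa S (sum_list ms) p (block_elem ms i h) = block_elem (incr ms k) i h"
  proof (cases "k < i")
    case True
    then show ?thesis
      unfolding block_elem_def sum_list_split[OF i(1)]
      using kappa_place_left[OF i(2,3) p(1) less] kl i(1)
      by (simp add: sum_list_take_incr sum_list_drop_incr nth_incr)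
  next
    case False
    then show ?thesis
      unfolding block_elem_def sum_list_split[OF i(1)]
      using kappa_place_right[OF i(2,3) greater, of "sum_list (drop (Suc i) ms)"] kl i(1) k p
        sum_list_split[OF i(1)]
      by (simp add: sum_list_take_incr sum_list_drop_incr nth_incr)
  qed
qed

text \<open>Places the \<kappa>_i(m) of (viii) among the tuple clonings, as the start of the
  induction for \<open>clone_block_elem\<close>.\<close>

lemma clone_single:
  assumes i: "i < n" and m: "1 \<le> m" and f: "f \<in> G n"
  shows "clone ((replicate n 1)[i := m]) f = kappa_iter S n (Suc i) m f"
  using m
proof (induction m rule: dec_induct)
  case base
  have "(replicate n 1)[i := 1] = replicate n (1::nat)"
    using i by (metis list_update_id nth_replicate)
  then show ?case
    using clone_ones[of n f] by simp
next
  case (step m)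
  let ?xs = "(replicate n 1)[i := m]"
  have v: "valid_tuple ?xs"
    using i step.hyps by (auto simp: valid_tuple_nth nth_list_update)
  have t: "take i ?xs = replicate i 1"
    using i by (simp add: take_update_cancel)
  have b: "in_block ?xs i (Suc i)"
    using i step.hyps t sum_list_take_Suc[of i ?xs] by (simp add: in_block_def sum_list_replicate)
  have "drop (Suc i) ?xs = replicate (n - Suc i) 1"
    by simp
  then have "sum_list ?xs = n + m - 1"
    using sum_list_split[of i ?xs] t i by (simp add: sum_list_replicate)
  moreover have "incr ?xs i = (replicate n 1)[i := Suc m]"
    using i by (simp add: incr_def)
  ultimately show ?case
    using kappa_clone[OF v _ b, of f] f step.IH kappa_iter_Suc[OF step.hyps(1)] by simp
qed

end

section \<open>Consequences of the operadic axioms (viii) and (ix)\<close>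

context operadic_cloning_system
begin

text \<open>Axiom (viii) is the case of a tuple with a single entry different from 1; cloning the other
  strands preserves the relation.\<close>

lemma clone_block_elem:
  assumes ms: "valid_tuple ms" and f: "f \<in> G (length ms)"
    and i: "i < length ms" and h: "h \<in> G (ms ! i)"
  defines "s \<equiv> signed_proj S (length ms) f"
  defines "u \<equiv> \<lambda>k. unsigned (length ms) s (Suc k) - 1"
  shows "clone ms f \<otimes>\<^bsub>grp S (sum_list ms)\<^esub> block_elem ms i h
    = block_elem (permute_tuple s ms) (u i) h \<otimes>\<^bsub>grp S (sum_list ms)\<^esub> clone ms f"
proof -
  let ?n = "length ms" and ?m = "ms ! i"
  let ?ms0 = "(replicate ?n 1)[i := ?m]"
  have n: "1 \<le> ?n"
    by (rule valid_tuple_length[OF ms])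
  have m: "1 \<le> ?m"
    using ms i by (simp add: valid_tuple_nth)
  have s: "s \<in> signed_perms ?n"
    unfolding s_def by (rule signed_proj_in_signed_perms[OF n f])
  have u: "u k < ?n" if "k < ?n" for k
    using unsigned_in[OF s that] by (auto simp: u_def)
  \<comment> \<open>The first conjunct records that entry i already has its final value, so the
    induction only ever increments other entries and h stays in the right group.\<close>
  let ?P = "\<lambda>xs. xs ! i = ?m \<and> clone xs f \<otimes>\<^bsub>grp S (sum_list xs)\<^esub> block_elem xs i h
    = block_elem (permute_tuple s xs) (u i) h \<otimes>\<^bsub>grp S (sum_list xs)\<^esub> clone xs f"
  have "?P ms"
  proof (rule tuple_induct[where ?ms0.0 = ?ms0 and ms = ms and P = ?P])
    fix k assume "k < ?n"
    then show "?ms0 ! k \<le> ms ! k"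
      using ms by (cases "k = i") (auto simp: valid_tuple_nth nth_list_update)
  next
    have "permute_tuple s ?ms0 = (replicate ?n 1)[u i := ?m]"
      using permute_tuple_list_update[of s "replicate ?n 1" i ?m]
        permute_tuple_replicate[OF s, of "1::nat"] s i
      by (simp add: u_def)
    moreover have "block_elem ((replicate ?n 1)[k := ?m]) k h = nu S ?m (Suc k) ?n h" if "k < ?n" for k
      using that by (simp add: block_elem_def nu_def place_def take_update_cancel
        drop_update_cancel sum_list_replicate)
    moreover have "proj S ?n f (Suc i) = Suc (u i)"
      using unsigned_signed_proj[OF n f] unsigned_in[OF s i] by (simp add: u_def s_def)
    moreover have "sum_list ?ms0 = ?n + ?m - 1"
      using sum_list_split[of i ?ms0] i by (simp add: take_update_cancel sum_list_replicate)
    ultimately show "?P ?ms0"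
      using kappa_nu[OF m _ _ f h, of "Suc i"] i u[OF i] clone_single[OF i m f] by simp
  next
    fix xs k
    assume xs: "length xs = ?n" "k < ?n" "xs ! k < ms ! k" and ge: "\<And>l. l < ?n \<Longrightarrow> ?ms0 ! l \<le> xs ! l"
      and IH: "?P xs"
    have ki: "k \<noteq> i"
      using xs IH by auto
    have v: "valid_tuple xs"
      unfolding valid_tuple_nth
    proof (intro conjI allI impI)
      fix l assume "l < length xs"
      then show "1 \<le> xs ! l"
        using ge[of l] xs(1) m by (cases "l = i") (auto simp: nth_list_update)
    qed (use xs in auto)
    let ?p = "sum_list (take (Suc k) xs)" and ?N = "sum_list xs" and ?ys = "permute_tuple s xs"
    let ?q = "proj S ?N (clone xs f) ?p"
    have ys: "length ?ys = ?n" "sum_list ?ys = ?N" "?ys ! u i = ?m"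
      using sum_list_permute_tuple[of s xs] nth_permute_tuple[of s xs i] s xs(1) i IH
        by (auto simp: u_def)
    have b: "in_block xs k ?p"
      using in_block_last[OF v] xs by simp
    have b': "in_block ?ys (u k) ?q"
      using proj_clone_in_block[OF v _ b, of f] f xs(1) by (simp add: s_def u_def)
    have p: "1 \<le> ?p" "?p \<le> ?N"
      using in_block_bounds[OF b] by auto
    have uk: "u k \<noteq> u i"
      using unsigned_index_eq_iff[OF s xs(2) i] ki by (simp add: u_def)
    have c: "clone xs f \<in> G ?N"
      using clone_in[OF v] f xs(1) by simp
    have e: "block_elem xs i h \<in> G ?N"
      by (rule block_elem_in) (use i xs h m IH in auto)
    have e': "block_elem ?ys (u i) h \<in> G ?N"
      using block_elem_in[of "u i" ?ys h] u[OF i] ys h m by simp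
    have 1: "kappa S ?N ?p (clone xs f) = clone (incr xs k) f"
      using kappa_clone[OF v _ b] f xs(1) by simp
    have 2: "kappa S ?N ?p (block_elem xs i h) = block_elem (incr xs k) i h"
      "proj S ?N (block_elem xs i h) ?p = ?p"
      by (rule block_elem_outside; use i xs h m IH b ki in auto)+
    have 3: "kappa S ?N ?q (block_elem ?ys (u i) h) = block_elem (permute_tuple s (incr xs k)) (u i) h"
      using block_elem_outside(1)[of "u i" ?ys h "u k" ?q] u[OF i] ys h m b' uk
        permute_tuple_incr[of s xs k] s xs by (simp add: u_def)
    \<comment> \<open>Apply \<kappa> at \<open>?p\<close> to the relation. In the left product (v)
      keeps the index, as \<open>block_elem\<close> fixes \<open>?p\<close>; in the right product it
      moves to \<open>?q\<close>, which lies in another block than h because the strand permutation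
      is injective.\<close>
    have "clone (incr xs k) f \<otimes>\<^bsub>grp S (?N + 1)\<^esub> block_elem (incr xs k) i h
        = kappa S ?N ?p (clone xs f \<otimes>\<^bsub>grp S ?N\<^esub> block_elem xs i h)"
      using kappa_mult[OF p c e] 1 2 by simp
    also have "\<dots> = block_elem (permute_tuple s (incr xs k)) (u i) h
      \<otimes>\<^bsub>grp S (?N + 1)\<^esub> clone (incr xs k) f"
      using kappa_mult[OF p e' c] 1 3 IH by simp
    finally show "?P (incr xs k)"
      using IH ki xs i by (simp add: nth_incr)
  qed simp
  then show ?thesis
    by blast
qed

text \<open>Interchange: (ix) exchanges the inner factors \<zeta>(g) and \<iota>(p), and both maps
  are homomorphisms.\<close>

lemma hprod_mult:
  assumes n: "1 \<le> n" and m: "1 \<le> m" and fp: "f \<in> G n" "p \<in> G n"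
    and gq: "g \<in> G m" "q \<in> G m"
  shows "hprod n m f g \<otimes>\<^bsub>grp S (n + m)\<^esub> hprod n m p q = hprod n m (f \<otimes>\<^bsub>grp S n\<^esub> p) (g \<otimes>\<^bsub>grp S m\<^esub> q)"
proof -
  interpret G: group "grp S (n + m)"
    using n by (intro grp_group) simp
  let ?i = "iota_iter S n m" and ?z = "zeta_iter S m n"
  have i: "?i f \<in> G (n + m)" "?i p \<in> G (n + m)"
    using fp by (auto intro: iota_iter_in[OF n])
  have z: "?z g \<in> G (n + m)" "?z q \<in> G (n + m)"
    using gq by (auto intro: zeta_iter_in'[OF m])
  have "hprod n m f g \<otimes>\<^bsub>grp S (n + m)\<^esub> hprod n m p q
      = ?i f \<otimes>\<^bsub>grp S (n + m)\<^esub> (?z g \<otimes>\<^bsub>grp S (n + m)\<^esub> ?i p) \<otimes>\<^bsub>grp S (n + m)\<^esub> ?z q"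
    unfolding hprod_def using i z by (simp add: G.m_assoc)
  also have "?z g \<otimes>\<^bsub>grp S (n + m)\<^esub> ?i p = ?i p \<otimes>\<^bsub>grp S (n + m)\<^esub> ?z g"
    by (rule iota_zeta_commute[OF n m fp(2) gq(1), symmetric])
  also have "?i f \<otimes>\<^bsub>grp S (n + m)\<^esub> (?i p \<otimes>\<^bsub>grp S (n + m)\<^esub> ?z g) \<otimes>\<^bsub>grp S (n + m)\<^esub> ?z q
      = (?i f \<otimes>\<^bsub>grp S (n + m)\<^esub> ?i p) \<otimes>\<^bsub>grp S (n + m)\<^esub> (?z g \<otimes>\<^bsub>grp S (n + m)\<^esub> ?z q)"
    using i z by (simp add: G.m_assoc)
  finally show ?thesis
    unfolding hprod_def using iota_iter_mult[OF n fp] zeta_iter_mult[OF m gq, of n]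
      by (simp add: add.commute)
qed

text \<open>The outer factors agree by adding numbers of iterations, the middle one by (vi) in
  iterated form.\<close>

lemma hprod_assoc:
  assumes n: "1 \<le> n" "1 \<le> m" "1 \<le> k"
    and f: "f \<in> G n" and g: "g \<in> G m" and h: "h \<in> G k"
  shows "hprod (n + m) k (hprod n m f g) h = hprod n (m + k) f (hprod m k g h)"
proof -
  let ?N = "n + (m + k)"
  interpret G: group "grp S ?N"
    using n by (intro grp_group) simp
  have F: "iota_iter S (n + m) k (iota_iter S n m f) = iota_iter S n (m + k) f"
    by (rule iota_iter_add)
  have H: "zeta_iter S (k + m) n (zeta_iter S k m h) = zeta_iter S k (m + n) h"
    by (rule zeta_iter_add)
  have GZ: "zeta_iter S (m + k) n (iota_iter S m k g) = iota_iter S (m + n) k (zeta_iter S m n g)"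
    by (rule zeta_iota_iter[OF n(2) g])
  have 1: "iota_iter S (n + m) k (hprod n m f g)
      = iota_iter S n (m + k) f \<otimes>\<^bsub>grp S ?N\<^esub> iota_iter S (n + m) k (zeta_iter S m n g)"
    unfolding hprod_def
    using iota_iter_mult[of "n + m" "iota_iter S n m f" "zeta_iter S m n g" k] F n
      iota_iter_in[OF n(1) f] zeta_iter_in'[OF n(2) g] by (simp add: add.assoc)
  have 2: "zeta_iter S (m + k) n (hprod m k g h)
      = zeta_iter S (m + k) n (iota_iter S m k g) \<otimes>\<^bsub>grp S ?N\<^esub> zeta_iter S k (n + m) h"
    unfolding hprod_def
    using zeta_iter_mult[of "m + k" "iota_iter S m k g" "zeta_iter S k m h" n] H n
      iota_iter_in[OF n(2) g, of k] zeta_iter_in'[OF n(3) h, of m]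
    by (simp add: add.commute[of k m] add.commute[of _ n])
  have in_N: "iota_iter S n (m + k) f \<in> G ?N" "zeta_iter S k (n + m) h \<in> G ?N"
    "iota_iter S (n + m) k (zeta_iter S m n g) \<in> G ?N"
    using iota_iter_in[OF n(1) f, of "m + k"] zeta_iter_in'[OF n(3) h, of "n + m"]
      iota_iter_in[of "n + m" "zeta_iter S m n g" k] zeta_iter_in'[OF n(2) g, of n] n
    by (simp_all add: add.assoc)
  have "hprod (n + m) k (hprod n m f g) h
      = iota_iter S n (m + k) f \<otimes>\<^bsub>grp S ?N\<^esub> iota_iter S (n + m) k (zeta_iter S m n g)
        \<otimes>\<^bsub>grp S ?N\<^esub> zeta_iter S k (n + m) h"
    unfolding hprod_def[of "n + m" k] 1 by (simp add: add.assoc)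
  also have "\<dots> = iota_iter S n (m + k) f
    \<otimes>\<^bsub>grp S ?N\<^esub> (iota_iter S (n + m) k (zeta_iter S m n g) \<otimes>\<^bsub>grp S ?N\<^esub> zeta_iter S k (n + m) h)"
    by (rule G.m_assoc[OF in_N(1,3,2)])
  also have "\<dots> = hprod n (m + k) f (hprod m k g h)"
    unfolding hprod_def[of n "m + k"] 2 GZ by (simp add: add.commute)
  finally show ?thesis .
qed

lemma hprod_one:
  assumes "1 \<le> n" "1 \<le> m"
  shows "hprod n m \<one>\<^bsub>grp S n\<^esub> \<one>\<^bsub>grp S m\<^esub> = \<one>\<^bsub>grp S (n + m)\<^esub>"
  unfolding hprod_def using iota_iter_one[OF assms(1)] zeta_iter_one[OF assms(2), of n]
    grp_simps[of "n + m"] assms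
  by (simp add: add.commute)

end

subsection \<open>The cloning PRO of an operadic cloning system\<close>

lemma Ops_pro_of_system: "Ops (pro_of_system S) n m = (if n = m \<and> n \<ge> 1 then carrier (grp S n) else {})"
  by (simp add: pro_of_system_def Let_def)

lemma vert_pro_of_system:
  "f \<in> Ops (pro_of_system S) n t \<Longrightarrow> g \<in> Ops (pro_of_system S) s n
    \<Longrightarrow> vert (pro_of_system S) s n t f g = f \<otimes>\<^bsub>grp S n\<^esub> g"
  by (simp add: pro_of_system_def Let_def restrict2_def)

lemma idn_pro_of_system: "idn (pro_of_system S) n = \<one>\<^bsub>grp S n\<^esub>"
  by (simp add: pro_of_system_def Let_def)

lemma Proj_pro_of_system: "f \<in> Ops (pro_of_system S) n m \<Longrightarrow> Proj (pro_of_system S) n m f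
  = signed_proj S n f"
  by (simp add: pro_of_system_def Let_def)

lemma extensional_pro_of_system:
  assumes "extensional_system S"
  shows "extensional_pro (pro_of_system S)"
  using assms
  by (auto simp: extensional_pro_def extensional_system_def pro_of_system_def Let_def extensional2_def
      restrict2_def)

text \<open>An equality of monoid records in all arities: arity 0 and products off the carriers must
  match too, and extensionality provides this.\<close>

lemma diag_grp_pro_of_system:
  assumes "extensional_system S"
  shows "diag_grp (pro_of_system S) = grp S"
proof
  fix n
  have "carrier (grp S n) = Ops (pro_of_system S) n n"
    using assms by (cases n) (auto simp: extensional_system_def Ops_pro_of_system)
  moreover have "mult (grp S n) = vert (pro_of_system S) n n n"
    using assms calculation
    by (auto simp: fun_eq_iff extensional_system_def extensional2_def pro_of_system_def Let_def
      restrict2_def)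
  ultimately show "diag_grp (pro_of_system S) n = grp S n"
    by (simp add: diag_grp_def idn_pro_of_system)
qed

locale normalized_system = operadic_cloning_system S
  for S :: "'a bilateral_cloning_data" +
  assumes extensional: "extensional_system S"
begin

abbreviation "P \<equiv> pro_of_system S"

lemma hor_pro_of_system:
  "f \<in> Ops P n n' \<Longrightarrow> g \<in> Ops P m m' \<Longrightarrow> hor P n n' m m' f g = hprod n m f g"
  by (simp add: pro_of_system_def Let_def restrict2_def hprod_def)

lemma Kappa_pro_of_system:
  "valid_tuple ms \<Longrightarrow> f \<in> Ops P (length ms) (length ms) \<Longrightarrow> Kappa P ms f = clone ms f"
  by (simp add: pro_of_system_def Let_def clone_def)

section \<open>Products of tuples of elements and axiom (\<star>)\<close>

definition fits :: "nat list \<Rightarrow> 'a list \<Rightarrow> bool" where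
  "fits ms gs \<longleftrightarrow> length gs = length ms \<and> (\<forall>i < length ms. gs ! i \<in> G (ms ! i))"

lemma fits_Cons: "fits (m # ms) (g # gs) \<longleftrightarrow> g \<in> G m \<and> fits ms gs"
  by (auto simp: fits_def less_Suc_eq_0_disj)

text \<open>Closure and recursion depend on each other, since \<open>hor\<close> is specified only
  on its domain. The fact \<open>step\<close> assumes closure for the tail, and the induction for
  closure discharges that assumption.\<close>

lemma hor_list_in: "valid_tuple ms \<Longrightarrow> fits ms gs \<Longrightarrow> hor_list P ms gs \<in> G (sum_list ms)"
  and hor_list_Cons: "valid_tuple ms \<Longrightarrow> fits ms gs \<Longrightarrow> 1 \<le> m \<Longrightarrow> g \<in> G m
    \<Longrightarrow> hor_list P (m # ms) (g # gs) = hprod m (sum_list ms) g (hor_list P ms gs)"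
proof -
  have step: "hor_list P (m # ms) (g # gs) = hprod m (sum_list ms) g (hor_list P ms gs)"
    if "hor_list P ms gs \<in> G (sum_list ms)"
      "valid_tuple ms" "fits ms gs" "1 \<le> m" "g \<in> G m" for m ms g gs
  proof -
    have ne: "ms \<noteq> []" "gs \<noteq> []"
      using that by (auto simp: valid_tuple_def fits_def)
    have "1 \<le> sum_list ms"
      using valid_tuple_ge_length[OF that(2)] ne by (cases ms) auto
    moreover have "hor_list P (m # ms) (g # gs)
      = hor P m m (sum_list ms) (sum_list ms) g (hor_list P ms gs)"
      using ne by (cases ms; cases gs) simp_all
    ultimately show ?thesis
      using hor_pro_of_system that by (simp add: Ops_pro_of_system)
  qed
  show in_car: "hor_list P ms gs \<in> G (sum_list ms)" if "valid_tuple ms" "fits ms gs" for ms gs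
    using that
  proof (induction ms arbitrary: gs)
    case (Cons m ms)
    then obtain g gs' where gs: "gs = g # gs'"
      by (cases gs) (auto simp: fits_def)
    show ?case
    proof (cases "ms = []")
      case True
      then show ?thesis
        using Cons.prems gs by (auto simp: fits_def)
    next
      case False
      then have v: "valid_tuple ms" "1 \<le> m"
        using Cons.prems by (auto simp: valid_tuple_def)
      then have "1 \<le> sum_list ms"
        using valid_tuple_ge_length[of ms] valid_tuple_length[of ms] by simp
      then show ?thesis
        using step[OF Cons.IH[OF v(1)] v(1) _ v(2)] Cons.IH[OF v(1)] Cons.prems hprod_in v
        by (simp add: gs fits_Cons)
    qed
  qed (simp add: valid_tuple_def)
  show "valid_tuple ms \<Longrightarrow> fits ms gs \<Longrightarrow> 1 \<le> m \<Longrightarrow> g \<in> G m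
    \<Longrightarrow> hor_list P (m # ms) (g # gs) = hprod m (sum_list ms) g (hor_list P ms gs)"
    by (rule step) (simp_all add: in_car)
qed

text \<open>Iterated interchange; it makes both sides of (\<star>) multiplicative in the
  tuple.\<close>

lemma hor_list_mult:
  assumes "valid_tuple ms" "fits ms gs" "fits ms hs" "length ks = length ms"
    and "\<And>i. i < length ms \<Longrightarrow> ks ! i = gs ! i \<otimes>\<^bsub>grp S (ms ! i)\<^esub> hs ! i"
  shows "hor_list P ms ks = hor_list P ms gs \<otimes>\<^bsub>grp S (sum_list ms)\<^esub> hor_list P ms hs"
  using assms
proof (induction ms arbitrary: gs hs ks)
  case (Cons m ms)
  obtain g gs' h hs' k ks' where gs: "gs = g # gs'" "hs = h # hs'" "ks = k # ks'"
    using Cons.prems by (cases gs; cases hs; cases ks) (auto simp: fits_def)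
  have k: "k = g \<otimes>\<^bsub>grp S m\<^esub> h"
    using Cons.prems(5)[of 0] gs by simp
  have ks': "ks' ! i = gs' ! i \<otimes>\<^bsub>grp S (ms ! i)\<^esub> hs' ! i" if "i < length ms" for i
    using Cons.prems(5)[of "Suc i"] that gs by simp
  show ?case
  proof (cases "ms = []")
    case True
    then show ?thesis
      using Cons.prems gs k by (simp add: fits_def)
  next
    case False
    then have v: "valid_tuple ms" "1 \<le> m"
      using Cons.prems by (auto simp: valid_tuple_def)
    then have s: "1 \<le> sum_list ms"
      using valid_tuple_ge_length[of ms] valid_tuple_length[of ms] by simp
    have f: "fits ms gs'" "fits ms hs'" "g \<in> G m" "h \<in> G m"
      using Cons.prems gs by (auto simp: fits_Cons)
    have IH: "hor_list P ms ks' = hor_list P ms gs' \<otimes>\<^bsub>grp S (sum_list ms)\<^esub> hor_list P ms hs'"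
      using Cons.IH[OF v(1) f(1,2), of ks'] ks' Cons.prems gs by simp
    have "fits ms ks'"
      using ks' f Cons.prems gs v by (auto simp: fits_def valid_tuple_nth intro!: grp_simps(4))
    then show ?thesis
      using hor_list_Cons[OF v(1) _ v(2)] f k IH hprod_mult[OF v(2) s f(3,4)] hor_list_in[OF v(1)]
        grp_simps(4)[OF v(2) f(3,4)] by (simp add: gs)
  qed
qed (simp add: valid_tuple_def)

definition ones :: "nat list \<Rightarrow> 'a list" where
  "ones ms = map (\<lambda>m. \<one>\<^bsub>grp S m\<^esub>) ms"

lemma length_ones [simp]: "length (ones ms) = length ms"
  by (simp add: ones_def)

lemma nth_ones [simp]: "i < length ms \<Longrightarrow> ones ms ! i = \<one>\<^bsub>grp S (ms ! i)\<^esub>"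
  by (simp add: ones_def)

lemma fits_ones: "valid_tuple ms \<Longrightarrow> fits ms (ones ms)"
  by (auto simp: fits_def valid_tuple_nth intro!: grp_simps(1))

lemma hor_list_ones: "valid_tuple ms \<Longrightarrow> hor_list P ms (ones ms) = \<one>\<^bsub>grp S (sum_list ms)\<^esub>"
proof (induction ms)
  case (Cons m ms)
  show ?case
  proof (cases "ms = []")
    case False
    then have v: "valid_tuple ms" "1 \<le> m"
      using Cons.prems by (auto simp: valid_tuple_def)
    then have s: "1 \<le> sum_list ms"
      using valid_tuple_ge_length[of ms] valid_tuple_length[of ms] by simp
    show ?thesis
      using hor_list_Cons[OF v(1) fits_ones[OF v(1)] v(2) grp_simps(1)[OF v(2)]] Cons.IH[OF v(1)]
        hprod_one[OF v(2) s] by (simp add: ones_def)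
  qed (simp add: ones_def)
qed (simp add: valid_tuple_def)

text \<open>A nontrivial head followed by units becomes its \<iota>-iterate; a unit head adds its
  strands on the left by \<zeta>, which merge with those already there.\<close>

lemma hor_list_single:
  assumes "valid_tuple ms" "i < length ms" "h \<in> G (ms ! i)"
  shows "hor_list P ms ((ones ms)[i := h]) = block_elem ms i h"
  using assms
proof (induction ms arbitrary: i)
  case (Cons m ms)
  show ?case
  proof (cases "ms = []")
    case True
    then show ?thesis
      using Cons.prems by (simp add: ones_def block_elem_def place_def)
  next
    case False
    then have v: "valid_tuple ms" "1 \<le> m"
      using Cons.prems by (auto simp: valid_tuple_def)
    then have s: "1 \<le> sum_list ms"
      using valid_tuple_ge_length[of ms] valid_tuple_length[of ms] by simp
    show ?thesis
    proof (cases i)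
      case 0
      then have h: "h \<in> G m"
        using Cons.prems by simp
      have "hor_list P (m # ms) ((ones (m # ms))[i := h])
        = hprod m (sum_list ms) h \<one>\<^bsub>grp S (sum_list ms)\<^esub>"
        using hor_list_Cons[OF v(1) fits_ones[OF v(1)] v(2) h] hor_list_ones[OF v(1)] 0
        by (simp add: ones_def)
      also have "\<dots> = iota_iter S m (sum_list ms) h"
        unfolding hprod_def
        using zeta_iter_one[OF s, of m] iota_iter_in[OF v(2) h, of "sum_list ms"]
          grp_simps(3)[of "m + sum_list ms"] v
        by (simp add: add.commute[of "sum_list ms"])
      finally show ?thesis
        by (simp add: 0 block_elem_def place_def)
    next
      case (Suc i')
      have i': "i' < length ms" "h \<in> G (ms ! i')"
        using Cons.prems Suc by auto
      have mi: "1 \<le> ms ! i'"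
        using v(1) i' by (simp add: valid_tuple_nth)
      have f: "fits ms ((ones ms)[i' := h])"
        using fits_ones[OF v(1)] i' by (auto simp: fits_def nth_list_update)
      have b: "block_elem ms i' h \<in> G (sum_list ms)"
        by (rule block_elem_in[OF i'(1) mi i'(2)])
      have "hor_list P (m # ms) ((ones (m # ms))[i := h])
        = hprod m (sum_list ms) \<one>\<^bsub>grp S m\<^esub> (block_elem ms i' h)"
        using hor_list_Cons[OF v(1) f v(2) grp_simps(1)[OF v(2)]] Cons.IH[OF v(1) i'] Suc
        by (simp add: ones_def)
      also have "\<dots> = zeta_iter S (sum_list ms) m (block_elem ms i' h)"
        unfolding hprod_def using iota_iter_one[OF v(2)] zeta_iter_in'[OF s b, of m]
          grp_simps(2)[of "m + sum_list ms"] v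
        by simp
      also have "\<dots> = block_elem (m # ms) i h"
        unfolding block_elem_def place_def sum_list_split[OF i'(1)]
        using zeta_iter_add[of "ms ! i' + sum_list (drop (Suc i') ms)" "sum_list (take i' ms)" m] Suc
        by (simp add: add.commute)
      finally show ?thesis .
    qed
  qed
qed (simp add: valid_tuple_def)

lemma permute_tuple_ones:
  assumes "s \<in> signed_perms (length ms)"
  shows "permute_tuple s (ones ms) = ones (permute_tuple s ms)"
proof (rule permute_tuple_eqI)
  fix i assume "i < length (ones ms)"
  then have i: "i < length ms"
    by simp
  have "unsigned (length ms) s (Suc i) - 1 < length ms"
    using unsigned_in[OF assms i] by auto
  then show "ones (permute_tuple s ms) ! (unsigned (length (ones ms)) s (Suc i) - 1) = ones ms ! i"
    using nth_permute_tuple[OF assms i] i by simp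
qed (use assms in simp_all)

lemma fits_permute_tuple:
  assumes "fits ms gs" and s: "s \<in> signed_perms (length ms)"
  shows "fits (permute_tuple s ms) (permute_tuple s gs)"
  unfolding fits_def
proof (intro conjI allI impI)
  show "length (permute_tuple s gs) = length (permute_tuple s ms)"
    using assms by (simp add: fits_def)
  fix k assume "k < length (permute_tuple s ms)"
  then obtain i where "i < length ms" "unsigned (length ms) s (Suc i) - 1 = k"
    using unsigned_index_surj[OF s, of k] by auto
  then show "permute_tuple s gs ! k \<in> G (permute_tuple s ms ! k)"
    using nth_permute_tuple[of s ms i] nth_permute_tuple[of s gs i] assms by (auto simp: fits_def)
qed

text \<open>Both sides are multiplicative in \<open>gs\<close>, so it suffices to treat tuples with one entry
  different from the unit, which are the elements \<open>block_elem\<close>.\<close>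

lemma clone_hor_list:
  assumes ms: "valid_tuple ms" and f: "f \<in> G (length ms)" and gs: "fits ms gs"
  defines "s \<equiv> signed_proj S (length ms) f"
  shows "clone ms f \<otimes>\<^bsub>grp S (sum_list ms)\<^esub> hor_list P ms gs
    = hor_list P (permute_tuple s ms) (permute_tuple s gs) \<otimes>\<^bsub>grp S (sum_list ms)\<^esub> clone ms f"
proof -
  let ?n = "length ms" and ?N = "sum_list ms" and ?ms' = "permute_tuple s ms"
  let ?u = "\<lambda>i. unsigned ?n s (Suc i) - 1"
  let ?star = "\<lambda>gs. clone ms f \<otimes>\<^bsub>grp S ?N\<^esub> hor_list P ms gs = hor_list P ?ms' (permute_tuple s gs)
    \<otimes>\<^bsub>grp S ?N\<^esub> clone ms f"
  have n: "1 \<le> ?n"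
    by (rule valid_tuple_length[OF ms])
  have s: "s \<in> signed_perms ?n"
    unfolding s_def by (rule signed_proj_in_signed_perms[OF n f])
  have N: "1 \<le> ?N"
    using valid_tuple_ge_length[OF ms] n by simp
  interpret G: group "grp S ?N"
    using N by (rule grp_group)
  have ms': "valid_tuple ?ms'" "sum_list ?ms' = ?N"
    using valid_permute_tuple[OF ms s] sum_list_permute_tuple[OF s] by auto
  have c: "clone ms f \<in> G ?N"
    by (rule clone_in[OF ms f])
  have single: "?star ((ones ms)[i := h])" if i: "i < ?n" and h: "h \<in> G (ms ! i)" for i h
  proof -
    have u: "?u i < ?n"
      using unsigned_in[OF s i] by auto
    have p: "permute_tuple s ((ones ms)[i := h]) = (ones ?ms')[?u i := h]"
      using permute_tuple_list_update[of s "ones ms" i h] permute_tuple_ones[OF s] s i by simp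
    have h': "h \<in> G (?ms' ! ?u i)"
      using nth_permute_tuple[OF s i] h by simp
    show ?thesis
      unfolding p hor_list_single[OF ms i h]
      using hor_list_single[OF ms'(1), of "?u i" h] u h' clone_block_elem[OF ms f i h]
        by (simp add: s_def)
  qed
  have mult: "?star ks" if g: "fits ms gs" "?star gs" and h: "fits ms hs" "?star hs"
    and k: "length ks = ?n"
      "\<And>i. i < ?n \<Longrightarrow> ks ! i = gs ! i \<otimes>\<^bsub>grp S (ms ! i)\<^esub> hs ! i" for gs hs ks
  proof -
    have l: "length gs = ?n" "length hs = ?n"
      using g h by (auto simp: fits_def)
    have "permute_tuple s ks ! j = permute_tuple s gs ! j \<otimes>\<^bsub>grp S (?ms' ! j)\<^esub> permute_tuple s hs ! j"
      if j: "j < ?n" for j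
    proof -
      obtain i where "i < ?n" "?u i = j"
        using unsigned_index_surj[OF s j] by auto
      then show ?thesis
        using nth_permute_tuple[of s ms i] nth_permute_tuple[of s gs i] nth_permute_tuple[of s hs i]
          nth_permute_tuple[of s ks i] s l k by auto
    qed
    then have p: "hor_list P ?ms' (permute_tuple s ks)
        = hor_list P ?ms' (permute_tuple s gs) \<otimes>\<^bsub>grp S ?N\<^esub> hor_list P ?ms' (permute_tuple s hs)"
      using hor_list_mult[OF ms'(1) fits_permute_tuple[OF g(1) s] fits_permute_tuple[OF h(1) s]]
        ms' k by simp
    have H: "hor_list P ms gs \<in> G ?N" "hor_list P ms hs \<in> G ?N"
      using hor_list_in[OF ms] g h by auto
    have H': "hor_list P ?ms' (permute_tuple s gs) \<in> G ?N"
      "hor_list P ?ms' (permute_tuple s hs) \<in> G ?N"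
      using hor_list_in[OF ms'(1)] fits_permute_tuple[OF _ s] g h ms'(2) by auto
    have "clone ms f \<otimes>\<^bsub>grp S ?N\<^esub> hor_list P ms ks
        = clone ms f \<otimes>\<^bsub>grp S ?N\<^esub> hor_list P ms gs \<otimes>\<^bsub>grp S ?N\<^esub> hor_list P ms hs"
      using hor_list_mult[OF ms g(1) h(1) k] H c by (simp add: G.m_assoc)
    also have "\<dots> = hor_list P ?ms' (permute_tuple s gs)
      \<otimes>\<^bsub>grp S ?N\<^esub> (clone ms f \<otimes>\<^bsub>grp S ?N\<^esub> hor_list P ms hs)"
      unfolding g(2) using H H' c by (simp add: G.m_assoc)
    also have "\<dots> = hor_list P ?ms' (permute_tuple s ks) \<otimes>\<^bsub>grp S ?N\<^esub> clone ms f"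
      unfolding h(2) p using H H' c by (simp add: G.m_assoc)
    finally show ?thesis .
  qed
  \<comment> \<open>Interpolates between the tuple of units and \<open>gs\<close>; each step
    multiplies by a tuple with a single nontrivial entry.\<close>
  define part where "part k = take k gs @ drop k (ones ms)" for k
  have lg: "length gs = ?n"
    using gs by (simp add: fits_def)
  have nth_part: "part k ! i = (if i < k then gs ! i else \<one>\<^bsub>grp S (ms ! i)\<^esub>)" if "k \<le> ?n" "i < ?n"
    for k i
    using that lg by (auto simp: part_def nth_append)
  have length_part: "length (part k) = ?n" if "k \<le> ?n" for k
    using that lg by (simp add: part_def)
  have fits_part: "fits ms (part k)" if "k \<le> ?n" for k
    using gs fits_ones[OF ms] nth_part[OF that] length_part[OF that] by (auto simp: fits_def)
  have "?star (part k)" if "k \<le> ?n" for k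
    using that
  proof (induction k)
    case 0
    \<comment> \<open>The tuple of units is itself of the one-entry form, with h the unit.\<close>
    have "part 0 = (ones ms)[0 := \<one>\<^bsub>grp S (ms ! 0)\<^esub>]"
      using n list_update_id[of "ones ms" 0] nth_ones[of 0 ms]
        by (simp add: part_def Suc_le_eq del: nth_ones)
    moreover have "1 \<le> ms ! 0"
      using ms n by (simp add: valid_tuple_nth)
    ultimately show ?case
      using single[of 0 "\<one>\<^bsub>grp S (ms ! 0)\<^esub>"] n grp_simps(1)[of "ms ! 0"] by (simp add: Suc_le_eq)
  next
    case (Suc k)
    have k: "k < ?n" "k \<le> ?n" "gs ! k \<in> G (ms ! k)"
      using Suc.prems gs by (auto simp: fits_def)
    have f1: "fits ms ((ones ms)[k := gs ! k])"
      using fits_ones[OF ms] k by (auto simp: fits_def nth_list_update)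
    show ?case
    proof (rule mult[OF fits_part[OF k(2)] Suc.IH[OF k(2)] f1 single[OF k(1,3)]
      length_part[OF Suc.prems]])
      fix i assume i: "i < ?n"
      have "1 \<le> ms ! i" "gs ! i \<in> G (ms ! i)"
        using ms gs i by (auto simp: valid_tuple_nth fits_def)
      then show "part (Suc k) ! i = part k ! i \<otimes>\<^bsub>grp S (ms ! i)\<^esub> (ones ms)[k := gs ! k] ! i"
        using nth_part[OF Suc.prems i] nth_part[OF k(2) i] i grp_simps[of "ms ! i"]
        by (cases "i = k") (auto simp: nth_list_update)
    qed
  qed
  from this[of ?n] show ?thesis
    using lg by (simp add: part_def)
qed

section \<open>The axioms of the constructed cloning PRO\<close>

lemma pro_pro_of_system: "pro P"
proof
  fix n :: nat assume "1 \<le> n"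
  then show "idn P n \<in> Ops P n n"
    by (simp add: idn_pro_of_system Ops_pro_of_system grp_simps(1))
next
  fix s n t f g assume "f \<in> Ops P n t" "g \<in> Ops P s n"
  then show "vert P s n t f g \<in> Ops P s t"
    using vert_pro_of_system[of f S n t g s]
    by (auto simp: Ops_pro_of_system intro!: grp_simps(4) split: if_splits)
next
  fix r s n t f g h assume a: "f \<in> Ops P n t" "g \<in> Ops P s n" "h \<in> Ops P r s"
  then have "n = t" "s = t" "r = t" "1 \<le> t" "f \<in> G t" "g \<in> G t" "h \<in> G t"
    by (auto simp: Ops_pro_of_system split: if_splits)
  then show "vert P r s t (vert P s n t f g) h = vert P r n t f (vert P r s n g h)"
    by (simp add: vert_pro_of_system Ops_pro_of_system grp_simps)
next
  fix n m f assume "f \<in> Ops P n m"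
  then have "n = m" "1 \<le> m" "f \<in> G m"
    by (auto simp: Ops_pro_of_system split: if_splits)
  then show "vert P n m m (idn P m) f = f" "vert P n n m f (idn P n) = f"
    by (simp_all add: vert_pro_of_system Ops_pro_of_system grp_simps idn_pro_of_system)
next
  fix n1 m1 n2 m2 f g assume "f \<in> Ops P n1 m1" "g \<in> Ops P n2 m2"
  then show "hor P n1 m1 n2 m2 f g \<in> Ops P (n1 + n2) (m1 + m2)"
    using hor_pro_of_system[of f n1 m1 g n2 m2]
      by (auto simp: Ops_pro_of_system hprod_in split: if_splits)
next
  fix n1 m1 n2 m2 n3 m3 f g h
  assume "f \<in> Ops P n1 m1" "g \<in> Ops P n2 m2" "h \<in> Ops P n3 m3"
  then have "m1 = n1" "m2 = n2" "m3 = n3" "1 \<le> n1" "1 \<le> n2" "1 \<le> n3"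
    "f \<in> G n1" "g \<in> G n2" "h \<in> G n3"
    by (auto simp: Ops_pro_of_system split: if_splits)
  then show "hor P (n1 + n2) (m1 + m2) n3 m3 (hor P n1 m1 n2 m2 f g) h
      = hor P n1 m1 (n2 + n3) (m2 + m3) f (hor P n2 m2 n3 m3 g h)"
    by (simp add: hor_pro_of_system Ops_pro_of_system hprod_in hprod_assoc)
next
  fix s1 n1 t1 s2 n2 t2 f g p q
  assume "f \<in> Ops P n1 t1" "g \<in> Ops P n2 t2" "p \<in> Ops P s1 n1" "q \<in> Ops P s2 n2"
  then have "t1 = n1" "s1 = n1" "t2 = n2" "s2 = n2" "1 \<le> n1" "1 \<le> n2"
    "f \<in> G n1" "g \<in> G n2" "p \<in> G n1" "q \<in> G n2"
    by (auto simp: Ops_pro_of_system split: if_splits)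
  then show "vert P (s1 + s2) (n1 + n2) (t1 + t2) (hor P n1 t1 n2 t2 f g) (hor P s1 n1 s2 n2 p q)
      = hor P s1 t1 s2 t2 (vert P s1 n1 t1 f p) (vert P s2 n2 t2 g q)"
    by (simp add: hor_pro_of_system vert_pro_of_system Ops_pro_of_system hprod_in hprod_mult grp_simps)
next
  fix n m :: nat assume "1 \<le> n" "1 \<le> m"
  then show "hor P n n m m (idn P n) (idn P m) = idn P (n + m)"
    by (simp add: hor_pro_of_system Ops_pro_of_system idn_pro_of_system grp_simps hprod_one)
qed

lemma Proj_pro_of_system_morphism: "pro_morphism P signed_pro (Proj P)"
  unfolding pro_morphism_def
proof (intro conjI allI impI ballI)
  fix n m :: nat
  show "Proj P n m \<in> Ops P n m \<rightarrow> Ops signed_pro n m"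
    by (auto simp: Proj_pro_of_system Ops_pro_of_system signed_pro_def signed_proj_in_signed_perms
      split: if_splits)
next
  fix n :: nat assume "1 \<le> n"
  then show "Proj P n n (idn P n) = idn signed_pro n"
    using signed_proj_one[of n]
    by (simp add: Proj_pro_of_system Ops_pro_of_system idn_pro_of_system grp_simps signed_pro_def)
next
  fix s n t f g assume "f \<in> Ops P n t" "g \<in> Ops P s n"
  then have "n = t" "s = t" "1 \<le> t" "f \<in> G t" "g \<in> G t"
    by (auto simp: Ops_pro_of_system split: if_splits)
  then show "Proj P s t (vert P s n t f g) = vert signed_pro s n t (Proj P n t f) (Proj P s n g)"
    by (simp add: vert_pro_of_system Proj_pro_of_system Ops_pro_of_system signed_proj_mult
      grp_simps signed_pro_def)
next
  fix n1 m1 n2 m2 f g assume "f \<in> Ops P n1 m1" "g \<in> Ops P n2 m2"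
  then have "m1 = n1" "m2 = n2" "1 \<le> n1" "1 \<le> n2" "f \<in> G n1" "g \<in> G n2"
    by (auto simp: Ops_pro_of_system split: if_splits)
  then show "Proj P (n1 + n2) (m1 + m2) (hor P n1 m1 n2 m2 f g)
      = hor signed_pro n1 m1 n2 m2 (Proj P n1 m1 f) (Proj P n2 m2 g)"
    by (simp add: hor_pro_of_system Proj_pro_of_system Ops_pro_of_system signed_proj_hprod
      hprod_in signed_pro_def)
qed

lemma valid_tuple_sum_ge: "valid_tuple ms \<Longrightarrow> 1 \<le> sum_list ms"
  using valid_tuple_ge_length[of ms] valid_tuple_length[of ms] by linarith

lemma Ops_length:
  "valid_tuple ms \<Longrightarrow> f \<in> Ops P (length ms) (length ms) \<longleftrightarrow> f \<in> G (length ms)"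
  using valid_tuple_length[of ms] by (simp add: Ops_pro_of_system)

lemma Ops_sum_list:
  "valid_tuple ms \<Longrightarrow> f \<in> Ops P (sum_list ms) (sum_list ms) \<longleftrightarrow> f \<in> G (sum_list ms)"
  using valid_tuple_sum_ge[of ms] by (simp add: Ops_pro_of_system)

text \<open>The identities are those proved for \<open>clone\<close>, \<open>hprod\<close> and
  \<open>signed_proj\<close>; what remains is to see that all arguments lie in the domains on which
  the restricted operations agree with them.\<close>

lemma cloning_pro_pro_of_system: "cloning_pro P"
proof (intro cloning_pro.intro cloning_pro_axioms.intro pro_pro_of_system Proj_pro_of_system_morphism)
  fix n m :: nat
  show "n \<noteq> m \<Longrightarrow> Ops P n m = {}"
    by (simp add: Ops_pro_of_system)
  show "1 \<le> n \<Longrightarrow> group (diag_grp P n)"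
    by (simp add: diag_grp_pro_of_system[OF extensional] grp_group)
  show "Kappa P (replicate n 1) f = f" if "1 \<le> n" "f \<in> Ops P n n" for f
    using Kappa_pro_of_system[of "replicate n 1" f] that clone_ones[of n f]
      by (simp add: valid_tuple_def)
next
  fix ms :: "nat list" assume ms: "valid_tuple ms"
  show "Kappa P ms \<in> Ops P (length ms) (length ms) \<rightarrow> Ops P (sum_list ms) (sum_list ms)"
    using Kappa_pro_of_system[OF ms] clone_in[OF ms]
      by (auto simp: Ops_length[OF ms] Ops_sum_list[OF ms])
  show "Kappa P ms (idn P (length ms)) = idn P (sum_list ms)"
    using Kappa_pro_of_system[OF ms] clone_one[OF ms] grp_simps(1)[OF valid_tuple_length[OF ms]]
    by (simp add: idn_pro_of_system Ops_length[OF ms])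
  fix f assume f: "f \<in> Ops P (length ms) (length ms)"
  then show "Proj P (sum_list ms) (sum_list ms) (Kappa P ms f)
    = signed_clone ms (Proj P (length ms) (length ms) f)"
    using signed_proj_clone[OF ms, of f] clone_in[OF ms, of f]
    by (simp add: Kappa_pro_of_system[OF ms] Proj_pro_of_system Ops_length[OF ms] Ops_sum_list[OF ms])
  fix ns g assume ns: "valid_tuple ns" and g: "g \<in> Ops P (length ns) (length ns)"
  have v: "valid_tuple (ms @ ns)"
    using ms ns by (auto simp: valid_tuple_def)
  have c: "f \<in> G (length ms)" "g \<in> G (length ns)"
    using f g Ops_length ms ns by auto
  have "hor P (length ms) (length ms) (length ns) (length ns) f g = hprod (length ms) (length ns) f g"
    by (rule hor_pro_of_system[OF f g])
  moreover have "hprod (length ms) (length ns) f g \<in> Ops P (length (ms @ ns)) (length (ms @ ns))"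
    using hprod_in[OF valid_tuple_length[OF ms] valid_tuple_length[OF ns] c] Ops_length[OF v] by simp
  moreover have "Kappa P ms f \<in> Ops P (sum_list ms) (sum_list ms)"
    "Kappa P ns g \<in> Ops P (sum_list ns) (sum_list ns)"
    using clone_in[OF ms c(1)] clone_in[OF ns c(2)] Kappa_pro_of_system f g ms ns Ops_sum_list
      by simp_all
  ultimately show "hor P (sum_list ms) (sum_list ms) (sum_list ns) (sum_list ns) (Kappa P ms f)
    (Kappa P ns g)
      = Kappa P (ms @ ns) (hor P (length ms) (length ms) (length ns) (length ns) f g)"
    using clone_hprod[OF ms ns c] Kappa_pro_of_system[OF v] Kappa_pro_of_system[OF ms f]
      Kappa_pro_of_system[OF ns g] hor_pro_of_system by simp
next
  fix rs :: "nat list list" and f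
  assume rs: "rs \<noteq> []" "\<forall>r \<in> set rs. valid_tuple r" and f: "f \<in> Ops P (length rs) (length rs)"
  have c: "f \<in> G (length rs)"
    using f by (simp add: Ops_pro_of_system split: if_splits)
  have v: "valid_tuple (map length rs)" "valid_tuple (map sum_list rs)" "valid_tuple (concat rs)"
    using rs valid_tuple_length valid_tuple_sum_ge by (auto simp: valid_tuple_def)
  have "clone (map length rs) f \<in> Ops P (length (concat rs)) (length (concat rs))"
    using clone_in[OF v(1), of f] c Ops_length[OF v(3)] by (simp add: length_concat)
  then show "Kappa P (concat rs) (Kappa P (map length rs) f) = Kappa P (map sum_list rs) f"
    using clone_clone[OF rs c] Kappa_pro_of_system[OF v(1), of f] Kappa_pro_of_system[OF v(2), of f]
      Kappa_pro_of_system[OF v(3)] f by simp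
next
  fix ms :: "nat list" and n k :: nat and h g
  assume ms: "valid_tuple ms" and nk: "n = length ms" "k = sum_list ms"
    and hg: "h \<in> Ops P n n" "g \<in> Ops P n n"
  let ?ms' = "permute_tuple (Proj P n n g) ms"
  have c: "h \<in> G (length ms)" "g \<in> G (length ms)"
    using hg Ops_length[OF ms] nk by auto
  have s: "signed_proj S (length ms) g \<in> signed_perms (length ms)"
    by (rule signed_proj_in_signed_perms[OF valid_tuple_length[OF ms] c(2)])
  have ms': "?ms' = permute_tuple (signed_proj S (length ms) g) ms"
    using Proj_pro_of_system[OF hg(2)] nk by simp
  have v: "valid_tuple ?ms'" "length ?ms' = length ms" "sum_list ?ms' = sum_list ms"
    using valid_permute_tuple[OF ms s] sum_list_permute_tuple[OF s] ms' by auto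
  have "Kappa P ?ms' h = clone ?ms' h" "Kappa P ms g = clone ms g"
    "vert P n n n h g = h \<otimes>\<^bsub>grp S (length ms)\<^esub> g"
    using Kappa_pro_of_system[OF v(1)] Kappa_pro_of_system[OF ms] v hg nk
      vert_pro_of_system[OF hg] by simp_all
  moreover have "h \<otimes>\<^bsub>grp S (length ms)\<^esub> g \<in> Ops P (length ms) (length ms)"
    using grp_simps(4)[OF valid_tuple_length[OF ms] c] Ops_length[OF ms] by simp
  moreover have "clone ?ms' h \<in> Ops P k k" "clone ms g \<in> Ops P k k"
    using clone_in[OF v(1)] clone_in[OF ms] c v Ops_sum_list[OF ms] nk by simp_all
  ultimately show "Kappa P ms (vert P n n n h g) = vert P k k k (Kappa P ?ms' h) (Kappa P ms g)"
    using clone_mult[OF ms c] Kappa_pro_of_system[OF ms] vert_pro_of_system[of _ S k k _ k] nk ms'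
      by simp
next
  fix ms :: "nat list" and n k :: nat and f gs
  assume ms: "valid_tuple ms" and nk: "n = length ms" "k = sum_list ms" and f: "f \<in> Ops P n n"
    and gs: "length gs = n" "\<forall>i<n. gs ! i \<in> Ops P (ms ! i) (ms ! i)"
  let ?s = "Proj P n n f"
  have c: "f \<in> G (length ms)"
    using f Ops_length[OF ms] nk by auto
  have s: "?s = signed_proj S (length ms) f" "signed_proj S (length ms) f \<in> signed_perms (length ms)"
    using Proj_pro_of_system[OF f] signed_proj_in_signed_perms[OF valid_tuple_length[OF ms] c] nk
      by simp_all
  have g: "fits ms gs"
    using gs nk by (auto simp: fits_def Ops_pro_of_system split: if_splits)
  have v: "valid_tuple (permute_tuple ?s ms)" "sum_list (permute_tuple ?s ms) = k"
    "fits (permute_tuple ?s ms) (permute_tuple ?s gs)"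
    using valid_permute_tuple[OF ms] sum_list_permute_tuple[of ?s ms] fits_permute_tuple[OF g] s
      nk by auto
  have "clone ms f \<in> Ops P k k" "hor_list P ms gs \<in> Ops P k k"
    "hor_list P (permute_tuple ?s ms) (permute_tuple ?s gs) \<in> Ops P k k"
    using clone_in[OF ms c] hor_list_in[OF ms g] hor_list_in[OF v(1,3)] v(2) Ops_sum_list[OF ms]
      nk by simp_all
  then show "vert P k k k (Kappa P ms f) (hor_list P ms gs)
      = vert P k k k (hor_list P (permute_tuple ?s ms) (permute_tuple ?s gs)) (Kappa P ms f)"
    using clone_hor_list[OF ms c g] Kappa_pro_of_system[OF ms] f
      vert_pro_of_system[of _ S k k _ k] nk s by simp
qed

end

subsection \<open>The operadic cloning system of a cloning PRO\<close>

lemma unsigned_comp: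
  assumes "h \<in> signed_perms n" "k \<in> signed_perms n"
  shows "unsigned n (h \<circ> k) = unsigned n h \<circ> unsigned n k"
proof
  fix i
  show "unsigned n (h \<circ> k) i = (unsigned n h \<circ> unsigned n k) i"
  proof (cases "i \<in> {1..n}")
    case True
    have "h (- k (int i)) = - h (k (int i))"
      using signed_perms_odd_map[OF assms(1)] by (simp add: odd_map_def)
    then show ?thesis
      using True signed_perms_in_range[OF assms(2), of i] by (auto simp: unsigned_def abs_if)
  qed (auto simp: unsigned_def)
qed

lemma unsigned_signed_block_left: "unsigned (n + 1) (signed_block n 1 h id) = sym_left n (unsigned n h)"
  by (auto simp: fun_eq_iff unsigned_def signed_block_def sym_left_def odd_extension_def)

lemma unsigned_signed_block_right:
  assumes "h \<in> signed_perms n"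
  shows "unsigned (n + 1) (signed_block 1 n id h) = sym_right n (unsigned n h)"
proof
  fix i
  consider "i = 0" | "i = 1" | "2 \<le> i" "i \<le> n + 1" | "n + 1 < i"
    by linarith
  then show "unsigned (n + 1) (signed_block 1 n id h) i = sym_right n (unsigned n h) i"
  proof cases
    case 3
    then have "h (int (i - 1)) \<noteq> 0"
      using signed_perms_in_range[OF assms, of "i - 1"] by auto
    then show ?thesis
      using 3 by (auto simp: unsigned_def signed_block_def sym_right_def odd_extension_def)
  qed (auto simp: unsigned_def signed_block_def sym_right_def odd_extension_def)
qed

text \<open>The first part yields (ii). The second explains the sign in the definition of
  \<open>signed_proj\<close>: the absolute value of a doubled signed permutation is the unsigned
  cloning exactly when the doubled strand is positive.\<close>

lemma unsigned_clone_strand: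
  assumes h: "h \<in> signed_perms n" and j: "1 \<le> j" "j \<le> n"
  shows "\<lbrakk>1 \<le> i; i \<le> n + 1; i \<noteq> j; i \<noteq> j + 1\<rbrakk>
      \<Longrightarrow> unsigned (Suc n) (clone_strand n j h) i = sym_clone n j (unsigned n h) i"
    and "unsigned (Suc n) (clone_strand n j h) = sym_clone n j (unsigned n h) \<longleftrightarrow> h (int j) > 0"
proof -
  have hj: "h (int j) \<noteq> 0"
    using signed_perms_in_range[OF h j] by simp
  show other: "unsigned (Suc n) (clone_strand n j h) i = sym_clone n j (unsigned n h) i"
    if i: "1 \<le> i" "i \<le> n + 1" "i \<noteq> j" "i \<noteq> j + 1" for i
  proof -
    define q where "q = (if i \<le> j then i else i - 1)"
    have q: "1 \<le> q" "q \<le> n" "q \<noteq> j"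
      using i j by (auto simp: q_def)
    have hq: "h (int q) \<noteq> 0"
      using signed_perms_in_range[OF h q(1,2)] by simp
    have ne: "unsigned n h q \<noteq> unsigned n h j"
      using inj_eq[OF permutes_inj[OF unsigned_permutes[OF h]]] q by blast
    have i': "1 \<le> i" "i \<le> Suc n"
      using i by auto
    have "unsigned (Suc n) (clone_strand n j h) i =
        nat \<bar>if \<bar>h (int q)\<bar> < \<bar>h (int j)\<bar> then h (int q) else h (int q) + sgn (h (int q))\<bar>"
      using i unfolding unsigned_def clone_strand_def odd_extension_nat[OF i'] q_def Let_def by simp
    also have "\<dots> = (if unsigned n h q < unsigned n h j then unsigned n h q else unsigned n h q + 1)"
      using q j hq hj by (auto simp: unsigned_def sgn_if)
    also have "\<dots> = sym_clone n j (unsigned n h) i"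
    proof (cases "i < j")
      case True
      then show ?thesis
        using i ne by (auto simp: sym_clone_def q_def)
    next
      case False
      then have "q = i - 1" "j + 1 < i"
        using i by (auto simp: q_def)
      then show ?thesis
        using i ne by (auto simp: sym_clone_def)
    qed
    finally show ?thesis .
  qed
  have at_j: "unsigned (Suc n) (clone_strand n j h) j
    = unsigned n h j + (if h (int j) > 0 then 0 else 1)"
    "unsigned (Suc n) (clone_strand n j h) (Suc j) = unsigned n h j + (if h (int j) > 0 then 1 else 0)"
    using j hj by (auto simp: unsigned_def clone_strand_def odd_extension_nat simp del: of_nat_Suc)
  have sym: "sym_clone n j (unsigned n h) j = unsigned n h j"
    "sym_clone n j (unsigned n h) (Suc j) = unsigned n h j + 1"
    using j by (auto simp: sym_clone_def)
  show "unsigned (Suc n) (clone_strand n j h) = sym_clone n j (unsigned n h) \<longleftrightarrow> h (int j) > 0"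
  proof
    assume pos: "h (int j) > 0"
    show "unsigned (Suc n) (clone_strand n j h) = sym_clone n j (unsigned n h)"
    proof
      fix i
      consider "i \<notin> {1..n + 1}" | "i = j" | "i = Suc j" | "1 \<le> i" "i \<le> n + 1" "i \<noteq> j" "i \<noteq> Suc j"
        by fastforce
      then show "unsigned (Suc n) (clone_strand n j h) i = sym_clone n j (unsigned n h) i"
      proof cases
        case 1
        then show ?thesis
          by (auto simp: unsigned_def sym_clone_def)
      next
        case 4
        then show ?thesis
          using other by simp
      qed (use at_j sym pos in auto)
    qed
  next
    assume "unsigned (Suc n) (clone_strand n j h) = sym_clone n j (unsigned n h)"
    then show "h (int j) > 0"
      using at_j(1) sym(1) by (auto split: if_splits)
  qed
qed

section \<open>Elementary tuples in a cloning PRO\<close>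

abbreviation two_at :: "nat \<Rightarrow> nat \<Rightarrow> nat list" where
  "two_at n j \<equiv> incr (replicate n 1) (j - 1)"

lemma sum_list_two_at: "1 \<le> j \<Longrightarrow> j \<le> n \<Longrightarrow> sum_list (two_at n j) = Suc n"
  by (simp add: sum_list_replicate)

lemma valid_tuple_two_at: "1 \<le> n \<Longrightarrow> valid_tuple (two_at n j)"
  by (rule valid_tuple_incr) (simp add: valid_tuple_def)

lemma in_block_two_at:
  assumes "1 \<le> j" "j \<le> n"
  shows "in_block (two_at n j) k p \<longleftrightarrow> k < n \<and> Suc k = (if p \<le> j then p else p - 1)"
  using in_block_incr[of "replicate n 1" "j - 1" j k p] assms by (auto simp: in_block_replicate)

lemma concat_replicate_ones: "concat (map (\<lambda>m. replicate m 1) ms) = replicate (sum_list ms) 1"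
  by (induction ms) (auto simp: replicate_add)

text \<open>Cutting the elementary tuple with its 2 at \<open>p\<close> along \<open>ms\<close>
  leaves 1s in all blocks except the i-th, which is again elementary with its 2 at the place of
  \<open>p\<close> in the block.\<close>

lemma concat_two_at:
  assumes "i < length ms" "in_block ms i p"
  shows "concat ((map (\<lambda>m. replicate m 1) ms)[i := two_at (ms ! i) (p - sum_list (take i ms))])
    = two_at (sum_list ms) p"
proof -
  let ?a = "sum_list (take i ms)"
  let ?f = "\<lambda>m. replicate m (1 :: nat)"
  have p: "?a < p" "p \<le> ?a + ms ! i"
    using assms sum_list_take_Suc[of i ms] by (auto simp: in_block_def)
  have "concat ((map ?f ms)[i := two_at (ms ! i) (p - ?a)])
      = concat (map ?f (take i ms)) @ two_at (ms ! i) (p - ?a) @ concat (map ?f (drop (Suc i) ms))"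
    using assms(1) by (simp add: upd_conv_take_nth_drop take_map drop_map)
  also have "\<dots> = replicate ?a 1 @ two_at (ms ! i) (p - ?a) @ replicate (sum_list (drop (Suc i) ms)) 1"
    unfolding concat_replicate_ones ..
  also have "two_at (ms ! i) (p - ?a) @ replicate (sum_list (drop (Suc i) ms)) 1
      = incr (replicate (ms ! i) 1 @ replicate (sum_list (drop (Suc i) ms)) 1) (p - ?a - 1)"
    by (rule incr_append1[symmetric]) (use p in simp)
  also have "replicate ?a 1 @ \<dots> = incr (replicate ?a 1 @ replicate (ms ! i) 1 @ replicate
    (sum_list (drop (Suc i) ms)) 1) (?a + (p - ?a - 1))"
    using incr_append2[of "replicate ?a 1"] by simp
  also have "\<dots> = two_at (sum_list ms) p"
  proof -
    have "?a + (p - ?a - 1) = p - 1"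
      using p by simp
    moreover have "sum_list ms = ?a + (ms ! i + sum_list (drop (Suc i) ms))"
      using sum_list_take_Suc[OF assms(1)] sum_list.append[of "take (Suc i) ms" "drop (Suc i) ms"]
        by simp
    ultimately show ?thesis
      by (simp only: replicate_add)
  qed
  finally show ?thesis .
qed

locale normalized_pro = cloning_pro P
  for P :: "'a cloning_pro_data" +
  assumes extensional: "extensional_pro P"
begin

abbreviation "S \<equiv> system_of_pro P"

lemma grp_system_of_pro: "grp S n = diag_grp P n"
  by (simp add: system_of_pro_def)

lemma carrier_system_of_pro [simp]: "carrier (grp S n) = Ops P n n"
  by (simp add: grp_system_of_pro diag_grp_def)

lemma mult_system_of_pro [simp]: "mult (grp S n) = vert P n n n"
  by (simp add: grp_system_of_pro diag_grp_def)

lemma one_system_of_pro [simp]: "one (grp S n) = idn P n"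
  by (simp add: grp_system_of_pro diag_grp_def)

lemma iota_system_of_pro: "f \<in> Ops P n n \<Longrightarrow> iota S n f = hor P n n 1 1 f (idn P 1)"
  by (simp add: system_of_pro_def)

lemma zeta_system_of_pro: "f \<in> Ops P n n \<Longrightarrow> zeta S n f = hor P 1 1 n n (idn P 1) f"
  by (simp add: system_of_pro_def)

lemma kappa_system_of_pro:
  assumes "1 \<le> j" "j \<le> n" "f \<in> Ops P n n"
  shows "kappa S n j f = Kappa P (two_at n j) f"
  using assms incr_ones[OF assms(1,2)] by (simp add: system_of_pro_def)

lemma proj_system_of_pro: "f \<in> Ops P n n \<Longrightarrow> proj S n f = unsigned n (Proj P n n f)"
  by (auto simp: system_of_pro_def unsigned_def)

lemmas Proj_conjuncts = Proj_morphism[unfolded pro_morphism_def]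
lemmas Proj_Pi = conjunct1[OF Proj_conjuncts, rule_format]
lemmas Proj_idn' = conjunct1[OF conjunct2[OF Proj_conjuncts], rule_format]
lemmas Proj_vert' = conjunct1[OF conjunct2[OF conjunct2[OF Proj_conjuncts]], rule_format]
lemmas Proj_hor' = conjunct2[OF conjunct2[OF conjunct2[OF Proj_conjuncts]], rule_format]

lemma Proj_in: "1 \<le> n \<Longrightarrow> f \<in> Ops P n n \<Longrightarrow> Proj P n n f \<in> signed_perms n"
  using Proj_Pi[of n n] by (auto simp: signed_pro_def)

lemma Proj_idn: "1 \<le> n \<Longrightarrow> Proj P n n (idn P n) = id"
  using Proj_idn'[of n] by (simp add: signed_pro_def)

lemma Proj_vert: "1 \<le> n \<Longrightarrow> f \<in> Ops P n n \<Longrightarrow> g \<in> Ops P n n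
    \<Longrightarrow> Proj P n n (vert P n n n f g) = Proj P n n f \<circ> Proj P n n g"
  using Proj_vert'[of n n n f g] by (simp add: signed_pro_def)

lemma Proj_hor: "1 \<le> n \<Longrightarrow> 1 \<le> m \<Longrightarrow> f \<in> Ops P n n \<Longrightarrow> g \<in> Ops P m m
    \<Longrightarrow> Proj P (n + m) (n + m) (hor P n n m m f g) = signed_block n m (Proj P n n f) (Proj P m m g)"
  using Proj_hor'[of n n m m f g] by (simp add: signed_pro_def)

lemma Kappa_in: "valid_tuple ms \<Longrightarrow> f \<in> Ops P (length ms) (length ms)
  \<Longrightarrow> Kappa P ms f \<in> Ops P (sum_list ms) (sum_list ms)"
  using Kappa_closed by blast

lemma Kappa_two_at_in:
  assumes "1 \<le> j" "j \<le> n" "f \<in> Ops P n n"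
  shows "Kappa P (two_at n j) f \<in> Ops P (Suc n) (Suc n)"
  using Kappa_in[OF valid_tuple_two_at[of n j]] assms sum_list_two_at[OF assms(1,2)] by simp

text \<open>The increment rule in a cloning PRO: composition of cloning maps for the tuples
  (1,...,1), except in block i, where the tuple has one 2 and therefore sum m_i + 1.\<close>

lemma Kappa_Kappa_two_at:
  assumes ms: "valid_tuple ms" and f: "f \<in> Ops P (length ms) (length ms)" and b: "in_block ms i p"
  shows "Kappa P (two_at (sum_list ms) p) (Kappa P ms f) = Kappa P (incr ms i) f"
proof -
  have i: "i < length ms"
    using b by (simp add: in_block_def)
  define t where "t = p - sum_list (take i ms)"
  have t: "1 \<le> t" "t \<le> ms ! i"
    using b sum_list_take_Suc[OF i] by (auto simp: in_block_def t_def)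
  define rs where "rs = (map (\<lambda>m. replicate m (1 :: nat)) ms)[i := two_at (ms ! i) t]"
  have len: "map length rs = ms"
    by (rule nth_equalityI) (use i in \<open>auto simp: rs_def nth_list_update\<close>)
  have sum: "map sum_list rs = incr ms i"
    by (rule nth_equalityI)
      (use i t in \<open>auto simp: rs_def nth_list_update nth_incr sum_list_replicate\<close>)
  have "concat rs = two_at (sum_list ms) p"
    unfolding rs_def t_def by (rule concat_two_at[OF i b])
  moreover have "valid_tuple r" if "r \<in> set rs" for r
  proof -
    obtain k where "k < length rs" "r = rs ! k"
      using \<open>r \<in> set rs\<close> unfolding in_set_conv_nth by blast
    moreover have "length rs = length ms"
      by (simp add: rs_def)
    ultimately show ?thesis
      using ms t valid_tuple_two_at[of "ms ! i" t]
      by (cases "k = i") (auto simp: rs_def valid_tuple_nth nth_list_update)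
  qed
  moreover have "rs \<noteq> []" "length rs = length ms"
    using ms len by (auto simp: valid_tuple_def)
  ultimately show ?thesis
    using Kappa_Kappa[of rs f] f len sum by simp
qed

lemma Kappa_one: "1 \<le> n \<Longrightarrow> Kappa P [n] (idn P 1) = idn P n"
  using Kappa_idn[of "[n]"] by (simp add: valid_tuple_def)

text \<open>Turns a double elementary cloning into one tuple, so that (iv) and (iv+) become
  equalities of tuples.\<close>

lemma Kappa_two_at_comp:
  assumes "1 \<le> j" "j \<le> n" "1 \<le> p" "p \<le> Suc n" "f \<in> Ops P n n"
  shows "Kappa P (two_at (Suc n) p) (Kappa P (two_at n j) f)
    = Kappa P (incr (two_at n j) ((if p \<le> j then p else p - 1) - 1)) f"
proof -
  have "in_block (two_at n j) ((if p \<le> j then p else p - 1) - 1) p"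
    unfolding in_block_two_at[OF assms(1,2)] using assms by auto
  moreover have "valid_tuple (two_at n j)"
    using assms by (intro valid_tuple_two_at) simp
  ultimately show ?thesis
    using Kappa_Kappa_two_at[of "two_at n j" f _ p] assms sum_list_two_at[of j n] by simp
qed

lemma two_at_last: "1 \<le> n \<Longrightarrow> two_at (Suc n) (Suc n) = replicate n 1 @ [2]"
  using incr_ones[of "Suc n" "Suc n"] by simp

lemma two_at_first: "two_at (Suc n) 1 = [2] @ replicate n 1"
  by (simp add: incr_def)

lemma two_at_snoc: "1 \<le> j \<Longrightarrow> j \<le> n \<Longrightarrow> two_at (Suc n) j = two_at n j @ [1]"
  using incr_append1[of "j - 1" "replicate n 1" "[1]"] by (simp flip: replicate_append_same)

lemma two_at_Cons: "1 \<le> j \<Longrightarrow> two_at (Suc n) (Suc j) = [1] @ two_at n j"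
  using incr_append2[of "[1]" "replicate n 1" "j - 1"] by simp

lemma hor_idn_in:
  assumes "1 \<le> n" "f \<in> Ops P n n" "1 \<le> r"
  shows "hor P n n r r f (idn P r) \<in> Ops P (n + r) (n + r)"
    "hor P r r n n (idn P r) f \<in> Ops P (r + n) (r + n)"
  using hor_closed[of n n r r f "idn P r"] hor_closed[of r r n n "idn P r" f] idn_closed[of r]
    assms by auto

lemma hor_hom_left:
  assumes "1 \<le> n" "1 \<le> r" "f \<in> Ops P n n" "g \<in> Ops P n n"
  shows "hor P n n r r (vert P n n n f g) (idn P r)
    = vert P (n + r) (n + r) (n + r) (hor P n n r r f (idn P r)) (hor P n n r r g (idn P r))"
  using interchange[of n n n r r r f "idn P r" g "idn P r"] assms idn_closed[of r]
    vert_idn_left[of r r "idn P r"]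
  by simp

lemma hor_hom_right:
  assumes "1 \<le> n" "1 \<le> r" "f \<in> Ops P n n" "g \<in> Ops P n n"
  shows "hor P r r n n (idn P r) (vert P n n n f g)
    = vert P (r + n) (r + n) (r + n) (hor P r r n n (idn P r) f) (hor P r r n n (idn P r) g)"
  using interchange[of r r r n n n "idn P r" f "idn P r" g] assms idn_closed[of r]
    vert_idn_left[of r r "idn P r"]
  by simp

lemma Proj_kappa:
  assumes j: "1 \<le> j" "j \<le> n" and f: "f \<in> Ops P n n"
  shows "Proj P (Suc n) (Suc n) (kappa S n j f) = clone_strand n j (Proj P n n f)"
proof -
  have n: "1 \<le> n"
    using j by simp
  show ?thesis
    using Proj_Kappa[OF valid_tuple_two_at[OF n], of f j] f sum_list_two_at[OF j]
      clone_strand_eq_signed_clone[OF Proj_in[OF n f] j] kappa_system_of_pro[OF j f] by simp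
qed

section \<open>The axioms of the constructed operadic cloning system\<close>

lemma bilateral_system_of_pro: "bilateral_cloning_system S"
proof (intro bilateral_cloning_system.intro cloning_system.intro bilateral_cloning_system_axioms.intro)
  fix n :: nat assume n: "1 \<le> n"
  note id1 = idn_closed[of 1, simplified]
  show "group (grp S n)"
    unfolding grp_system_of_pro by (rule diag_group[OF n])
  show "iota S n \<in> hom (grp S n) (grp S (n + 1))"
    using hor_hom_left[OF n, of 1] hor_idn_in(1)[OF n, where r = 1] vert_closed[OF n n n]
    by (auto simp: hom_def iota_system_of_pro)
  show "zeta S n \<in> hom (grp S n) (grp S (n + 1))"
    using hor_hom_right[OF n, of 1] hor_idn_in(2)[OF n, where r = 1] vert_closed[OF n n n]
    by (auto simp: hom_def zeta_system_of_pro)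
  show "proj S n \<in> hom (grp S n) (sym_group n)"
    using Proj_vert[OF n] unsigned_comp[OF Proj_in[OF n] Proj_in[OF n]]
      unsigned_permutes[OF Proj_in[OF n]]
      vert_closed[OF n n n]
    by (auto simp: hom_def proj_system_of_pro sym_group_def)
  fix g assume g': "g \<in> carrier (grp S n)"
  then have g: "g \<in> Ops P n n"
    by simp
  note ig = hor_idn_in(1)[OF n g, of 1, simplified] and zg = hor_idn_in(2)[OF n g, of 1, simplified]
  show "proj S (n + 1) (iota S n g) = sym_left n (proj S n g)"
    using unsigned_signed_block_left[of n "Proj P n n g"] ig g Proj_hor[OF n _ g, of 1 "idn P 1"]
      id1 Proj_idn[of 1]
    by (simp add: iota_system_of_pro proj_system_of_pro)
  show "proj S (n + 1) (zeta S n g) = sym_right n (proj S n g)"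
    using unsigned_signed_block_right[OF Proj_in[OF n g]] zg g
      Proj_hor[OF _ n _ g, of 1 "idn P 1"] id1 Proj_idn[of 1]
    by (simp add: zeta_system_of_pro proj_system_of_pro)
  show "iota S (n + 1) (iota S n g) = kappa S (n + 1) (n + 1) (iota S n g)"
  proof -
    \<comment> \<open>Both sides of (vii) equal the product of g with the identity on two strands:
      one by associativity, the other by doubling the added strand via (3) and (2).\<close>
    have "iota S (n + 1) (iota S n g) = hor P n n 2 2 g (idn P 2)"
      using iota_system_of_pro[OF g] iota_system_of_pro[OF ig] id1 g n hor_idn[of 1 1]
        hor_assoc[of n n 1 1 1 1 g "idn P 1" "idn P 1"] by (simp add: numeral_2_eq_2)
    moreover have "kappa S (n + 1) (n + 1) (iota S n g)
      = Kappa P (replicate n 1 @ [2]) (hor P n n 1 1 g (idn P 1))"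
      using kappa_system_of_pro[of "Suc n" "Suc n", OF _ _ ig] two_at_last[OF n]
        iota_system_of_pro[OF g] by simp
    moreover have "Kappa P (replicate n 1 @ [2]) (hor P n n 1 1 g (idn P 1))
      = hor P n n 2 2 g (idn P 2)"
      using Kappa_hor[of "replicate n 1" "[2]" g "idn P 1"] n g id1 Kappa_ones[OF n g] Kappa_one[of 2]
      by (simp add: valid_tuple_def sum_list_replicate)
    ultimately show ?thesis
      by simp
  qed
  show "zeta S (n + 1) (zeta S n g) = kappa S (n + 1) 1 (zeta S n g)"
  proof -
    have "zeta S (n + 1) (zeta S n g) = hor P 2 2 n n (idn P 2) g"
      using zeta_system_of_pro[OF g] zeta_system_of_pro[OF zg] id1 g n hor_idn[of 1 1]
        hor_assoc[of 1 1 1 1 n n "idn P 1" "idn P 1" g] by (simp add: numeral_2_eq_2)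
    moreover have "kappa S (n + 1) 1 (zeta S n g)
      = Kappa P ([2] @ replicate n 1) (hor P 1 1 n n (idn P 1) g)"
      using kappa_system_of_pro[of 1 "Suc n", OF _ _ zg] two_at_first[of n]
        zeta_system_of_pro[OF g] by simp
    moreover have "Kappa P ([2] @ replicate n 1) (hor P 1 1 n n (idn P 1) g)
      = hor P 2 2 n n (idn P 2) g"
      using Kappa_hor[of "[2]" "replicate n 1" "idn P 1" g] n g id1 Kappa_ones[OF n g] Kappa_one[of 2]
      by (simp add: valid_tuple_def sum_list_replicate)
    ultimately show ?thesis
      by simp
  qed
  show "zeta S (n + 1) (iota S n g) = iota S (n + 1) (zeta S n g)"
    using zeta_system_of_pro[OF g] iota_system_of_pro[OF g] zeta_system_of_pro[OF ig]
      iota_system_of_pro[OF zg]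
      id1 g n hor_assoc[of 1 1 n n 1 1 "idn P 1" g "idn P 1"] by simp
next
  fix l j n :: nat and g assume l: "1 \<le> l" "l < j" and jn: "j \<le> n" and "g \<in> carrier (grp S n)"
  then have ln: "l \<le> n" and j: "1 \<le> j" "j \<le> n" and g: "g \<in> Ops P n n"
    by auto
  have "kappa S (n + 1) (j + 1) (kappa S n l g) = Kappa P (incr (two_at n l) (j - 1)) g"
    using kappa_system_of_pro[OF l(1) ln g]
      kappa_system_of_pro[of "Suc j" "Suc n", OF _ _ Kappa_two_at_in[OF l(1) ln g]]
      Kappa_two_at_comp[OF l(1) ln _ _ g, of "Suc j"] l j by simp
  moreover have "kappa S (n + 1) l (kappa S n j g) = Kappa P (incr (two_at n j) (l - 1)) g"
    using kappa_system_of_pro[OF j g] kappa_system_of_pro[of l "Suc n", OF _ _ Kappa_two_at_in[OF j g]]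
      Kappa_two_at_comp[OF j _ _ g, of l] l j by simp
  \<comment> \<open>(iv) has become the commutation of the increments e_l and e_j.\<close>
  moreover have "incr (two_at n l) (j - 1) = incr (two_at n j) (l - 1)"
    using l j by (auto simp: incr_def list_update_swap nth_list_update)
  ultimately show "kappa S (n + 1) (j + 1) (kappa S n l g) = kappa S (n + 1) l (kappa S n j g)"
    by simp
next
  fix j n :: nat and g assume j: "1 \<le> j" "j \<le> n"
  show "kappa S n j \<in> carrier (grp S n) \<rightarrow> carrier (grp S (n + 1))"
    using Kappa_two_at_in[OF j] by (auto simp: kappa_system_of_pro[OF j])
  assume "g \<in> carrier (grp S n)"
  then have g: "g \<in> Ops P n n"
    by simp
  have n: "1 \<le> n"
    using j by simp
  note id1 = idn_closed[of 1, simplified]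
  note k = kappa_system_of_pro[OF j g] and kg = Kappa_two_at_in[OF j g]
  note ig = hor_idn_in(1)[OF n g, of 1, simplified] and zg = hor_idn_in(2)[OF n g, of 1, simplified]
  show "proj S (n + 1) (kappa S n j g) i = sym_clone n j (proj S n g) i"
    if "i \<in> {1..n + 1}" "i \<noteq> j" "i \<noteq> j + 1" for i
    using unsigned_clone_strand(1)[OF Proj_in[OF n g] j, of i] that Proj_kappa[OF j g] kg g k
    by (simp add: proj_system_of_pro)
  show "iota S (n + 1) (kappa S n j g) = kappa S (n + 1) j (iota S n g)"
    using Kappa_hor[of "two_at n j" "[1]" g "idn P 1"] valid_tuple_two_at[OF n, of j] g id1
      Kappa_one[of 1]
      sum_list_two_at[OF j] two_at_snoc[OF j] k iota_system_of_pro[OF g] iota_system_of_pro[OF kg]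
      kappa_system_of_pro[of j "Suc n", OF _ _ ig] j by (simp add: valid_tuple_def)
  show "zeta S (n + 1) (kappa S n j g) = kappa S (n + 1) (j + 1) (zeta S n g)"
    using Kappa_hor[of "[1]" "two_at n j" "idn P 1" g] valid_tuple_two_at[OF n, of j] g id1
      Kappa_one[of 1]
      sum_list_two_at[OF j] two_at_Cons[OF j(1)] k zeta_system_of_pro[OF g] zeta_system_of_pro[OF kg]
      kappa_system_of_pro[of "Suc j" "Suc n", OF _ _ zg] j by (simp add: valid_tuple_def)

  \<comment> \<open>The positions j and j + 1 lie in the same block of length 2, so both sides are
    the cloning with a 3 at j.\<close>
  show "kappa S (n + 1) (j + 1) (kappa S n j g) = kappa S (n + 1) j (kappa S n j g)"
    using k kappa_system_of_pro[of _ "Suc n", OF _ _ kg] Kappa_two_at_comp[OF j _ _ g, of j]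
      Kappa_two_at_comp[OF j _ _ g, of "Suc j"] j by simp
  fix h assume "h \<in> carrier (grp S n)"
  then have h: "h \<in> Ops P n n"
    by simp
  let ?s = "Proj P n n h"
  have s: "?s \<in> signed_perms n"
    by (rule Proj_in[OF n h])
  have u: "1 \<le> unsigned n ?s j" "unsigned n ?s j \<le> n"
    using unsigned_in[OF s, of "j - 1"] j by auto
  \<comment> \<open>For an elementary tuple the permuted tuple in (4) is elementary, and (4) becomes
    (v).\<close>
  have "permute_tuple ?s (two_at n j) = two_at n (unsigned n ?s j)"
    using permute_tuple_incr[of ?s "replicate n 1" "j - 1"]
      permute_tuple_replicate[OF s, of "1 :: nat"] s j by simp
  then show "kappa S n j (g \<otimes>\<^bsub>grp S n\<^esub> h) = kappa S n (proj S n h j) g \<otimes>\<^bsub>grp S (n + 1)\<^esub> kappa S n j h"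
    using Kappa_vert[OF valid_tuple_two_at[OF n, of j], of n "Suc n" g h] g h sum_list_two_at[OF j]
      kappa_system_of_pro[OF j h] kappa_system_of_pro[OF u g]
        kappa_system_of_pro[OF j vert_closed[OF n n n g h]]
    by (simp add: proj_system_of_pro)
qed

sublocale system: bilateral_cloning_system S
  by (rule bilateral_system_of_pro)

text \<open>Both sides are the identity at (1,...,1) and satisfy the same increment rule, hence
  agree on all tuples.\<close>

lemma clone_system_of_pro:
  assumes ms: "valid_tuple ms" and f: "f \<in> Ops P (length ms) (length ms)"
  shows "system.clone ms f = Kappa P ms f"
proof (rule valid_tuple_induct[OF ms, where P = "\<lambda>ms. system.clone ms f = Kappa P ms f"])
  show "system.clone (replicate (length ms) 1) f = Kappa P (replicate (length ms) 1) f"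
    unfolding system.clone_ones using Kappa_ones[OF system.valid_tuple_length[OF ms] f] by simp
  fix xs i assume xs: "valid_tuple xs" "length xs = length ms" "i < length ms"
    and IH: "system.clone xs f = Kappa P xs f"
  let ?p = "sum_list (take (Suc i) xs)"
  have b: "in_block xs i ?p"
    using in_block_last xs by simp
  have p: "1 \<le> ?p" "?p \<le> sum_list xs"
    using in_block_bounds[OF b] by auto
  show "system.clone (incr xs i) f = Kappa P (incr xs i) f"
    using system.kappa_clone[OF xs(1) _ b, of f] f xs IH
      kappa_system_of_pro[OF p Kappa_in[OF xs(1), of f]]
      Kappa_Kappa_two_at[OF xs(1) _ b, of f] by simp
qed

lemma iota_iter_system_of_pro:
  assumes "1 \<le> n" "f \<in> Ops P n n" "1 \<le> r"
  shows "iota_iter S n r f = hor P n n r r f (idn P r)"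
  using assms(3)
proof (induction r rule: dec_induct)
  case base
  then show ?case
    using iota_system_of_pro assms by simp
next
  case (step r)
  then show ?case
    using iota_system_of_pro[OF hor_idn_in(1)[OF assms(1,2) step.hyps(1)]] hor_idn[of r 1]
      hor_assoc[of n n r r 1 1 f "idn P r" "idn P 1"] assms idn_closed[of r] idn_closed[of 1] by simp
qed

lemma zeta_iter_system_of_pro:
  assumes "1 \<le> n" "f \<in> Ops P n n" "1 \<le> r"
  shows "zeta_iter S n r f = hor P r r n n (idn P r) f"
  using assms(3)
proof (induction r rule: dec_induct)
  case base
  then show ?case
    using zeta_system_of_pro assms by simp
next
  case (step r)
  then show ?case
    using zeta_system_of_pro[OF hor_idn_in(2)[OF assms(1,2) step.hyps(1)]] hor_idn[of 1 r]
      hor_assoc[of 1 1 r r n n "idn P 1" "idn P r" f] assms idn_closed[of r] idn_closed[of 1]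
    by (simp add: add.commute)
qed

lemma hor_list_replicate_idn:
  assumes "1 \<le> r"
  shows "hor_list P (replicate r 1) (replicate r (idn P 1)) = idn P r"
  using assms
proof (induction r rule: dec_induct)
  case (step r)
  then obtain q where q: "r = Suc q"
    by (cases r) auto
  have "hor_list P (replicate (Suc r) 1) (replicate (Suc r) (idn P 1))
      = hor P 1 1 r r (idn P 1) (hor_list P (replicate r 1) (replicate r (idn P 1)))"
    unfolding q by (simp add: sum_list_replicate)
  then show ?case
    using step hor_idn[of 1 r] by simp
qed simp

text \<open>Identifies the \<nu> of (viii) with an iterated product of identities and one h, the
  shape in which (\<star>) applies.\<close>

lemma hor_list_idn_update:
  assumes "k < n" "1 \<le> m" "h \<in> Ops P m m"
  shows "hor_list P ((replicate n 1)[k := m]) ((replicate n (idn P 1))[k := h]) = nu S m (Suc k) n h"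
  using assms(1)
proof (induction k arbitrary: n)
  case 0
  then obtain q where q: "n = Suc q"
    by (cases n) auto
  show ?case
  proof (cases q)
    case 0
    then show ?thesis
      by (simp add: q nu_def)
  next
    case (Suc q')
    have "hor_list P ((replicate n 1)[0 := m]) ((replicate n (idn P 1))[0 := h])
        = hor P m m q q h (hor_list P (replicate q 1) (replicate q (idn P 1)))"
      by (simp add: q Suc sum_list_replicate)
    then show ?thesis
      using hor_list_replicate_idn[of q] iota_iter_system_of_pro[OF assms(2,3), of q] Suc
        by (simp add: q nu_def)
  qed
next
  case (Suc k)
  then obtain q where q: "n = Suc (Suc q)" "k < Suc q"
    by (cases n; cases "n - 1") auto
  let ?ms = "(replicate (Suc q) 1)[k := m]" and ?gs = "(replicate (Suc q) (idn P 1))[k := h]"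
  let ?N = "m + (q - k)"
  have s: "sum_list ?ms = ?N + k"
    using q assms by (simp add: sum_list_update sum_list_replicate nth_Cons' del: replicate_Suc)
  \<comment> \<open>The recursive equation of \<open>hor_list\<close> only fires on lists with
    visibly nonempty tails.\<close>
  obtain m' ms' g' gs' where c: "?ms = m' # ms'" "?gs = g' # gs'"
    by (cases k) auto
  have "hor_list P ((replicate n 1)[Suc k := m]) ((replicate n (idn P 1))[Suc k := h])
      = hor P 1 1 (sum_list ?ms) (sum_list ?ms) (idn P 1) (hor_list P ?ms ?gs)"
  proof -
    have "(replicate n 1)[Suc k := m] = 1 # ?ms" "(replicate n (idn P 1))[Suc k := h] = idn P 1 # ?gs"
      by (simp_all add: q)
    then show ?thesis
      unfolding c by simp
  qed
  also have "hor_list P ?ms ?gs = zeta_iter S ?N k (iota_iter S m (q - k) h)"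
    using Suc.IH[OF q(2)] q by (simp add: nu_def del: replicate_Suc)
  also have "hor P 1 1 (sum_list ?ms) (sum_list ?ms) (idn P 1) \<dots>
    = zeta S (?N + k) (zeta_iter S ?N k (iota_iter S m (q - k) h))"
    unfolding s using zeta_system_of_pro[of "zeta_iter S ?N k (iota_iter S m (q - k) h)" "?N + k"]
      system.zeta_iter_in[of ?N "iota_iter S m (q - k) h" k] system.iota_iter_in[of m h "q - k"]
        assms by simp
  also have "\<dots> = nu S m (Suc (Suc k)) n h"
    using q by (simp add: nu_def)
  finally show ?case .
qed

lemma operadic_system_of_pro: "operadic_cloning_system S"
proof (intro operadic_cloning_system.intro operadic_cloning_system_axioms.intro bilateral_system_of_pro)
  fix n m :: nat and g h
  assume nm: "1 \<le> n" "1 \<le> m" and "g \<in> carrier (grp S n)" "h \<in> carrier (grp S m)"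
  then have gh: "g \<in> Ops P n n" "h \<in> Ops P m m"
    by auto
  have "zeta_iter S m n h = hor P n n m m (idn P n) h" "iota_iter S n m g = hor P n n m m g (idn P m)"
    using iota_iter_system_of_pro[OF nm(1) gh(1) nm(2)]
      zeta_iter_system_of_pro[OF nm(2) gh(2) nm(1)] by auto
  \<comment> \<open>By interchange, both products equal g \<otimes> h.\<close>
  then show "iota_iter S n m g \<otimes>\<^bsub>grp S (n + m)\<^esub> zeta_iter S m n h
      = zeta_iter S m n h \<otimes>\<^bsub>grp S (n + m)\<^esub> iota_iter S n m g"
    using interchange[of n n n m m m g "idn P m" "idn P n" h]
      interchange[of n n n m m m "idn P n" h g "idn P m"]
      nm gh idn_closed vert_idn_left vert_idn_right by simp
next
  fix m i n g h
  assume m: "1 \<le> m" and i: "1 \<le> i" "i \<le> n" and "g \<in> carrier (grp S n)" "h \<in> carrier (grp S m)"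
  then have gh: "g \<in> Ops P n n" "h \<in> Ops P m m" and n: "1 \<le> n" and i': "i - 1 < n" "Suc (i - 1) = i"
    by auto
  let ?s = "Proj P n n g"
  have s: "?s \<in> signed_perms n"
    by (rule Proj_in[OF n gh(1)])
  let ?u = "unsigned n ?s i - 1"
  have u: "?u < n" "Suc ?u = unsigned n ?s i"
    using unsigned_in[OF s i'(1)] i'(2) by auto
  \<comment> \<open>The instance of (\<star>) that is (viii): m copies of strand i with h on them,
    and identities on the other single strands.\<close>
  let ?ms = "(replicate n 1)[i - 1 := m]" and ?gs = "(replicate n (idn P 1))[i - 1 := h]"
  have v: "valid_tuple ?ms"
    unfolding valid_tuple_nth
  proof (intro conjI allI impI)
    fix k assume "k < length ?ms"
    then show "1 \<le> ?ms ! k"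
      using m by (cases "k = i - 1") auto
  qed (use n in auto)
  have sum: "sum_list ?ms = n + m - 1"
    using i by (simp add: sum_list_update sum_list_replicate)
  have K: "Kappa P ?ms g = kappa_iter S n i m g"
    using system.clone_single[OF i'(1) m, of g] clone_system_of_pro[OF v, of g] gh i'(2) by simp
  have p: "permute_tuple ?s ?ms = (replicate n 1)[?u := m]"
    "permute_tuple ?s ?gs = (replicate n (idn P 1))[?u := h]"
    using permute_tuple_list_update[of ?s "replicate n (1 :: nat)" "i - 1" m]
      permute_tuple_list_update[of ?s "replicate n (idn P 1)" "i - 1" h]
      permute_tuple_replicate[OF s, of "1 :: nat"] permute_tuple_replicate[OF s, of "idn P 1"] s
        i' by simp_all
  have "\<forall>k<n. ?gs ! k \<in> Ops P (?ms ! k) (?ms ! k)"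
    using gh idn_closed[of 1] i' by (auto simp: nth_list_update)
  then have "vert P (n + m - 1) (n + m - 1) (n + m - 1) (Kappa P ?ms g) (hor_list P ?ms ?gs)
      = vert P (n + m - 1) (n + m - 1) (n + m - 1)
        (hor_list P (permute_tuple ?s ?ms) (permute_tuple ?s ?gs)) (Kappa P ?ms g)"
    by (intro Kappa_star[OF v]) (use sum gh in simp_all)
  then show "kappa_iter S n i m g \<otimes>\<^bsub>grp S (n + m - 1)\<^esub> nu S m i n h
      = nu S m (proj S n g i) n h \<otimes>\<^bsub>grp S (n + m - 1)\<^esub> kappa_iter S n i m g"
    unfolding K p using hor_list_idn_update[OF i'(1) m gh(2)] hor_list_idn_update[OF u(1) m gh(2)]
      i'(2) u(2)
    by (simp add: proj_system_of_pro[OF gh(1)])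
qed

lemma extensional_system_of_pro: "extensional_system S"
  using extensional unfolding extensional_system_def extensional_pro_def
  by (auto simp: system_of_pro_def diag_grp_def)

text \<open>The sign lost in passing to the absolute value is recovered: by
  \<open>unsigned_clone_strand\<close>, a flip at j occurs exactly when the original value at j is
  not positive.\<close>

lemma signed_proj_system_of_pro:
  assumes n: "1 \<le> n" and f: "f \<in> Ops P n n"
  shows "signed_proj S n f = Proj P n n f"
proof (rule odd_map_eqI[OF odd_map_signed_proj signed_perms_odd_map[OF Proj_in[OF n f]]])
  fix j assume j: "1 \<le> j" "j \<le> n"
  have "flips S n j f \<longleftrightarrow> \<not> Proj P n n f (int j) > 0"
    using unsigned_clone_strand(2)[OF Proj_in[OF n f] j] Proj_kappa[OF j f] f Kappa_two_at_in[OF j f]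
      kappa_system_of_pro[OF j f] by (simp add: flips_def proj_system_of_pro)
  then show "signed_proj S n f (int j) = Proj P n n f (int j)"
    using j by (auto simp: signed_proj_flips proj_system_of_pro[OF f] unsigned_def)
qed

end

section \<open>The constructions are mutually inverse on objects\<close>

text \<open>In f \<otimes> id_1 and id_1 \<otimes> f the unit contributes a trivial factor, leaving
  \<iota>(f) and \<zeta>(f). Off the domains both sides take the default value.\<close>

lemma (in normalized_system) system_of_pro_of_system: "system_of_pro P = S"
proof (rule bilateral_cloning_data.equality)
  have nrm: "carrier (grp S 0) = {}" "iota S n \<in> extensional (carrier (grp S n))"
    "zeta S n \<in> extensional (carrier (grp S n))" "proj S n \<in> extensional (carrier (grp S n))"
    "kappa S n j \<in> extensional (if 1 \<le> j \<and> j \<le> n then carrier (grp S n) else {})" for n j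
    using extensional by (auto simp: extensional_system_def)
  have Ops: "Ops P n n = carrier (grp S n)" for n
    using nrm(1) by (cases n) (auto simp: Ops_pro_of_system)
  have pos: "1 \<le> n" if "f \<in> carrier (grp S n)" for n f
    using nrm(1) that by (cases n) auto
  have one1: "\<one>\<^bsub>grp S 1\<^esub> \<in> Ops P 1 1"
    using grp_simps(1)[of 1] by (simp add: Ops)
  show "grp (system_of_pro P) = grp S"
    using diag_grp_pro_of_system[OF extensional] by (simp add: system_of_pro_def)
  show "iota (system_of_pro P) = iota S"
  proof
    fix n
    have "hor P n n 1 1 f (idn P 1) = iota S n f" if "f \<in> carrier (grp S n)" for f
      using hor_pro_of_system[of f n n "\<one>\<^bsub>grp S 1\<^esub>" 1 1] that one1 pos[OF that] zeta_iter_one[of 1 n]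
        iota_in[OF pos[OF that] that] grp_simps(3)[of "Suc n"]
      by (simp add: hprod_def idn_pro_of_system Ops)
    then show "iota (system_of_pro P) n = iota S n"
      using nrm(2)[of n] by (auto simp: system_of_pro_def Ops restrict_def fun_eq_iff extensional_def)
  qed
  show "zeta (system_of_pro P) = zeta S"
  proof
    fix n
    have "hor P 1 1 n n (idn P 1) f = zeta S n f" if "f \<in> carrier (grp S n)" for f
      using hor_pro_of_system[of "\<one>\<^bsub>grp S 1\<^esub>" 1 1 f n n] that one1 pos[OF that] iota_iter_one[of 1 n]
        zeta_in[OF pos[OF that] that] grp_simps(2)[of "Suc n"]
      by (simp add: hprod_def idn_pro_of_system Ops)
    then show "zeta (system_of_pro P) n = zeta S n"
      using nrm(3)[of n] by (auto simp: system_of_pro_def Ops restrict_def fun_eq_iff extensional_def)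
  qed
  show "kappa (system_of_pro P) = kappa S"
  proof (intro ext)
    fix n j f
    show "kappa (system_of_pro P) n j f = kappa S n j f"
    proof (cases "1 \<le> j \<and> j \<le> n \<and> f \<in> carrier (grp S n)")
      case True
      then have j: "1 \<le> j" "j \<le> n" and f: "f \<in> carrier (grp S n)"
        by auto
      have "Kappa P (two_at n j) f = kappa S n j f"
        using Kappa_pro_of_system[OF valid_tuple_two_at, of n f j] clone_two[OF j f] j f Ops[of n]
          by simp
      then show ?thesis
        using j f incr_ones[OF j] by (simp add: system_of_pro_def Ops)
    next
      case False
      then show ?thesis
        using nrm(5)[of n j] by (auto simp: system_of_pro_def Ops extensional_def)
    qed
  qed
  show "proj (system_of_pro P) = proj S"
  proof (intro ext)
    fix n f i
    show "proj (system_of_pro P) n f i = proj S n f i"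
    proof (cases "f \<in> carrier (grp S n)")
      case True
      then have "proj (system_of_pro P) n f = unsigned n (signed_proj S n f)"
        by (auto simp: system_of_pro_def Ops unsigned_def Proj_pro_of_system)
      then show ?thesis
        using unsigned_signed_proj[OF pos[OF True] True] by simp
    next
      case False
      then show ?thesis
        using nrm(4)[of n] by (simp add: system_of_pro_def Ops extensional_def)
    qed
  qed
qed simp

text \<open>The horizontal product is recovered from \<iota> and \<zeta> by interchange, as (f
  \<otimes> id) \<odot> (id \<otimes> g); \<kappa> and \<pi> are recovered by the increment rule and
  by the sign criterion.\<close>

lemma (in normalized_pro) pro_of_system_of_pro: "pro_of_system S = P"
proof (rule cloning_pro_data.equality)
  let ?Q = "pro_of_system S"
  have nrm: "idn P 0 = undefined" "Ops P n 0 = {}" "Ops P 0 n = {}"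
    "extensional2 (Ops P n t) (Ops P s n) (vert P s n t)"
    "extensional2 (Ops P n m) (Ops P n' m') (hor P n m n' m')"
    "Proj P n m \<in> extensional (Ops P n m)"
    "Kappa P ms \<in> extensional (if valid_tuple ms then Ops P (length ms) (length ms) else {})" for
      n m s t n' m' ms
    using extensional by (auto simp: extensional_pro_def)
  show Ops: "Ops ?Q = Ops P"
  proof (intro ext)
    fix n m :: nat
    consider "n = 0 \<or> m = 0" | "n = m" "1 \<le> n" | "1 \<le> n" "1 \<le> m" "n \<noteq> m"
      by (cases "n = m"; cases "n = 0"; cases "m = 0") (auto simp: Suc_le_eq)
    then show "Ops ?Q n m = Ops P n m"
      by cases (auto simp: Ops_pro_of_system nrm off_diagonal)
  qed
  have diag: "m = n \<and> 1 \<le> n" if "f \<in> Ops P n m" for f n m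
    using that off_diagonal[of n m] nrm(2)[of n] nrm(3)[of m] by (cases "n = 0"; cases "m = 0") auto
  show "vert ?Q = vert P"
  proof (intro ext)
    fix s n t f g
    show "vert ?Q s n t f g = vert P s n t f g"
    proof (cases "f \<in> Ops P n t \<and> g \<in> Ops P s n")
      case True
      then show ?thesis
        using vert_pro_of_system[of f S n t g s] diag[of f n t] diag[of g s n] by (simp add: Ops)
    next
      case False
      then have "vert P s n t f g = undefined"
        using nrm(4)[of n t s] by (auto simp: extensional2_def)
      moreover have "vert ?Q s n t f g = undefined"
        using False Ops by (auto simp: pro_of_system_def Let_def restrict2_def fun_eq_iff)
      ultimately show ?thesis
        by simp
    qed
  qed
  show "hor ?Q = hor P"
  proof (intro ext)
    fix n m n' m' f g
    show "hor ?Q n m n' m' f g = hor P n m n' m' f g"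
    proof (cases "f \<in> Ops P n m \<and> g \<in> Ops P n' m'")
      case True
      then have d: "m = n" "1 \<le> n" "m' = n'" "1 \<le> n'" and fg: "f \<in> Ops P n n" "g \<in> Ops P n' n'"
        using diag by auto
      have "hor ?Q n m n' m' f g = iota_iter S n n' f \<otimes>\<^bsub>grp S (n + n')\<^esub> zeta_iter S n' n g"
        using True Ops by (simp add: pro_of_system_def Let_def restrict2_def fun_eq_iff)
      also have "\<dots> = vert P (n + n') (n + n') (n + n') (hor P n n n' n' f (idn P n'))
        (hor P n n n' n' (idn P n) g)"
        using iota_iter_system_of_pro[OF d(2) fg(1) d(4)]
          zeta_iter_system_of_pro[OF d(4) fg(2) d(2)] by simp
      also have "\<dots> = hor P n n n' n' f g"
        using interchange[of n n n n' n' n' f "idn P n'" "idn P n" g] d fg idn_closed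
          vert_idn_left vert_idn_right
        by simp
      finally show ?thesis
        using d by simp
    next
      case False
      then have "hor P n m n' m' f g = undefined"
        using nrm(5)[of n m n' m'] by (auto simp: extensional2_def)
      moreover have "hor ?Q n m n' m' f g = undefined"
        using False Ops by (auto simp: pro_of_system_def Let_def restrict2_def fun_eq_iff)
      ultimately show ?thesis
        by simp
    qed
  qed
  show "idn ?Q = idn P"
    by (simp add: idn_pro_of_system fun_eq_iff)
  show "Proj ?Q = Proj P"
  proof (intro ext)
    fix n m f i
    show "Proj ?Q n m f i = Proj P n m f i"
    proof (cases "f \<in> Ops P n m")
      case True
      then show ?thesis
        using diag[OF True] Proj_pro_of_system[of f S n m] signed_proj_system_of_pro[of n f]
          by (simp add: Ops)
    next
      case False
      then have "Proj P n m f = undefined"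
        using nrm(6)[of n m] by (simp add: extensional_def)
      moreover have "Proj ?Q n m f = undefined"
        using False Ops by (auto simp: pro_of_system_def Let_def fun_eq_iff)
      ultimately show ?thesis
        by simp
    qed
  qed
  show "Kappa ?Q = Kappa P"
  proof (intro ext)
    fix ms f
    show "Kappa ?Q ms f = Kappa P ms f"
    proof (cases "valid_tuple ms \<and> f \<in> Ops P (length ms) (length ms)")
      case True
      then have "Kappa ?Q ms f = system.clone ms f"
        using Ops by (simp add: pro_of_system_def Let_def system.clone_def fun_eq_iff)
      then show ?thesis
        using clone_system_of_pro True by simp
    next
      case False
      then have "Kappa P ms f = undefined"
        using nrm(7)[of ms] by (auto simp: extensional_def split: if_splits)
      moreover have "Kappa ?Q ms f = undefined"
        using False Ops by (auto simp: pro_of_system_def Let_def fun_eq_iff)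
      ultimately show ?thesis
        by simp
    qed
  qed
qed simp

subsection \<open>The two functors\<close>

lemma Obj_operadic_systems: "X \<in> Obj operadic_systems \<longleftrightarrow> normalized_system X"
  by (auto simp: operadic_systems_def normalized_system_def normalized_system_axioms_def)

lemma Obj_cloning_pros: "X \<in> Obj cloning_pros \<longleftrightarrow> normalized_pro X"
  by (auto simp: cloning_pros_def normalized_pro_def normalized_pro_axioms_def)

lemma Hom_operadic_systems:
  "\<phi> \<in> Hom operadic_systems X Y \<longleftrightarrow> system_morphism X Y \<phi> \<and> (\<forall>n. \<phi> n \<in> extensional (carrier (grp X n)))"
  by (simp add: operadic_systems_def)

lemma Hom_cloning_pros:
  "F \<in> Hom cloning_pros P Q \<longleftrightarrow> cloning_pro_morphism P Q F \<and> (\<forall>n m. F n m \<in> extensional (Ops P n m))"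
  by (simp add: cloning_pros_def)

text \<open>Morphism axioms are stated for positive arities; emptiness in arity 0 extends their
  consequences to every index.\<close>

lemma (in normalized_system) carrier_pos: "g \<in> carrier (grp S n) \<Longrightarrow> 1 \<le> n"
  using extensional by (cases n) (auto simp: extensional_system_def)

lemma (in normalized_pro) Ops_diag: "f \<in> Ops P n m \<Longrightarrow> m = n \<and> 1 \<le> n"
  using extensional off_diagonal[of n m]
    by (cases "n = 0"; cases "m = 0") (auto simp: extensional_pro_def)

lemma system_morphismD:
  assumes "system_morphism X Y \<phi>" "1 \<le> n"
  shows "g \<in> carrier (grp X n) \<Longrightarrow> \<phi> n g \<in> carrier (grp Y n)"
    and "g \<in> carrier (grp X n) \<Longrightarrow> h \<in> carrier (grp X n) \<Longrightarrow> \<phi> n (g \<otimes>\<^bsub>grp X n\<^esub> h) = \<phi> n g \<otimes>\<^bsub>grp Y n\<^esub> \<phi> n h"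
    and "g \<in> carrier (grp X n) \<Longrightarrow> \<phi> (Suc n) (iota X n g) = iota Y n (\<phi> n g)"
    and "g \<in> carrier (grp X n) \<Longrightarrow> \<phi> (Suc n) (zeta X n g) = zeta Y n (\<phi> n g)"
    and "g \<in> carrier (grp X n) \<Longrightarrow> 1 \<le> j \<Longrightarrow> j \<le> n \<Longrightarrow> \<phi> (Suc n) (kappa X n j g) = kappa Y n j (\<phi> n g)"
    and "g \<in> carrier (grp X n) \<Longrightarrow> proj Y n (\<phi> n g) = proj X n g"
  using assms by (auto simp: system_morphism_def hom_def)

lemma system_morphismI:
  assumes "\<And>n g. 1 \<le> n \<Longrightarrow> g \<in> carrier (grp X n) \<Longrightarrow> \<phi> n g \<in> carrier (grp Y n)"
    and "\<And>n g h. 1 \<le> n \<Longrightarrow> g \<in> carrier (grp X n) \<Longrightarrow> h \<in> carrier (grp X n)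
      \<Longrightarrow> \<phi> n (g \<otimes>\<^bsub>grp X n\<^esub> h) = \<phi> n g \<otimes>\<^bsub>grp Y n\<^esub> \<phi> n h"
    and "\<And>n g. 1 \<le> n \<Longrightarrow> g \<in> carrier (grp X n) \<Longrightarrow> \<phi> (Suc n) (iota X n g) = iota Y n (\<phi> n g)"
    and "\<And>n g. 1 \<le> n \<Longrightarrow> g \<in> carrier (grp X n) \<Longrightarrow> \<phi> (Suc n) (zeta X n g) = zeta Y n (\<phi> n g)"
    and "\<And>n j g. 1 \<le> j \<Longrightarrow> j \<le> n \<Longrightarrow> g \<in> carrier (grp X n) \<Longrightarrow> \<phi> (Suc n) (kappa X n j g)
      = kappa Y n j (\<phi> n g)"
    and "\<And>n g. 1 \<le> n \<Longrightarrow> g \<in> carrier (grp X n) \<Longrightarrow> proj Y n (\<phi> n g) = proj X n g"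
  shows "system_morphism X Y \<phi>"
  using assms by (auto simp: system_morphism_def hom_def)

lemma cloning_pro_morphismD:
  assumes "cloning_pro_morphism P Q F"
  shows "1 \<le> n \<Longrightarrow> 1 \<le> m \<Longrightarrow> f \<in> Ops P n m \<Longrightarrow> F n m f \<in> Ops Q n m"
    and "1 \<le> n \<Longrightarrow> F n n (idn P n) = idn Q n"
    and "1 \<le> s \<Longrightarrow> 1 \<le> n \<Longrightarrow> 1 \<le> t \<Longrightarrow> f \<in> Ops P n t \<Longrightarrow> g \<in> Ops P s n
      \<Longrightarrow> F s t (vert P s n t f g) = vert Q s n t (F n t f) (F s n g)"
    and "1 \<le> n \<Longrightarrow> 1 \<le> m \<Longrightarrow> 1 \<le> n' \<Longrightarrow> 1 \<le> m' \<Longrightarrow> f \<in> Ops P n m \<Longrightarrow> g \<in> Ops P n' m'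
      \<Longrightarrow> F (n + n') (m + m') (hor P n m n' m' f g) = hor Q n m n' m' (F n m f) (F n' m' g)"
    and "1 \<le> n \<Longrightarrow> 1 \<le> m \<Longrightarrow> f \<in> Ops P n m \<Longrightarrow> Proj Q n m (F n m f) = Proj P n m f"
    and "valid_tuple ms \<Longrightarrow> f \<in> Ops P (length ms) (length ms)
      \<Longrightarrow> F (sum_list ms) (sum_list ms) (Kappa P ms f) = Kappa Q ms (F (length ms) (length ms) f)"
proof -
  note M = assms[unfolded cloning_pro_morphism_def pro_morphism_def]
  note p = conjunct1[OF M] and q = conjunct2[OF M]
  show "1 \<le> n \<Longrightarrow> 1 \<le> m \<Longrightarrow> f \<in> Ops P n m \<Longrightarrow> F n m f \<in> Ops Q n m"
    by (rule funcset_mem[OF conjunct1[OF p, rule_format]])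
  show "1 \<le> n \<Longrightarrow> F n n (idn P n) = idn Q n"
    by (rule conjunct1[OF conjunct2[OF p], rule_format])
  show "1 \<le> s \<Longrightarrow> 1 \<le> n \<Longrightarrow> 1 \<le> t \<Longrightarrow> f \<in> Ops P n t \<Longrightarrow> g \<in> Ops P s n
      \<Longrightarrow> F s t (vert P s n t f g) = vert Q s n t (F n t f) (F s n g)"
    by (rule conjunct1[OF conjunct2[OF conjunct2[OF p]], rule_format])
  show "1 \<le> n \<Longrightarrow> 1 \<le> m \<Longrightarrow> 1 \<le> n' \<Longrightarrow> 1 \<le> m' \<Longrightarrow> f \<in> Ops P n m \<Longrightarrow> g \<in> Ops P n' m'
      \<Longrightarrow> F (n + n') (m + m') (hor P n m n' m' f g) = hor Q n m n' m' (F n m f) (F n' m' g)"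
    by (rule conjunct2[OF conjunct2[OF conjunct2[OF p]], rule_format])
  show "1 \<le> n \<Longrightarrow> 1 \<le> m \<Longrightarrow> f \<in> Ops P n m \<Longrightarrow> Proj Q n m (F n m f) = Proj P n m f"
    by (rule conjunct1[OF q, rule_format])
  show "valid_tuple ms \<Longrightarrow> f \<in> Ops P (length ms) (length ms)
      \<Longrightarrow> F (sum_list ms) (sum_list ms) (Kappa P ms f) = Kappa Q ms (F (length ms) (length ms) f)"
    by (rule conjunct2[OF q, rule_format])
qed

lemma cloning_pro_morphismI:
  assumes "\<And>n m f. 1 \<le> n \<Longrightarrow> 1 \<le> m \<Longrightarrow> f \<in> Ops P n m \<Longrightarrow> F n m f \<in> Ops Q n m"
    and "\<And>n. 1 \<le> n \<Longrightarrow> F n n (idn P n) = idn Q n"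
    and "\<And>s n t f g. 1 \<le> s \<Longrightarrow> 1 \<le> n \<Longrightarrow> 1 \<le> t \<Longrightarrow> f \<in> Ops P n t \<Longrightarrow> g \<in> Ops P s n
      \<Longrightarrow> F s t (vert P s n t f g) = vert Q s n t (F n t f) (F s n g)"
    and "\<And>n m n' m' f g. 1 \<le> n \<Longrightarrow> 1 \<le> m \<Longrightarrow> 1 \<le> n' \<Longrightarrow> 1 \<le> m' \<Longrightarrow> f \<in> Ops P n m \<Longrightarrow> g \<in> Ops P n' m'
      \<Longrightarrow> F (n + n') (m + m') (hor P n m n' m' f g) = hor Q n m n' m' (F n m f) (F n' m' g)"
    and "\<And>n m f. 1 \<le> n \<Longrightarrow> 1 \<le> m \<Longrightarrow> f \<in> Ops P n m \<Longrightarrow> Proj Q n m (F n m f) = Proj P n m f"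
    and "\<And>ms f. valid_tuple ms \<Longrightarrow> f \<in> Ops P (length ms) (length ms)
      \<Longrightarrow> F (sum_list ms) (sum_list ms) (Kappa P ms f) = Kappa Q ms (F (length ms) (length ms) f)"
  shows "cloning_pro_morphism P Q F"
  unfolding cloning_pro_morphism_def pro_morphism_def
  by (intro conjI allI impI ballI Pi_I; rule assms; assumption)

lemma category_operadic_systems: "category
  (operadic_systems :: ('a bilateral_cloning_data, nat \<Rightarrow> 'a \<Rightarrow> 'a) category)"
proof (rule category.intro)
  fix X :: "'a bilateral_cloning_data" assume "X \<in> Obj operadic_systems"
  then interpret X: normalized_system X
    by (simp add: Obj_operadic_systems)
  have "system_morphism X X (\<lambda>n. \<lambda>g \<in> carrier (grp X n). g)"
    by (rule system_morphismI) (simp_all add: X.iota_in X.zeta_in X.kappa_in X.grp_simps)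
  then show "Ident operadic_systems X \<in> Hom operadic_systems X X"
    by (simp add: Hom_operadic_systems) (simp add: operadic_systems_def)
next
  fix X Y Z :: "'a bilateral_cloning_data" and f g
  assume "X \<in> Obj operadic_systems" "Y \<in> Obj operadic_systems" "Z \<in> Obj operadic_systems"
    and f: "f \<in> Hom operadic_systems X Y" and g: "g \<in> Hom operadic_systems Y Z"
  then interpret X: normalized_system X
    by (simp add: Obj_operadic_systems)
  have fm: "system_morphism X Y f" and gm: "system_morphism Y Z g"
    using f g by (auto simp: Hom_operadic_systems)
  have "system_morphism X Z (\<lambda>n. compose (carrier (grp X n)) (g n) (f n))"
    by (rule system_morphismI)
      (simp_all add: compose_def system_morphismD[OF fm] system_morphismD[OF gm]
        X.iota_in X.zeta_in X.kappa_in X.grp_simps)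
  then show "Comp operadic_systems X Y Z g f \<in> Hom operadic_systems X Z"
    by (simp add: Hom_operadic_systems) (simp add: operadic_systems_def)
next
  fix X Y :: "'a bilateral_cloning_data" and f
  assume "X \<in> Obj operadic_systems" "Y \<in> Obj operadic_systems" and f: "f \<in> Hom operadic_systems X Y"
  then interpret X: normalized_system X
    by (simp add: Obj_operadic_systems)
  have fm: "system_morphism X Y f" and fe: "\<And>n. f n \<in> extensional (carrier (grp X n))"
    using f by (auto simp: Hom_operadic_systems)
  have "compose (carrier (grp X n)) (f n) (\<lambda>g \<in> carrier (grp X n). g) = f n" for n
    using fe[of n] by (auto simp: compose_def fun_eq_iff extensional_def)
  then show "Comp operadic_systems X X Y f (Ident operadic_systems X) = f"
    by (simp add: operadic_systems_def)
  have "compose (carrier (grp X n)) (\<lambda>g \<in> carrier (grp Y n). g) (f n) = f n" for n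
  proof
    fix x
    show "compose (carrier (grp X n)) (\<lambda>g \<in> carrier (grp Y n). g) (f n) x = f n x"
      using fe[of n] system_morphismD(1)[OF fm X.carrier_pos]
        by (auto simp: compose_def extensional_def)
  qed
  then show "Comp operadic_systems X Y Y (Ident operadic_systems Y) f = f"
    by (simp add: operadic_systems_def)
next
  fix W X Y Z :: "'a bilateral_cloning_data" and f g h
  assume "W \<in> Obj operadic_systems" "f \<in> Hom operadic_systems W X"
  then interpret W: normalized_system W
    by (simp add: Obj_operadic_systems)
  have "f n x \<in> carrier (grp X n)" if "x \<in> carrier (grp W n)" for n x
    using system_morphismD(1)[of W X f n x] W.carrier_pos[OF that] that \<open>f \<in> Hom operadic_systems W X\<close>
    by (simp add: Hom_operadic_systems)
  then show "Comp operadic_systems W Y Z h (Comp operadic_systems W X Y g f)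
      = Comp operadic_systems W X Z (Comp operadic_systems X Y Z h g) f"
    by (auto simp: operadic_systems_def compose_def fun_eq_iff)
qed

lemma category_cloning_pros: "category (cloning_pros :: ('a cloning_pro_data, nat \<Rightarrow> nat \<Rightarrow> 'a \<Rightarrow> 'a)
  category)"
proof (rule category.intro)
  fix P :: "'a cloning_pro_data" assume "P \<in> Obj cloning_pros"
  then interpret P: normalized_pro P
    by (simp add: Obj_cloning_pros)
  have "cloning_pro_morphism P P (\<lambda>n m. \<lambda>f \<in> Ops P n m. f)"
    by (rule cloning_pro_morphismI)
      (simp_all add: P.idn_closed P.vert_closed P.hor_closed P.Kappa_in)
  then show "Ident cloning_pros P \<in> Hom cloning_pros P P"
    by (simp add: Hom_cloning_pros) (simp add: cloning_pros_def)
next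
  fix P Q R :: "'a cloning_pro_data" and F G
  assume "P \<in> Obj cloning_pros" and F: "F \<in> Hom cloning_pros P Q" and G: "G \<in> Hom cloning_pros Q R"
    and Q: "Q \<in> Obj cloning_pros"
  then interpret P: normalized_pro P
    by (simp add: Obj_cloning_pros)
  have Fm: "cloning_pro_morphism P Q F" and Gm: "cloning_pro_morphism Q R G"
    using F G by (auto simp: Hom_cloning_pros)
  have "cloning_pro_morphism P R (\<lambda>n m. compose (Ops P n m) (G n m) (F n m))"
  proof (rule cloning_pro_morphismI)
    fix ms f assume ms: "valid_tuple ms" and f: "f \<in> Ops P (length ms) (length ms)"
    have "length ms \<ge> 1"
      using P.system.valid_tuple_length[OF ms] .
    then show "compose (Ops P (sum_list ms) (sum_list ms)) (G (sum_list ms) (sum_list ms))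
      (F (sum_list ms) (sum_list ms)) (Kappa P ms f)
        = Kappa R ms (compose (Ops P (length ms) (length ms)) (G (length ms) (length ms))
          (F (length ms) (length ms)) f)"
      using cloning_pro_morphismD(6)[OF Fm ms f] cloning_pro_morphismD(6)[OF Gm ms]
        cloning_pro_morphismD(1)[OF Fm _ _ f] P.Kappa_in[OF ms f] f by (simp add: compose_def)
  qed (simp_all add: compose_def cloning_pro_morphismD(1-5)[OF Fm] cloning_pro_morphismD(1-5)[OF Gm]
      P.idn_closed P.vert_closed P.hor_closed)
  then show "Comp cloning_pros P Q R G F \<in> Hom cloning_pros P R"
    by (simp add: Hom_cloning_pros) (simp add: cloning_pros_def)
next
  fix P Q :: "'a cloning_pro_data" and F
  assume "P \<in> Obj cloning_pros" and F: "F \<in> Hom cloning_pros P Q"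
  then interpret P: normalized_pro P
    by (simp add: Obj_cloning_pros)
  have Fm: "cloning_pro_morphism P Q F" and Fe: "\<And>n m. F n m \<in> extensional (Ops P n m)"
    using F by (auto simp: Hom_cloning_pros)
  have "compose (Ops P n m) (F n m) (\<lambda>f \<in> Ops P n m. f) = F n m" for n m
    using Fe[of n m] by (auto simp: compose_def fun_eq_iff extensional_def)
  then show "Comp cloning_pros P P Q F (Ident cloning_pros P) = F"
    by (simp add: cloning_pros_def)
  have "compose (Ops P n m) (\<lambda>f \<in> Ops Q n m. f) (F n m) = F n m" for n m
  proof
    fix x
    show "compose (Ops P n m) (\<lambda>f \<in> Ops Q n m. f) (F n m) x = F n m x"
      using Fe[of n m] cloning_pro_morphismD(1)[OF Fm, of n m x] P.Ops_diag[of x n m]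
      by (auto simp: compose_def extensional_def)
  qed
  then show "Comp cloning_pros P Q Q (Ident cloning_pros Q) F = F"
    by (simp add: cloning_pros_def)
next
  fix O' P Q R :: "'a cloning_pro_data" and F G H
  assume "O' \<in> Obj cloning_pros" and F: "F \<in> Hom cloning_pros O' P"
  then interpret N: normalized_pro O'
    by (simp add: Obj_cloning_pros)
  have "F n m x \<in> Ops P n m" if "x \<in> Ops O' n m" for n m x
    using cloning_pro_morphismD(1)[of O' P F n m x] N.Ops_diag[OF that] that F
      by (simp add: Hom_cloning_pros)
  then show "Comp cloning_pros O' Q R H (Comp cloning_pros O' P Q G F)
      = Comp cloning_pros O' P R (Comp cloning_pros P Q R H G) F"
    by (auto simp: cloning_pros_def compose_def fun_eq_iff)
qed

lemma normalized_pro_pro_of_system: "normalized_system X \<Longrightarrow> normalized_pro (pro_of_system X)"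
  by (simp add: normalized_pro_def normalized_pro_axioms_def normalized_system.cloning_pro_pro_of_system
      extensional_pro_of_system normalized_system.extensional)

lemma normalized_system_system_of_pro: "normalized_pro P \<Longrightarrow> normalized_system (system_of_pro P)"
  by (simp add: normalized_system_def normalized_system_axioms_def normalized_pro.operadic_system_of_pro
      normalized_pro.extensional_system_of_pro)

text \<open>A flip is expressed by \<pi> and \<kappa> alone, so a morphism of systems preserves
  signs. Products follow from \<iota> and \<zeta>, and cloning by tuples from the increment
  rule.\<close>

lemma cloning_pro_morphism_pro_arrow:
  assumes "normalized_system X" "normalized_system Y" and \<phi>: "system_morphism X Y \<phi>"
  shows "cloning_pro_morphism (pro_of_system X) (pro_of_system Y) (pro_arrow \<phi>)"
proof -
  interpret X: normalized_system X by fact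
  interpret Y: normalized_system Y by fact
  note \<phi>D = system_morphismD[OF \<phi>]
  \<comment> \<open>A multiplicative map sends the unit to an idempotent.\<close>
  have one: "\<phi> n \<one>\<^bsub>grp X n\<^esub> = \<one>\<^bsub>grp Y n\<^esub>" if n: "1 \<le> n" for n
    using Y.idempotent_is_one[OF n] \<phi>D(1,2)[OF n] X.grp_simps[OF n] by metis
  have iota: "\<phi> (n + r) (iota_iter X n r f) = iota_iter Y n r (\<phi> n f)" if "f \<in> carrier (grp X n)"
    "1 \<le> n" for n r f
    by (induction r) (use that in \<open>simp_all add: \<phi>D X.iota_iter_in\<close>)
  have zeta: "\<phi> (n + r) (zeta_iter X n r f) = zeta_iter Y n r (\<phi> n f)" if "f \<in> carrier (grp X n)"
    "1 \<le> n" for n r f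
    by (induction r) (use that in \<open>simp_all add: \<phi>D X.zeta_iter_in\<close>)
  have hprod: "\<phi> (n + m) (X.hprod n m f g) = Y.hprod n m (\<phi> n f) (\<phi> m g)"
    if "1 \<le> n" "1 \<le> m" "f \<in> carrier (grp X n)" "g \<in> carrier (grp X m)" for n m f g
    unfolding X.hprod_def Y.hprod_def
    using \<phi>D(2)[of "n + m" "iota_iter X n m f" "zeta_iter X m n g"] that iota[of f n m] zeta[of g m n]
      X.iota_iter_in[of n f m] X.zeta_iter_in'[of m g n] by (simp add: add.commute)
  have clone: "\<phi> (sum_list ms) (X.clone ms f) = Y.clone ms (\<phi> (length ms) f)"
    if ms: "valid_tuple ms" and f: "f \<in> carrier (grp X (length ms))" for ms f
  proof (rule valid_tuple_induct[OF ms, where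
        P = "\<lambda>xs. \<phi> (sum_list xs) (X.clone xs f) = Y.clone xs (\<phi> (length ms) f)"])
    show "\<phi> (sum_list (replicate (length ms) 1)) (X.clone (replicate (length ms) 1) f)
        = Y.clone (replicate (length ms) 1) (\<phi> (length ms) f)"
      unfolding X.clone_ones Y.clone_ones by (simp add: sum_list_replicate)
    fix xs i assume xs: "valid_tuple xs" "length xs = length ms" "i < length ms"
      and IH: "\<phi> (sum_list xs) (X.clone xs f) = Y.clone xs (\<phi> (length ms) f)"
    let ?p = "sum_list (take (Suc i) xs)"
    have b: "in_block xs i ?p"
      using in_block_last xs by simp
    have p: "1 \<le> ?p" "?p \<le> sum_list xs" "1 \<le> sum_list xs"
      using in_block_bounds[OF b] by auto
    have "\<phi> (length ms) f \<in> carrier (grp Y (length xs))"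
      using \<phi>D(1)[OF X.valid_tuple_length[OF ms] f] xs by simp
    then show "\<phi> (sum_list (incr xs i)) (X.clone (incr xs i) f) = Y.clone (incr xs i) (\<phi> (length ms) f)"
      using X.kappa_clone[OF xs(1) _ b, of f] Y.kappa_clone[OF xs(1) _ b, of "\<phi> (length ms) f"]
        \<phi>D(5)[OF p(3) X.clone_in[OF xs(1)] p(1,2), of f] f xs IH by simp
  qed
  have flips: "flips Y n j (\<phi> n f) \<longleftrightarrow> flips X n j f" if "1 \<le> j" "j \<le> n" "f \<in> carrier (grp X n)" for n j f
    using \<phi>D(5)[of n f j] \<phi>D(6)[of n f] \<phi>D(6)[of "Suc n" "kappa X n j f"] X.kappa_in[OF that] that
    by (simp add: flips_def)
  have sp: "signed_proj Y n (\<phi> n f) = signed_proj X n f" if "1 \<le> n" "f \<in> carrier (grp X n)" for n f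
    by (rule odd_map_eqI[OF odd_map_signed_proj odd_map_signed_proj])
      (use that in \<open>simp add: signed_proj_flips flips \<phi>D\<close>)
  show ?thesis
  proof (rule cloning_pro_morphismI)
    fix ms f assume ms: "valid_tuple ms" and "f \<in> Ops (pro_of_system X) (length ms) (length ms)"
    then have f: "f \<in> carrier (grp X (length ms))"
      using X.Ops_length by blast
    have \<phi>f: "\<phi> (length ms) f \<in> carrier (grp Y (length ms))"
      by (rule \<phi>D(1)[OF X.valid_tuple_length[OF ms] f])
    show "pro_arrow \<phi> (sum_list ms) (sum_list ms) (Kappa (pro_of_system X) ms f)
        = Kappa (pro_of_system Y) ms (pro_arrow \<phi> (length ms) (length ms) f)"
      using X.Kappa_pro_of_system[OF ms, of f] Y.Kappa_pro_of_system[OF ms, of "\<phi> (length ms) f"]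
        clone[OF ms f] f \<phi>f X.Ops_length[OF ms] Y.Ops_length[OF ms] by (simp add: pro_arrow_def)
  next
    fix s n t f g assume "f \<in> Ops (pro_of_system X) n t" "g \<in> Ops (pro_of_system X) s n"
    then have "n = t" "s = t" "1 \<le> t" "f \<in> carrier (grp X t)" "g \<in> carrier (grp X t)"
      by (auto simp: Ops_pro_of_system split: if_splits)
    then show "pro_arrow \<phi> s t (vert (pro_of_system X) s n t f g)
        = vert (pro_of_system Y) s n t (pro_arrow \<phi> n t f) (pro_arrow \<phi> s n g)"
      by (simp add: vert_pro_of_system Ops_pro_of_system pro_arrow_def \<phi>D)
  next
    fix n m n' m' f g assume "f \<in> Ops (pro_of_system X) n m" "g \<in> Ops (pro_of_system X) n' m'"
    then have "m = n" "m' = n'" "1 \<le> n" "1 \<le> n'" "f \<in> carrier (grp X n)" "g \<in> carrier (grp X n')"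
      by (auto simp: Ops_pro_of_system split: if_splits)
    then show "pro_arrow \<phi> (n + n') (m + m') (hor (pro_of_system X) n m n' m' f g)
        = hor (pro_of_system Y) n m n' m' (pro_arrow \<phi> n m f) (pro_arrow \<phi> n' m' g)"
      using X.hor_pro_of_system[of f n n g n' n'] Y.hor_pro_of_system[of "\<phi> n f" n n "\<phi> n' g" n' n']
      by (simp add: Ops_pro_of_system pro_arrow_def \<phi>D hprod)
  qed (auto simp: Ops_pro_of_system Proj_pro_of_system idn_pro_of_system pro_arrow_def \<phi>D one sp
    split: if_splits)
qed

lemma pro_arrow_extensional:
  "(\<And>n. \<phi> n \<in> extensional (carrier (grp X n))) \<Longrightarrow> normalized_system X
    \<Longrightarrow> pro_arrow \<phi> n m \<in> extensional (Ops (pro_of_system X) n m)"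
  using normalized_system.carrier_pos[of X]
    by (auto simp: pro_arrow_def extensional_def Ops_pro_of_system)

lemma system_morphism_system_arrow:
  assumes "normalized_pro P" "normalized_pro Q" and F: "cloning_pro_morphism P Q F"
  shows "system_morphism (system_of_pro P) (system_of_pro Q) (system_arrow F)"
proof -
  interpret P: normalized_pro P by fact
  interpret Q: normalized_pro Q by fact
  note FD = cloning_pro_morphismD[OF F]
  show ?thesis
  proof (rule system_morphismI)
    fix n g assume n: "1 \<le> n" and "g \<in> carrier (grp (system_of_pro P) n)"
    then have g: "g \<in> Ops P n n" and Fg: "F n n g \<in> Ops Q n n"
      using FD(1)[of n n g] by simp_all
    show "system_arrow F n g \<in> carrier (grp (system_of_pro Q) n)"
      using Fg by (simp add: system_arrow_def)
    show "system_arrow F (Suc n) (iota (system_of_pro P) n g)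
      = iota (system_of_pro Q) n (system_arrow F n g)"
      using FD(4)[of n n 1 1 g "idn P 1"] FD(2)[of 1] n g P.idn_closed[of 1]
      by (simp add: system_arrow_def P.iota_system_of_pro[OF g] Q.iota_system_of_pro[OF Fg])
    show "system_arrow F (Suc n) (zeta (system_of_pro P) n g)
      = zeta (system_of_pro Q) n (system_arrow F n g)"
      using FD(4)[of 1 1 n n "idn P 1" g] FD(2)[of 1] n g P.idn_closed[of 1]
      by (simp add: system_arrow_def P.zeta_system_of_pro[OF g] Q.zeta_system_of_pro[OF Fg])
    show "proj (system_of_pro Q) n (system_arrow F n g) = proj (system_of_pro P) n g"
      using FD(5)[OF n n g] by (simp add: system_arrow_def P.proj_system_of_pro[OF g]
        Q.proj_system_of_pro[OF Fg])
    fix h assume "h \<in> carrier (grp (system_of_pro P) n)"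
    then show "system_arrow F n (g \<otimes>\<^bsub>grp (system_of_pro P) n\<^esub> h)
        = system_arrow F n g \<otimes>\<^bsub>grp (system_of_pro Q) n\<^esub> system_arrow F n h"
      using FD(3)[of n n n g h] n g by (simp add: system_arrow_def)
  next
    fix n j g assume j: "1 \<le> j" "j \<le> n" and "g \<in> carrier (grp (system_of_pro P) n)"
    then have n: "1 \<le> n" and g: "g \<in> Ops P n n" and Fg: "F n n g \<in> Ops Q n n"
      using FD(1)[of n n g] by simp_all
    show "system_arrow F (Suc n) (kappa (system_of_pro P) n j g)
      = kappa (system_of_pro Q) n j (system_arrow F n g)"
      using FD(6)[OF valid_tuple_two_at[OF n, of j], of g] g sum_list_two_at[OF j]
      by (simp add: system_arrow_def P.kappa_system_of_pro[OF j g] Q.kappa_system_of_pro[OF j Fg])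
  qed
qed

lemma functor_pro_of_system:
  "category_functor (operadic_systems :: ('a bilateral_cloning_data, nat \<Rightarrow> 'a \<Rightarrow> 'a) category)
    cloning_pros
    pro_of_system (\<lambda>S T. pro_arrow)"
proof (intro category_functor.intro category_functor_axioms.intro category_operadic_systems
  category_cloning_pros)
  fix X :: "'a bilateral_cloning_data" assume "X \<in> Obj operadic_systems"
  then have X: "normalized_system X"
    by (simp add: Obj_operadic_systems)
  then show "pro_of_system X \<in> Obj cloning_pros"
    by (simp add: Obj_cloning_pros normalized_pro_pro_of_system)
  show "pro_arrow (Ident operadic_systems X) = Ident cloning_pros (pro_of_system X)"
    using normalized_system.carrier_pos[OF X]
    by (auto simp: operadic_systems_def cloning_pros_def pro_arrow_def Ops_pro_of_system fun_eq_iff)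
next
  fix X Y :: "'a bilateral_cloning_data" and f
  assume "X \<in> Obj operadic_systems" "Y \<in> Obj operadic_systems" "f \<in> Hom operadic_systems X Y"
  then show "pro_arrow f \<in> Hom cloning_pros (pro_of_system X) (pro_of_system Y)"
    by (auto simp: Obj_operadic_systems Hom_operadic_systems Hom_cloning_pros
        intro: cloning_pro_morphism_pro_arrow pro_arrow_extensional)
next
  fix X Y Z :: "'a bilateral_cloning_data" and f g
  assume "X \<in> Obj operadic_systems"
  then have X: "normalized_system X"
    by (simp add: Obj_operadic_systems)
  show "pro_arrow (Comp operadic_systems X Y Z g f)
      = Comp cloning_pros (pro_of_system X) (pro_of_system Y) (pro_of_system Z) (pro_arrow g)
        (pro_arrow f)"
    using normalized_system.carrier_pos[OF X]
    by (auto simp: operadic_systems_def cloning_pros_def pro_arrow_def Ops_pro_of_system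
      compose_def fun_eq_iff)
qed

lemma functor_system_of_pro:
  "category_functor (cloning_pros :: ('a cloning_pro_data, nat \<Rightarrow> nat \<Rightarrow> 'a \<Rightarrow> 'a) category)
    operadic_systems
    system_of_pro (\<lambda>P Q. system_arrow)"
proof (intro category_functor.intro category_functor_axioms.intro category_operadic_systems
  category_cloning_pros)
  fix P :: "'a cloning_pro_data" assume "P \<in> Obj cloning_pros"
  then have P: "normalized_pro P"
    by (simp add: Obj_cloning_pros)
  then show "system_of_pro P \<in> Obj operadic_systems"
    by (simp add: Obj_operadic_systems normalized_system_system_of_pro)
  show "system_arrow (Ident cloning_pros P) = Ident operadic_systems (system_of_pro P)"
    using normalized_pro.carrier_system_of_pro[OF P]
    by (simp add: operadic_systems_def cloning_pros_def system_arrow_def fun_eq_iff)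
next
  fix P Q :: "'a cloning_pro_data" and F
  assume "P \<in> Obj cloning_pros" "Q \<in> Obj cloning_pros" "F \<in> Hom cloning_pros P Q"
  then show "system_arrow F \<in> Hom operadic_systems (system_of_pro P) (system_of_pro Q)"
    using system_morphism_system_arrow[of P Q F] normalized_pro.carrier_system_of_pro[of P]
    by (simp add: Obj_cloning_pros Hom_operadic_systems Hom_cloning_pros system_arrow_def)
next
  fix P Q R :: "'a cloning_pro_data" and F G
  assume "P \<in> Obj cloning_pros"
  then have P: "normalized_pro P"
    by (simp add: Obj_cloning_pros)
  show "system_arrow (Comp cloning_pros P Q R G F)
      = Comp operadic_systems (system_of_pro P) (system_of_pro Q) (system_of_pro R)
        (system_arrow G) (system_arrow F)"
    using normalized_pro.carrier_system_of_pro[OF P]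
    by (simp add: operadic_systems_def cloning_pros_def system_arrow_def fun_eq_iff)
qed

lemma mutually_inverse_pro_system:
  "mutually_inverse_functors (operadic_systems :: ('a bilateral_cloning_data, nat \<Rightarrow> 'a \<Rightarrow> 'a)
    category) cloning_pros
    pro_of_system (\<lambda>S T. pro_arrow) system_of_pro (\<lambda>P Q. system_arrow)"
proof (intro mutually_inverse_functors.intro mutually_inverse_functors_axioms.intro
    functor_pro_of_system functor_system_of_pro)
  fix X :: "'a bilateral_cloning_data" assume "X \<in> Obj operadic_systems"
  then show "system_of_pro (pro_of_system X) = X"
    by (simp add: Obj_operadic_systems normalized_system.system_of_pro_of_system)
next
  fix P :: "'a cloning_pro_data" assume "P \<in> Obj cloning_pros"
  then show "pro_of_system (system_of_pro P) = P"
    by (simp add: Obj_cloning_pros normalized_pro.pro_of_system_of_pro)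
next
  fix f :: "nat \<Rightarrow> 'a \<Rightarrow> 'a"
  show "system_arrow (pro_arrow f) = f"
    by (simp add: system_arrow_def pro_arrow_def fun_eq_iff)
next
  fix P Q :: "'a cloning_pro_data" and F
  assume "P \<in> Obj cloning_pros" "F \<in> Hom cloning_pros P Q"
  then have P: "normalized_pro P" and F: "\<And>n m. F n m \<in> extensional (Ops P n m)"
    by (simp_all add: Obj_cloning_pros Hom_cloning_pros)
  show "pro_arrow (system_arrow F) = F"
  proof (intro ext)
    fix n m f
    \<comment> \<open>Off the diagonal the domain is empty, and extensionality determines the arrow
      there.\<close>
    have "F n m f = undefined" if "n \<noteq> m"
      using F[of n m] normalized_pro.Ops_diag[OF P, of f n m] that by (auto simp: extensional_def)
    then show "pro_arrow (system_arrow F) n m f = F n m f"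
      by (simp add: system_arrow_def pro_arrow_def)
  qed
qed

section \<open>Restriction to full subcategories\<close>

lemma category_full_subcategory: "category C \<Longrightarrow> category (full_subcategory C Q)"
  unfolding category_def full_subcategory_def by simp

text \<open>One equivalence of the predicates along \<open>Fo\<close> suffices; the one along
  \<open>Go\<close> follows because \<open>Fo\<close> inverts \<open>Go\<close> on objects.\<close>

lemma mutually_inverse_full_subcategories:
  assumes "mutually_inverse_functors C D Fo Fa Go Ga" and QR: "\<And>X. X \<in> Obj C \<Longrightarrow> Q X \<longleftrightarrow> R (Fo X)"
  shows "mutually_inverse_functors (full_subcategory C Q) (full_subcategory D R) Fo Fa Go Ga"
proof -
  interpret mutually_inverse_functors C D Fo Fa Go Ga by fact

  have RQ: "R Y \<longleftrightarrow> Q (Go Y)" if "Y \<in> Obj D" for Y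
    using QR[OF G.obj_map[OF that]] FG_obj[OF that] by simp
  show ?thesis
    using category_full_subcategory[OF F.source.category_axioms]
      category_full_subcategory[OF F.target.category_axioms]
    by (intro mutually_inverse_functors.intro mutually_inverse_functors_axioms.intro
        category_functor.intro category_functor_axioms.intro)
      (auto simp: full_subcategory_def F.obj_map F.hom_map F.map_ident F.map_comp G.obj_map G.hom_map
        G.map_ident G.map_comp GF_obj GF_hom FG_obj FG_hom QR RQ)
qed

text \<open>The values of \<pi>(g) on strands are at least 1, so a value of the signed projection is
  positive exactly when there is no flip.\<close>

lemma restricted_iff:
  assumes "normalized_system X"
  shows "restricted_system X \<longleftrightarrow> restricted_pro (pro_of_system X)"
proof -
  interpret X: normalized_system X by fact
  have "restricted_system X \<longleftrightarrow> (\<forall>n j. \<forall>g \<in> carrier (grp X n). 1 \<le> j \<longrightarrow> j \<le> n \<longrightarrow> \<not> flips X n j g)"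
    by (auto simp: restricted_system_def flips_def)
  also have "\<dots> \<longleftrightarrow> (\<forall>n \<ge> 1. \<forall>g \<in> carrier (grp X n). \<forall>j. 1 \<le> j \<longrightarrow> j \<le> n \<longrightarrow> signed_proj X n g (int j) > 0)"
  proof -
    have "signed_proj X n g (int j) > 0 \<longleftrightarrow> \<not> flips X n j g"
      if "g \<in> carrier (grp X n)" "1 \<le> j" "j \<le> n" for n j g
      using X.proj_in[OF that(2,3,1)] that(2,3) by (simp add: signed_proj_flips)
    then show ?thesis
      using X.carrier_pos by blast
  qed
  also have "\<dots> \<longleftrightarrow> (\<forall>n \<ge> 1. \<forall>g \<in> carrier (grp X n). signed_proj X n g \<in> positive_perms n)"
  proof -
    have "(\<forall>j. 1 \<le> j \<longrightarrow> j \<le> n \<longrightarrow> h (int j) > 0) \<longleftrightarrow> (\<forall>i \<in> {1..int n}. h i > 0)" for n and h :: "int \<Rightarrow> int"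
    proof
      assume h: "\<forall>j. 1 \<le> j \<longrightarrow> j \<le> n \<longrightarrow> h (int j) > 0"
      show "\<forall>i \<in> {1..int n}. h i > 0"
      proof
        fix i assume "i \<in> {1..int n}"
        then show "h i > 0"
          using h[rule_format, of "nat i"] by auto
      qed
    qed auto
    then show ?thesis
      using X.signed_proj_in_signed_perms by (auto simp: positive_perms_def)
  qed
  also have "\<dots> \<longleftrightarrow> restricted_pro (pro_of_system X)"
    by (auto simp: restricted_pro_def Ops_pro_of_system Proj_pro_of_system)
  finally show ?thesis .
qed

theorem theorem8p8:
  shows "mutually_inverse_functors
      (operadic_systems :: ('a bilateral_cloning_data, nat \<Rightarrow> 'a \<Rightarrow> 'a) category)
      (cloning_pros :: ('a cloning_pro_data, nat \<Rightarrow> nat \<Rightarrow> 'a \<Rightarrow> 'a) category)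
      pro_of_system (\<lambda>S T. pro_arrow) system_of_pro (\<lambda>P Q. system_arrow)
    \<and> mutually_inverse_functors
      (restricted_operadic_systems :: ('a bilateral_cloning_data, nat \<Rightarrow> 'a \<Rightarrow> 'a) category)
      (restricted_cloning_pros :: ('a cloning_pro_data, nat \<Rightarrow> nat \<Rightarrow> 'a \<Rightarrow> 'a) category)
      pro_of_system (\<lambda>S T. pro_arrow) system_of_pro (\<lambda>P Q. system_arrow)"
  unfolding restricted_operadic_systems_def restricted_cloning_pros_def
  by (intro conjI mutually_inverse_pro_system mutually_inverse_full_subcategories)
    (simp add: Obj_operadic_systems restricted_iff)

end
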